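(* Let $r,g,\mathfrak{V}\geq 1$ be integers and let $0<\varepsilon,\delta,\lambda<1$ be real numbers, all fixed. For $x\geq 1$ put $z:=\mathrm{e}^{(\log x)^{1-\lambda}}$. There exist constants $K,c_0>0$, and an implicit constant in $\ll$ below, all depending at most on $r,g,\mathfrak{V},\varepsilon,\delta,\lambda$, such that the following holds. Let $Q_1,\dots,Q_r\in\mathbb{Z}[X]$ be irreducible polynomials, pairwise coprime and without fixed divisor, whose product $Q=\prod_{1\leq j\leq r}Q_j$ has degree $g$, and let $\beta, D,\|Q\|,\rho_j,\varphi_0,M,M'$ be the associated quantities (see context). Then, uniformly for $x\geq c_0\|Q\|^{\delta}$, $x^{\varepsilon}<y\leq x$, and additive functions $f_1,\dots,f_r$ satisfying, for every $1\leq j\leq r$, \[\#\left\{f_j(n)\,:\ n\leq t^u,\ P^-(n)>t\right\}\leq\mathfrak{V}^{u}\qquad(t\geq z,\ u\geq 1),\] one has \[\sup_{k_1,\dots,k_r\in\mathbb{R}}\ \sum_{\substack{x<n\leq x+y\\ f_j(Q_j(n))=k_j\ (1\leq j\leq r)}}1\ \ll\ \left(\frac{\beta D}{\varphi_0(\beta D)}\right)^{K}\frac{\mathrm{e}^{3M+M'/z}\,y}{\prod_{1\leq j\leq r}\sqrt{E_{f_j}(x;\rho_j)}}.\]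
   Context: Throughout, $p$ denotes a prime number and $n$ an integer; $\log_2=\log\log$. $P^-(n)$ is the smallest prime factor of $n\ge 1$, with $P^-(1)=+\infty$. Additive functions are real-valued functions $f$ on the positive integers with $f(mn)=f(m)+f(n)$ whenever $(m,n)=1$. An additive or multiplicative function is extended to $\mathbb{Z}$ by parity ($f(-n)=f(n)$) and by giving it the value $0$ at $0$. For $f$ additive, $\rho\geq 0$ multiplicative and $x\geq 2$, \[E_f(x;\rho):=1+\sum_{p\leq x,\ f(p)\neq 0}\frac{\rho(p)}{p}.\] Setting on polynomials. $\{Q_j\}_{1\leq j\leq r}$ is a family of irreducible polynomials of $\mathbb{Z}[X]$, pairwise coprime and without fixed divisor (for each $j$, no prime divides $Q_j(n)$ for all $n\in\mathbb{Z}$). Put $Q:=\prod_{1\leq j\leq r}Q_j$, $g:=\deg Q$, $Q(X)=\sum_{0\leq i\leq g}\beta_iX^i$, $\beta:=\beta_g$, $\|Q\|:=\max_{0\leq i\leq g}|\beta_i|$. $D$ is the discriminant of $Q$. For $m\geq 1$, $\rho_j(m)$ ($1\le j\le r$) is the number of roots of $Q_j$ in $\mathbb{Z}/m\mathbb{Z}$ and $\rho_0(m)$ is the number of roots of $Q$ in $\mathbb{Z}/m\mathbb{Z}$. For $n\geq1$, \[\varphi_0(n):=n\prod_{p\mid n}\left(1-\frac{\rho_0(p)}{p}\right),\] and $\beta D/\varphi_0(\beta D)$ is understood as $|\beta D|/\varphi_0(|\beta D|)=\prod_{p\mid\beta D}(1-\rho_0(p)/p)^{-1}$ (equal to $+\infty$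 if $\varphi_0(|\beta D|)=0$). For $1\leq j\leq r$, $M_j,M_j'\geq 1$ denote constants (depending on $Q_j$), whose existence is a known fact, such that for all $x\geq 2$ \[\left|\sum_{p\leq x}\frac{\rho_j(p)}{p}-\log_2x\right|\leq M_j,\qquad \sum_{p\leq x}\rho_j(p)=\mathrm{li}(x)+O\left(M_j'+x\exp(-c\sqrt{\log x})\right),\] where $c=c(g)>0$ and the implied constant depend at most on $g$, and $\mathrm{li}$ is the logarithmic integral. Put $M:=\sum_{1\leq j\leq r}M_j$, $M':=\sum_{1\leq j\leq r}M_j'$. *)

theory Defs
  imports "HOL-Analysis.Analysis" "Subresultants.Resultant_Prelim"
begin

definition additive_fun :: "(nat \<Rightarrow> real) \<Rightarrow> bool" where
  "additive_fun f \<longleftrightarrow>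
     (\<forall>m n. m \<ge> 1 \<longrightarrow> n \<ge> 1 \<longrightarrow> coprime m n \<longrightarrow> f (m * n) = f m + f n)"

(* The value of f at the natural number 0 is irrelevant: it is never used. *)
definition ext_even :: "(nat \<Rightarrow> real) \<Rightarrow> int \<Rightarrow> real" where
  "ext_even f n = (if n = 0 then 0 else f (nat \<bar>n\<bar>))"

(* Extended-real-valued: the infimum of the empty set gives P^-(1) = \<infinity>. *)
definition least_prime_factor :: "nat \<Rightarrow> ereal" where
  "least_prime_factor n = (INF p\<in>{p. prime p \<and> p dvd n}. ereal (real p))"

definition num_roots_mod :: "int poly \<Rightarrow> nat \<Rightarrow> nat" where
  "num_roots_mod q m = card {a \<in> {0..<int m}. int m dvd poly q a}"

definition E_sum :: "(nat \<Rightarrow> real) \<Rightarrow> (nat \<Rightarrow> real) \<Rightarrow> real \<Rightarrow> real" where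
  "E_sum f \<rho> x = 1 + (\<Sum>p | prime p \<and> real p \<le> x \<and> f p \<noteq> 0. \<rho> p / real p)"

(* li from 2; any other base point changes li by a constant, which is absorbed by the
   error term O(M') since M' \<ge> 1. *)
definition log_integral :: "real \<Rightarrow> real" where
  "log_integral x = integral {2..x} (\<lambda>t. 1 / ln t)"

definition no_fixed_divisor :: "int poly \<Rightarrow> bool" where
  "no_fixed_divisor q \<longleftrightarrow> (\<forall>p::nat. prime p \<longrightarrow> (\<exists>n::int. \<not> int p dvd poly q n))"

definition poly_height :: "int poly \<Rightarrow> int" where
  "poly_height q = Max ((\<lambda>i. \<bar>coeff q i\<bar>) ` {0..degree q})"

(* The first column of the Sylvester matrix of q and q' is divisible by the leading
   coefficient of q, so the integer division is exact. *)
definition poly_discriminant :: "int poly \<Rightarrow> int" where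
  "poly_discriminant q =
     (-1) ^ (degree q * (degree q - 1) div 2) * (resultant q (pderiv q) div lead_coeff q)"

definition phi_roots :: "int poly \<Rightarrow> nat \<Rightarrow> real" where
  "phi_roots q n =
     real n * (\<Prod>p | prime p \<and> p dvd n. 1 - real (num_roots_mod q p) / real p)"

(* The quotient |\<beta>D| / \<phi>\<^sub>0(|\<beta>D|). Since a / 0 = \<infinity> for a > 0 in ereal and \<beta>D \<noteq> 0, it is
   \<infinity> exactly when \<phi>\<^sub>0(|\<beta>D|) = 0. *)
definition disc_ratio :: "int poly \<Rightarrow> ereal" where
  "disc_ratio q =
     (let N = nat \<bar>lead_coeff q * poly_discriminant q\<bar> in ereal (real N) / ereal (phi_roots q N))"

(* Real powers of nonnegative extended reals, for positive exponents. *)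
definition ereal_powr :: "ereal \<Rightarrow> real \<Rightarrow> ereal" where
  "ereal_powr a K = (if a = \<infinity> then \<infinity> else ereal (real_of_ereal a powr K))"

definition poly_family :: "nat \<Rightarrow> nat \<Rightarrow> (nat \<Rightarrow> int poly) \<Rightarrow> bool" where
  "poly_family r g Q \<longleftrightarrow>
     (\<forall>j\<in>{1..r}. irreducible (Q j) \<and> no_fixed_divisor (Q j)) \<and>
     (\<forall>i\<in>{1..r}. \<forall>j\<in>{1..r}. i \<noteq> j \<longrightarrow> coprime (Q i) (Q j)) \<and>
     degree (\<Prod>j=1..r. Q j) = g"

(* m and m' are admissible values of M_j and M_j' for the polynomial q; here c is the
   constant in the exponential and C the implied constant of the second estimate. *)
definition prime_sum_bounds :: "real \<Rightarrow> real \<Rightarrow> int poly \<Rightarrow> real \<Rightarrow> real \<Rightarrow> bool" where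
  "prime_sum_bounds c C q m m' \<longleftrightarrow> m \<ge> 1 \<and> m' \<ge> 1 \<and>
     (\<forall>x::real. x \<ge> 2 \<longrightarrow>
        \<bar>(\<Sum>p | prime p \<and> real p \<le> x. real (num_roots_mod q p) / real p) - ln (ln x)\<bar> \<le> m \<and>
        \<bar>(\<Sum>p | prime p \<and> real p \<le> x. real (num_roots_mod q p)) - log_integral x\<bar>
          \<le> C * (m' + x * exp (- c * sqrt (ln x))))"

definition value_count_bound :: "nat \<Rightarrow> real \<Rightarrow> (nat \<Rightarrow> real) \<Rightarrow> bool" where
  "value_count_bound V z f \<longleftrightarrow>
     (\<forall>t u::real. t \<ge> z \<longrightarrow> u \<ge> 1 \<longrightarrow>
        real (card (f ` {n. n \<ge> 1 \<and> real n \<le> t powr u \<and> least_prime_factor n > ereal t}))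
          \<le> real V powr u)"

end

theory Submission
  imports Defs "HOL-Number_Theory.Cong" "HOL-Analysis.Kronecker_Approximation_Theorem"
    "Subresultants.Subresultant_Gcd" "HOL-Real_Asymp.Real_Asymp"
begin

text \<open>
  Write \<open>Q_j(n) = a_j b_j\<close> with \<open>a_j\<close> composed of the primes below \<open>s\<close> and \<open>b_j\<close> free of
  them, where \<open>s\<close> is the first prime at which the smooth part of \<open>Q(n)\<close> exceeds a small power
  of \<open>y\<close>. The hypothesis on \<open>f_j\<close> leaves few values for \<open>f_j(b_j)\<close>, so \<open>f_j(a_j)\<close> is confined to
  few values as well. For given \<open>a_1, \<dots>, a_r\<close>, Selberg's sieve bounds the number of \<open>n\<close> by \<open>y\<close>
  times a product of local densities, uniformly in \<open>a_1, \<dots>, a_r\<close>. Since these are the exact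
  densities of the events \<open>v_p(Q_j(n)) = e_j\<close>, what remains is the probability that a sum
  of independent random vectors, indexed by the primes, takes a prescribed value. For the primes
  not dividing \<open>\<beta>D\<close>, at most one coordinate of the vector is nonzero; the characteristic function
  then splits over \<open>j\<close>, and Jensen's inequality yields the factors \<open>1 / sqrt E\<close>. If \<open>s\<close> is
  small, a smooth part of that size has very many prime factors, and tilting the measure (Rankin's
  trick) gains more than the number of values of the \<open>f_j(b_j)\<close> costs.
\<close>

section \<open>Sums over primes\<close>

text \<open>The hypothesis allows V^u values of \<open>f_j(b_j)\<close> with u of order log x / log
  s: harmless if s is a fixed power of x, ruinous below. What saves small s is that a smooth part of
  size at least y^(1/8) is built from primes at most T: the tilt \<sigma> = C / log T gains
  exp(-(C/8) log y / log T), the same shape as the loss, and C is chosen to win. Cutting at a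
  variable s keeps the smooth part below y^(1/4), so the congruences have modulus at most sqrt y and
  leave room for the sieve; blocks, dyadic in log s, make s comparable to a fixed T. Two obstacles
  remain. A single prime power may make the smooth part jump; such n are few and are set aside.
  Below z nothing is known about \<open>f_j\<close>: there the functions are dropped, and Rankin's
  gain exp(-(\<epsilon>/2)(log x)^lam) beats the (log x)^r that the sqrt E can cost, up to the M_j.
  For uniformity, root counts modulo prime powers are bounded through the degree alone, and the
  discriminant enters only through its prime divisors.\<close>

definition primes_le :: "real \<Rightarrow> nat set" where
  "primes_le T = {p. prime p \<and> real p \<le> T}"

lemma finite_primes_le [simp, intro]: "finite (primes_le T)"
proof (rule finite_subset)
  show "primes_le T \<subseteq> {..nat \<lfloor>T\<rfloor>}"
    by (auto simp: primes_le_def le_nat_floor)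
qed auto

lemma primes_leD: "p \<in> primes_le T \<Longrightarrow> prime p" "p \<in> primes_le T \<Longrightarrow> real p \<le> T"
  "p \<in> primes_le T \<Longrightarrow> p \<ge> 2"
  by (auto simp: primes_le_def prime_ge_2_nat)

lemma primes_le_mono: "S \<le> T \<Longrightarrow> primes_le S \<subseteq> primes_le T"
  by (auto simp: primes_le_def)

lemma prod_primes_dvd:
  fixes k :: nat
  assumes "finite P" "\<And>p. p \<in> P \<Longrightarrow> prime p" "\<And>p. p \<in> P \<Longrightarrow> p dvd k"
  shows "\<Prod>P dvd k"
  using assms
proof (induction P rule: finite_induct)
  case (insert p P)
  have "coprime p (\<Prod>P)"
    by (rule prod_coprime_right) (use insert in \<open>auto intro!: primes_coprime\<close>)
  with insert show ?case by (auto intro!: divides_mult)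
qed auto

lemma sum_ln_prime_divisors_le:
  fixes k :: nat
  assumes "k \<ge> 1"
  shows "(\<Sum>p | prime p \<and> p dvd k. ln (real p)) \<le> ln (real k)"
proof -
  let ?P = "{p. prime p \<and> p dvd k}"
  have fin: "finite ?P" by (rule finite_subset[of _ "{..k}"]) (use assms in \<open>auto dest: dvd_imp_le\<close>)
  have "(\<Sum>p\<in>?P. ln (real p)) = ln (\<Prod>p\<in>?P. real p)"
    using fin by (subst ln_prod) (auto intro: prime_gt_0_nat)
  also have "(\<Prod>p\<in>?P. real p) = real (\<Prod>?P)" by simp
  also have "ln \<dots> \<le> ln (real k)"
  proof -
    have "\<Prod>?P dvd k" by (rule prod_primes_dvd) (use fin in auto)
    hence "\<Prod>?P \<le> k" using assms by (intro dvd_imp_le) auto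
    moreover have "\<Prod>?P > 0" by (intro prod_pos) (auto intro: prime_gt_0_nat)
    ultimately show ?thesis by (intro ln_mono) (simp_all only: of_nat_0_less_iff of_nat_le_iff)
  qed
  finally show ?thesis .
qed

lemma card_multiples_atMost:
  fixes p n :: nat
  assumes "p > 0"
  shows "card {k\<in>{1..n}. p dvd k} = n div p"
proof -
  have "{k\<in>{1..n}. p dvd k} = (\<lambda>i. p * i) ` {1..n div p}"
  proof (intro equalityI subsetI)
    fix k assume "k \<in> {k\<in>{1..n}. p dvd k}"
    then obtain i where "k = p * i" "1 \<le> k" "k \<le> n" by (auto elim!: dvdE)
    thus "k \<in> (\<lambda>i. p * i) ` {1..n div p}" using assms
      by (auto simp: less_eq_div_iff_mult_less_eq mult.commute intro!: imageI)
  next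
    fix k assume "k \<in> (\<lambda>i. p * i) ` {1..n div p}"
    thus "k \<in> {k\<in>{1..n}. p dvd k}" using assms
      by (auto simp: less_eq_div_iff_mult_less_eq mult.commute)
  qed
  thus ?thesis using assms by (simp add: card_image inj_on_def)
qed

text \<open>Chebyshev's double count: \<open>ln p\<close> summed over all pairs of a prime p and a
  multiple k of p up to n is at most the sum of \<open>ln k\<close>, hence at most
  \<open>n * ln n\<close>. The factor 2 comes from \<open>n div p\<close> being at least n / (2p).
  An upper bound of this order is all that the Rankin estimates require.\<close>

lemma sum_ln_prime_over_prime_le_nat:
  fixes n :: nat
  assumes n: "n \<ge> 1"
  shows "(\<Sum>p | prime p \<and> p \<le> n. ln (real p) / real p) \<le> 2 * ln (real n)"
proof -
  let ?P = "{p. prime p \<and> p \<le> n}"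
  have "(\<Sum>p\<in>?P. ln (real p) * real n / (2 * real p)) \<le> (\<Sum>p\<in>?P. ln (real p) * real (n div p))"
  proof (rule sum_mono)
    fix p assume p: "p \<in> ?P"
    hence p0: "p \<ge> 2" by (auto simp: prime_ge_2_nat)
    have d1: "n div p \<ge> 1" using p p0 by (simp add: div_greater_zero_iff Suc_le_eq)
    have "n < p * (n div p) + p"
      using p0 by (metis add.commute dividend_less_times_div mult.commute order_less_le_trans not_numeral_le_zero neq0_conv)
    also have "\<dots> \<le> 2 * p * (n div p)" using d1 by (simp add: algebra_simps)
    finally have "real n \<le> real (2 * p * (n div p))" by linarith
    hence "real n / (2 * real p) \<le> real (n div p)" using p0 by (simp add: field_simps)
    thus "ln (real p) * real n / (2 * real p) \<le> ln (real p) * real (n div p)"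
      using p0 by (simp add: mult_left_mono flip: times_divide_eq_right)
  qed
  also have "\<dots> = (\<Sum>p\<in>?P. \<Sum>k\<in>{1..n}. if p dvd k then ln (real p) else 0)"
  proof (rule sum.cong)
    fix p assume p: "p \<in> ?P"
    have "(\<Sum>k\<in>{1..n}. if p dvd k then ln (real p) else 0) = (\<Sum>k\<in>{k\<in>{1..n}. p dvd k}. ln (real p))"
      by (rule sum.inter_filter[symmetric]) auto
    also have "\<dots> = real (n div p) * ln (real p)"
      using card_multiples_atMost[of p n] p by (simp add: prime_gt_0_nat)
    finally show "ln (real p) * real (n div p) = (\<Sum>k\<in>{1..n}. if p dvd k then ln (real p) else 0)"
      by simp
  qed auto
  also have "\<dots> = (\<Sum>k\<in>{1..n}. \<Sum>p\<in>?P. if p dvd k then ln (real p) else 0)"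
    by (rule sum.swap)
  also have "\<dots> \<le> (\<Sum>k\<in>{1..n}. ln (real n))"
  proof (rule sum_mono)
    fix k assume k: "k \<in> {1..n}"
    have "(\<Sum>p\<in>?P. if p dvd k then ln (real p) else 0) = (\<Sum>p\<in>{p\<in>?P. p dvd k}. ln (real p))"
      by (rule sum.inter_filter[symmetric]) auto
    also have "{p\<in>?P. p dvd k} = {p. prime p \<and> p dvd k}"
      using k by (auto dest: dvd_imp_le)
    also have "(\<Sum>p\<in>\<dots>. ln (real p)) \<le> ln (real k)" using k by (intro sum_ln_prime_divisors_le) auto
    also have "\<dots> \<le> ln (real n)" using k by simp
    finally show "(\<Sum>p\<in>?P. if p dvd k then ln (real p) else 0) \<le> ln (real n)" .
  qed
  also have "\<dots> = real n * ln (real n)" by simp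
  finally have "real n / 2 * (\<Sum>p\<in>?P. ln (real p) / real p) \<le> real n / 2 * (2 * ln (real n))"
    by (simp add: sum_distrib_left mult_ac)
  thus ?thesis using n by (subst (asm) mult_le_cancel_left_pos) auto
qed

lemma sum_ln_prime_over_prime_le:
  assumes T: "T \<ge> 1"
  shows "(\<Sum>p\<in>primes_le T. ln (real p) / real p) \<le> 2 * ln T"
proof -
  have "real p \<le> T \<longleftrightarrow> p \<le> nat \<lfloor>T\<rfloor>" for p :: nat
  proof
    assume "p \<le> nat \<lfloor>T\<rfloor>"
    hence "real p \<le> real (nat \<lfloor>T\<rfloor>)" by simp
    also have "\<dots> \<le> T" using T by (intro of_nat_floor) auto
    finally show "real p \<le> T" .
  qed (rule le_nat_floor)
  hence eq: "primes_le T = {p. prime p \<and> p \<le> nat \<lfloor>T\<rfloor>}"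
    by (simp add: primes_le_def)
  have "(\<Sum>p\<in>primes_le T. ln (real p) / real p) \<le> 2 * ln (real (nat \<lfloor>T\<rfloor>))"
    unfolding eq by (rule sum_ln_prime_over_prime_le_nat) (use T le_nat_floor[of 1 T] in simp)
  also have "\<dots> \<le> 2 * ln T"
  proof -
    have "nat \<lfloor>T\<rfloor> \<ge> 1" using T le_nat_floor[of 1 T] by simp
    moreover have "real (nat \<lfloor>T\<rfloor>) \<le> T" using T by (intro of_nat_floor) auto
    ultimately have "ln (real (nat \<lfloor>T\<rfloor>)) \<le> ln T" by (intro ln_mono) linarith+
    thus ?thesis by simp
  qed
  finally show ?thesis .
qed

lemma powr_minus_one_le:
  fixes x \<sigma> b :: real
  assumes "x \<ge> 1" "\<sigma> \<ge> 0" "\<sigma> * ln x \<le> b"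
  shows "x powr \<sigma> - 1 \<le> \<sigma> * ln x * exp b"
proof -
  let ?v = "\<sigma> * ln x"
  have v: "?v \<ge> 0" using assms by simp
  have "exp (-?v) \<ge> 1 - ?v" using exp_ge_add_one_self[of "-?v"] by simp
  hence "exp ?v * exp (-?v) \<ge> exp ?v * (1 - ?v)" by (intro mult_left_mono) auto
  hence "exp ?v - 1 \<le> ?v * exp ?v" by (simp add: algebra_simps flip: exp_add)
  also have "\<dots> \<le> ?v * exp b" using assms v by (intro mult_left_mono) auto
  finally show ?thesis using assms by (simp add: powr_def)
qed

text \<open>The price of Rankin's trick: tilting the weight \<open>1 / p\<close> to \<open>p powr \<sigma> / p\<close> for \<open>p \<le> T\<close> is
  harmless as long as \<open>\<sigma> * ln T\<close> stays bounded.\<close>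

lemma rankin_cost:
  assumes "T \<ge> 1" "\<sigma> \<ge> 0" "\<sigma> * ln T \<le> b"
  shows "(\<Sum>p\<in>primes_le T. (real p powr \<sigma> - 1) / real p) \<le> 2 * b * exp b"
proof -
  have b0: "b \<ge> 0" using assms by (meson ln_ge_zero mult_nonneg_nonneg order_trans)
  have "(\<Sum>p\<in>primes_le T. (real p powr \<sigma> - 1) / real p) \<le>
        (\<Sum>p\<in>primes_le T. \<sigma> * exp b * (ln (real p) / real p))"
  proof (rule sum_mono)
    fix p assume p: "p \<in> primes_le T"
    hence p2: "p \<ge> 2" "real p \<le> T" by (auto dest: primes_leD)
    have "\<sigma> * ln (real p) \<le> \<sigma> * ln T" using p2 assms by (intro mult_left_mono ln_mono) auto
    hence "real p powr \<sigma> - 1 \<le> \<sigma> * ln (real p) * exp b"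
      using assms p2 by (intro powr_minus_one_le) auto
    thus "(real p powr \<sigma> - 1) / real p \<le> \<sigma> * exp b * (ln (real p) / real p)"
      using p2 by (simp add: divide_right_mono mult_ac)
  qed
  also have "\<dots> = \<sigma> * exp b * (\<Sum>p\<in>primes_le T. ln (real p) / real p)"
    by (simp add: sum_distrib_left)
  also have "\<dots> \<le> \<sigma> * exp b * (2 * ln T)"
    using sum_ln_prime_over_prime_le[of T] assms by (intro mult_left_mono) auto
  also have "\<dots> = 2 * exp b * (\<sigma> * ln T)" by simp
  also have "\<dots> \<le> 2 * exp b * b" using assms by (intro mult_left_mono) auto
  finally show ?thesis by (simp add: mult_ac)
qed

text \<open>Beyond t the weight \<open>ln p / ln t\<close> is at least 1, and
  \<open>T \<le> t ^ 2\<close> bounds \<open>2 * ln T / ln t\<close> by 4. This controls the primes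
  between the two ends of a block.\<close>

lemma sum_inverse_primes_between_le:
  assumes "t > 1" "T \<ge> t" "T \<le> t ^ 2"
  shows "(\<Sum>p\<in>primes_le T - primes_le t. 1 / real p) \<le> 4"
proof -
  have lt: "ln t > 0" using assms by simp
  have "(\<Sum>p\<in>primes_le T - primes_le t. 1 / real p) \<le>
        (\<Sum>p\<in>primes_le T - primes_le t. ln (real p) / real p / ln t)"
  proof (rule sum_mono)
    fix p assume p: "p \<in> primes_le T - primes_le t"
    hence "real p > t" by (auto simp: primes_le_def)
    hence "ln (real p) \<ge> ln t" using assms by (intro ln_mono) auto
    hence "ln (real p) / ln t \<ge> 1" using lt by simp
    thus "1 / real p \<le> ln (real p) / real p / ln t"
      by (metis divide_divide_eq_left divide_right_mono mult.commute of_nat_0_le_iff)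
  qed
  also have "\<dots> = (\<Sum>p\<in>primes_le T - primes_le t. ln (real p) / real p) / ln t"
    by (simp add: sum_divide_distrib)
  also have "\<dots> \<le> (\<Sum>p\<in>primes_le T. ln (real p) / real p) / ln t"
    using lt by (intro divide_right_mono sum_mono2) (auto dest: primes_leD(3))
  also have "\<dots> \<le> 2 * ln T / ln t"
    using sum_ln_prime_over_prime_le[of T] assms lt by (intro divide_right_mono) auto
  also have "\<dots> \<le> 4"
  proof -
    have "ln T \<le> ln (t ^ 2)" using assms by (intro ln_mono) auto
    also have "ln (t ^ 2) = 2 * ln t" using assms ln_realpow[of t 2] by simp
    finally show ?thesis using lt by (simp add: divide_le_eq)
  qed
  finally show ?thesis .
qed

section \<open>Periodic predicates and roots modulo prime powers\<close>

text \<open>Subsets of Z/mZ are encoded as predicates on the integers with period m. The same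
  predicate can then be counted modulo any multiple of its period, and the Chinese remainder theorem
  becomes a statement about conjunctions.\<close>

definition pcount :: "(int \<Rightarrow> bool) \<Rightarrow> nat \<Rightarrow> nat" where
  "pcount P m = card {a \<in> {0..<int m}. P a}"

definition periodic_mod :: "(int \<Rightarrow> bool) \<Rightarrow> nat \<Rightarrow> bool" where
  "periodic_mod P m \<longleftrightarrow> (\<forall>a b. a mod int m = b mod int m \<longrightarrow> P a = P b)"

lemma periodic_mod_eqD: "periodic_mod P m \<Longrightarrow> a mod int m = b mod int m \<Longrightarrow> P a = P b"
  unfolding periodic_mod_def by blast

lemma periodic_modD: "periodic_mod P m \<Longrightarrow> P (a mod int m) = P a"
  by (rule periodic_mod_eqD) auto

lemma periodic_mod_dvd:
  assumes "periodic_mod P m" "m dvd n"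
  shows "periodic_mod P n"
  unfolding periodic_mod_def
proof (intro allI impI)
  fix a b assume "a mod int n = b mod int n"
  hence "a mod int n mod int m = b mod int n mod int m" by simp
  hence "a mod int m = b mod int m"
    using assms(2) by (simp add: mod_mod_cancel)
  thus "P a = P b" by (rule periodic_mod_eqD[OF assms(1)])
qed

lemma periodic_mod_conj:
  "periodic_mod P m \<Longrightarrow> periodic_mod R m \<Longrightarrow> periodic_mod (\<lambda>a. P a \<and> R a) m"
  unfolding periodic_mod_def by blast

lemma periodic_mod_all:
  "(\<And>i. i \<in> A \<Longrightarrow> periodic_mod (P i) m) \<Longrightarrow> periodic_mod (\<lambda>a. \<forall>i\<in>A. P i a) m"
  unfolding periodic_mod_def by blast

lemma periodic_mod_not: "periodic_mod P m \<Longrightarrow> periodic_mod (\<lambda>a. \<not> P a) m"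
  unfolding periodic_mod_def by blast

lemma poly_mod_cong:
  fixes q :: "int poly"
  assumes "a mod m = b mod m"
  shows "poly q a mod m = poly q b mod m"
proof -
  have "m dvd a - b" using assms by (simp add: mod_eq_dvd_iff)
  moreover have "a - b dvd poly q a - poly q b"
  proof (induction q)
    case (pCons c q)
    have "poly (pCons c q) a - poly (pCons c q) b = a * (poly q a - poly q b) + (a - b) * poly q b"
      by (simp add: algebra_simps)
    with pCons show ?case by simp
  qed auto
  ultimately show ?thesis by (metis dvd_trans mod_eq_dvd_iff)
qed

lemma periodic_mod_dvd_poly: "periodic_mod (\<lambda>a. int m dvd poly q a) m"
  unfolding periodic_mod_def by (metis poly_mod_cong dvd_eq_mod_eq_0)

lemma finite_pcount_set [simp]: "finite {a. 0 \<le> a \<and> a < int m \<and> P a}"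
  by (rule finite_subset[of _ "{0..<int m}"]) auto

lemma pcount_1: "pcount P 1 = (if P 0 then 1 else 0)"
proof -
  have "{a \<in> {0..<int 1}. P a} = (if P 0 then {0} else {})" by (auto simp: order.order_iff_strict)
  thus ?thesis by (simp add: pcount_def)
qed

lemma pcount_le: "pcount P m \<le> m"
proof -
  have "pcount P m \<le> card {0..<int m}" unfolding pcount_def by (intro card_mono) auto
  thus ?thesis by simp
qed

lemma pcount_mono: "(\<And>a. P a \<Longrightarrow> R a) \<Longrightarrow> pcount P m \<le> pcount R m"
  unfolding pcount_def by (intro card_mono) auto

lemma pcount_not: "pcount (\<lambda>a. \<not> P a) m = m - pcount P m"
proof -
  have "{a \<in> {0..<int m}. \<not> P a} = {0..<int m} - {a \<in> {0..<int m}. P a}" by auto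
  moreover have "card ({0..<int m} - {a \<in> {0..<int m}. P a}) = card {0..<int m} - card {a \<in> {0..<int m}. P a}"
    by (rule card_Diff_subset) auto
  ultimately show ?thesis unfolding pcount_def by simp
qed

lemma num_roots_mod_eq_pcount: "num_roots_mod q m = pcount (\<lambda>a. int m dvd poly q a) m"
  by (simp add: num_roots_mod_def pcount_def)

lemma pcount_mult:
  assumes P: "periodic_mod P m" and m: "m > 0"
  shows "pcount P (k * m) = k * pcount P m"
proof -
  let ?A = "{a \<in> {0..<int m}. P a}"
  have "bij_betw (\<lambda>(i, a). int m * i + a) ({0..<int k} \<times> ?A) {a \<in> {0..<int (k * m)}. P a}"
  proof (rule bij_betw_byWitness[where f' = "\<lambda>b. (b div int m, b mod int m)"])
    show "\<forall>ia\<in>{0..<int k} \<times> ?A. ((case ia of (i, a) \<Rightarrow> int m * i + a) div int m,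
       (case ia of (i, a) \<Rightarrow> int m * i + a) mod int m) = ia"
      using m by auto
    show "\<forall>b\<in>{a \<in> {0..<int (k * m)}. P a}. (case (b div int m, b mod int m) of (i, a) \<Rightarrow> int m * i + a) = b"
      by auto
    show "(\<lambda>(i, a). int m * i + a) ` ({0..<int k} \<times> ?A) \<subseteq> {a \<in> {0..<int (k * m)}. P a}"
    proof
      fix b assume "b \<in> (\<lambda>(i, a). int m * i + a) ` ({0..<int k} \<times> ?A)"
      then obtain i a where b: "b = int m * i + a" and *: "0 \<le> i" "i < int k" "0 \<le> a" "a < int m" "P a"
        by auto
      have "int m * i + a < int m * (i + 1)" using * by (simp add: algebra_simps)
      also have "\<dots> \<le> int m * int k" using * by (intro mult_left_mono) auto
      finally have "int m * i + a < int k * int m" by (simp add: mult.commute)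
      moreover have "P (int m * i + a)"
        using periodic_modD[OF P, of "int m * i + a"] * by simp
      ultimately show "b \<in> {a \<in> {0..<int (k * m)}. P a}"
        using * b by simp
    qed
    show "(\<lambda>b. (b div int m, b mod int m)) ` {a \<in> {0..<int (k * m)}. P a} \<subseteq> {0..<int k} \<times> ?A"
    proof
      fix c assume "c \<in> (\<lambda>b. (b div int m, b mod int m)) ` {a \<in> {0..<int (k * m)}. P a}"
      then obtain b where c: "c = (b div int m, b mod int m)" and *: "0 \<le> b" "b < int k * int m" "P b"
        by auto
      have "b div int m < int k"
      proof (rule ccontr)
        assume "\<not> b div int m < int k"
        hence "int k * int m \<le> (b div int m) * int m" using m by (intro mult_right_mono) auto
        also have "\<dots> \<le> b" using div_mult_mod_eq[of b "int m"] pos_mod_sign[of "int m" b] m by linarith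
        finally show False using * by simp
      qed
      thus "c \<in> {0..<int k} \<times> ?A"
        using * c m periodic_modD[OF P, of b] by (simp add: pos_imp_zdiv_nonneg_iff)
    qed
  qed
  from bij_betw_same_card[OF this] show ?thesis
    unfolding pcount_def by (simp add: card_cartesian_product)
qed

lemma pcount_crt:
  assumes P: "periodic_mod P m" and R: "periodic_mod R n"
    and m: "m > 0" and n: "n > 0" and cop: "coprime m n"
  shows "pcount (\<lambda>a. P a \<and> R a) (m * n) = pcount P m * pcount R n"
proof -
  let ?A = "{a \<in> {0..<int m}. P a}" and ?B = "{a \<in> {0..<int n}. R a}"
  let ?C = "{a \<in> {0..<int (m * n)}. P a \<and> R a}"
  have "bij_betw (\<lambda>a. (a mod int m, a mod int n)) ?C (?A \<times> ?B)"
  proof (rule bij_betwI')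
    fix a b assume ab: "a \<in> ?C" "b \<in> ?C"
    show "((a mod int m, a mod int n) = (b mod int m, b mod int n)) = (a = b)"
    proof
      assume "(a mod int m, a mod int n) = (b mod int m, b mod int n)"
      hence "[a = b] (mod int m)" "[a = b] (mod int n)" by (auto simp: cong_def)
      hence "[a = b] (mod int m * int n)"
        using cop coprime_cong_mult by (metis coprime_int_iff)
      thus "a = b" using ab by (auto simp: cong_def)
    qed auto
  next
    fix a assume "a \<in> ?C"
    thus "(a mod int m, a mod int n) \<in> ?A \<times> ?B"
      using m n periodic_modD[OF P, of a] periodic_modD[OF R, of a] by auto
  next
    fix ab assume "ab \<in> ?A \<times> ?B"
    then obtain a b where ab: "ab = (a, b)" "a \<in> ?A" "b \<in> ?B" by auto
    obtain c where c: "[c = a] (mod int m)" "[c = b] (mod int n)"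
      using binary_chinese_remainder_int[of "int m" "int n" a b] cop by auto
    define d where "d = c mod int (m * n)"
    have d: "d mod int m = a" "d mod int n = b"
      using c ab by (auto simp: d_def cong_def mod_mod_cancel)
    have "P d" using periodic_modD[OF P, of d] d ab by simp
    moreover have "R d" using periodic_modD[OF R, of d] d ab by simp
    moreover have "0 \<le> d" "d < int (m * n)" using m n by (auto simp: d_def simp del: of_nat_mult)
    ultimately show "\<exists>x\<in>?C. ab = (x mod int m, x mod int n)" using ab d by auto
  qed
  from bij_betw_same_card[OF this] show ?thesis
    unfolding pcount_def by (simp add: card_cartesian_product)
qed

lemma periodic_mod_prod:
  assumes "finite S" "\<And>p. p \<in> S \<Longrightarrow> periodic_mod (P p) (m p)"
  shows "periodic_mod (\<lambda>a. \<forall>p\<in>S. P p a) (\<Prod>p\<in>S. m p)"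
  using assms by (intro periodic_mod_all) (blast intro: dvd_prodI periodic_mod_dvd)

lemma pcount_prod:
  fixes m :: "'i \<Rightarrow> nat"
  assumes "finite S" "\<And>p. p \<in> S \<Longrightarrow> periodic_mod (P p) (m p)" "\<And>p. p \<in> S \<Longrightarrow> m p > 0"
    "\<And>p q. p \<in> S \<Longrightarrow> q \<in> S \<Longrightarrow> p \<noteq> q \<Longrightarrow> coprime (m p) (m q)"
  shows "pcount (\<lambda>a. \<forall>p\<in>S. P p a) (\<Prod>p\<in>S. m p) = (\<Prod>p\<in>S. pcount (P p) (m p))"
  using assms
proof (induction S rule: finite_induct)
  case empty
  thus ?case using pcount_1[of "\<lambda>_. True"] by simp
next
  case (insert p S)
  have "pcount (\<lambda>a. P p a \<and> (\<forall>p\<in>S. P p a)) (m p * (\<Prod>p\<in>S. m p)) =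
        pcount (P p) (m p) * pcount (\<lambda>a. \<forall>p\<in>S. P p a) (\<Prod>p\<in>S. m p)"
    using insert by (intro pcount_crt periodic_mod_prod prod_coprime_right prod_pos) auto
  thus ?case using insert by simp
qed

section \<open>Periodic conditions on an interval, and polynomial roots modulo prime powers\<close>

lemma card_residue_class_interval:
  fixes x y :: real
  assumes "m > 0" "y \<ge> 0"
  shows "finite {n :: int. x < n \<and> n \<le> x + y \<and> n mod int m = c mod int m}"
    and "\<bar>real (card {n :: int. x < n \<and> n \<le> x + y \<and> n mod int m = c mod int m}) - y / m\<bar> \<le> 1"
proof -
  let ?N = "{n :: int. x < n \<and> n \<le> x + y \<and> n mod int m = c mod int m}"
  define u v where "u = \<lfloor>(x - c) / m\<rfloor>" and "v = \<lfloor>(x + y - c) / m\<rfloor>"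
  have "?N = (\<lambda>i. c + int m * i) ` {u<..v}"
  proof (intro equalityI subsetI)
    fix n assume n: "n \<in> ?N"
    hence "int m dvd n - c" by (simp add: mod_eq_dvd_iff)
    then obtain i where "n - c = int m * i" by (rule dvdE)
    hence i: "n = c + int m * i" by simp
    have "x < c + m * real_of_int i" "c + m * real_of_int i \<le> x + y" using n i by auto
    hence "(x - c) / m < i" "i \<le> (x + y - c) / m" using assms by (auto simp: field_simps)
    hence "i \<in> {u<..v}" by (auto simp: u_def v_def floor_less_iff le_floor_iff)
    with i show "n \<in> (\<lambda>i. c + int m * i) ` {u<..v}" by blast
  next
    fix n assume "n \<in> (\<lambda>i. c + int m * i) ` {u<..v}"
    then obtain i where i: "n = c + int m * i" "i \<in> {u<..v}" by blast
    hence "(x - c) / m < i" "i \<le> (x + y - c) / m"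
      by (auto simp: u_def v_def floor_less_iff le_floor_iff)
    hence "x < c + m * real_of_int i" "c + m * real_of_int i \<le> x + y" using assms by (auto simp: field_simps)
    with i show "n \<in> ?N" by simp
  qed
  moreover have "inj_on (\<lambda>i. c + int m * i) {u<..v}" using assms by (auto simp: inj_on_def)
  ultimately have card: "finite ?N" "card ?N = nat (v - u)" by (auto simp: card_image)
  show "finite ?N" by fact
  have "u \<le> v" unfolding u_def v_def using assms by (intro floor_mono divide_right_mono) auto
  hence c2: "real (card ?N) = real_of_int v - real_of_int u" using card by simp
  have "(x + y - c) / m - (x - c) / m = y / m" using assms by (simp add: field_simps)
  moreover have "v \<le> (x + y - c) / m" "(x + y - c) / m < v + 1" "u \<le> (x - c) / m" "(x - c) / m < u + 1"
    unfolding u_def v_def by linarith+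
  ultimately show "\<bar>real (card ?N) - y / m\<bar> \<le> 1" unfolding c2 by linarith
qed

text \<open>Each residue class contributes y/m with an error of at most 1, so the total error is the
  number of classes; compared with the main term it is a factor m/y.\<close>

lemma card_periodic_interval:
  fixes x y :: real
  assumes P: "periodic_mod P m" and m: "m > 0" and y: "y \<ge> 0"
  shows "\<bar>real (card {n :: int. x < n \<and> n \<le> x + y \<and> P n}) - real (pcount P m) * (y / m)\<bar> \<le> pcount P m"
proof -
  let ?A = "{a \<in> {0..<int m}. P a}"
  let ?N = "\<lambda>c. {n :: int. x < n \<and> n \<le> x + y \<and> n mod int m = c mod int m}"
  have eq: "{n :: int. x < n \<and> n \<le> x + y \<and> P n} = (\<Union>c\<in>?A. ?N c)"
  proof (intro equalityI subsetI)
    fix n assume n: "n \<in> {n :: int. x < n \<and> n \<le> x + y \<and> P n}"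
    hence "n mod int m \<in> ?A" using m periodic_modD[OF P, of n] by auto
    moreover have "n \<in> ?N (n mod int m)" using n by auto
    ultimately show "n \<in> (\<Union>c\<in>?A. ?N c)" by blast
  next
    fix n assume "n \<in> (\<Union>c\<in>?A. ?N c)"
    then obtain c where "c \<in> ?A" "n \<in> ?N c" by blast
    moreover from this have "P n" using periodic_mod_eqD[OF P, of n c] by simp
    ultimately show "n \<in> {n :: int. x < n \<and> n \<le> x + y \<and> P n}" by simp
  qed
  have "card (\<Union>c\<in>?A. ?N c) = (\<Sum>c\<in>?A. card (?N c))"
  proof (rule card_UN_disjoint)
    show "\<forall>c\<in>?A. finite (?N c)" using m y by (intro ballI card_residue_class_interval(1))
    show "\<forall>c\<in>?A. \<forall>d\<in>?A. c \<noteq> d \<longrightarrow> ?N c \<inter> ?N d = {}"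
    proof (intro ballI impI)
      fix c d assume "c \<in> ?A" "d \<in> ?A" "c \<noteq> d"
      hence "c mod int m \<noteq> d mod int m" by simp
      thus "?N c \<inter> ?N d = {}" by auto
    qed
  qed simp
  hence "real (card {n :: int. x < n \<and> n \<le> x + y \<and> P n}) - real (pcount P m) * (y / m) =
     (\<Sum>c\<in>?A. (real (card (?N c)) - y / m))"
    unfolding eq by (simp add: sum_subtractf pcount_def)
  moreover have "\<bar>\<Sum>c\<in>?A. (real (card (?N c)) - y / m)\<bar> \<le> real (card ?A) * 1"
    by (rule order_trans[OF sum_abs], rule sum_bounded_above) (rule card_residue_class_interval(2)[OF m y])
  ultimately show ?thesis by (simp add: pcount_def)
qed

text \<open>Dividing out \<open>X - x0\<close> costs at most \<open>p ^ (k - 1)\<close> in each of the other values.\<close>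

lemma coeffs_dvd_of_values_dvd:
  fixes q :: "int poly" and p :: nat
  assumes "prime p" "k \<ge> 1" "degree q \<le> d" "finite X" "card X = Suc d"
    "\<And>x y. x \<in> X \<Longrightarrow> y \<in> X \<Longrightarrow> x \<noteq> y \<Longrightarrow> \<not> int p ^ k dvd x - y"
    "\<And>x. x \<in> X \<Longrightarrow> int p ^ i dvd poly q x"
  shows "[:int p ^ (i - d * (k - 1)):] dvd q"
  using assms(3-)
proof (induction d arbitrary: q i X)
  case 0
  then obtain c where q: "q = [:c:]" by (metis degree_0_id le_zero_eq of_nat_0 degree_eq_zeroE)
  from 0 obtain x where "X = {x}" by (metis One_nat_def card_1_singletonE)
  thus ?case using 0 q by (simp add: const_poly_dvd_const_poly_iff)
next
  case (Suc d)
  then obtain x0 where x0: "x0 \<in> X" by fastforce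
  define q1 where "q1 = synthetic_div q x0"
  have q: "q = [:-x0, 1:] * q1 + [:poly q x0:]"
    unfolding q1_def by (rule synthetic_div_correct'[symmetric])
  have "[:int p ^ ((i - (k - 1)) - d * (k - 1)):] dvd q1"
  proof (rule Suc.IH)
    show "degree q1 \<le> d" using Suc.prems by (simp add: q1_def degree_synthetic_div)
    show "finite (X - {x0})" "card (X - {x0}) = Suc d" using Suc.prems x0 by auto
    show "\<not> int p ^ k dvd x - y" if "x \<in> X - {x0}" "y \<in> X - {x0}" "x \<noteq> y" for x y
      using Suc.prems that by blast
    show "int p ^ (i - (k - 1)) dvd poly q1 x" if x: "x \<in> X - {x0}" for x
    proof -
      have "poly q x = (x - x0) * poly q1 x + poly q x0" using arg_cong[OF q, of "\<lambda>r. poly r x"] by (simp add: algebra_simps)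
      hence d: "int p ^ i dvd (x - x0) * poly q1 x"
        using Suc.prems(5)[of x] Suc.prems(5)[OF x0] x by (simp add: dvd_add_left_iff)
      have nd: "\<not> int p ^ k dvd x - x0" using Suc.prems(4)[of x x0] x x0 by auto
      show ?thesis
      proof (cases "k \<le> i")
        case True
        have "prime_elem (int p)" using assms(1) by auto
        with d have "int p ^ k dvd x - x0 \<or> int p ^ (i - (k - 1)) dvd poly q1 x"
          using True assms(2) by (intro prime_elem_power_dvd_cases[of _ i]) auto
        with nd show ?thesis by blast
      next
        case False
        hence "i - (k - 1) = 0" by simp
        thus ?thesis by simp
      qed
    qed
  qed
  moreover have "(i - (k - 1)) - d * (k - 1) = i - Suc d * (k - 1)" by (simp add: diff_diff_left)
  ultimately have "[:int p ^ (i - Suc d * (k - 1)):] dvd q1" by simp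
  moreover have "[:int p ^ (i - Suc d * (k - 1)):] dvd [:poly q x0:]"
    using Suc.prems(5)[OF x0]
    by (auto simp: const_poly_dvd_const_poly_iff intro: dvd_trans[OF le_imp_power_dvd, of _ i])
  ultimately have "[:int p ^ (i - Suc d * (k - 1)):] dvd [:-x0, 1:] * q1 + [:poly q x0:]"
    by (meson dvd_add dvd_mult)
  with q show ?case by metis
qed

text \<open>If the roots modulo \<open>p ^ i\<close> met more than d classes modulo
  \<open>p ^ k\<close>, representatives of d + 1 of them would force
  \<open>p ^ (i - d * (k - 1))\<close>, hence p, to divide all coefficients. So at most d classes
  modulo \<open>p ^ k\<close> occur, each with \<open>p ^ (i - k)\<close> lifts. The bound involves
  the degree only, neither the discriminant nor simplicity of the roots.\<close>

lemma pcount_roots_prime_power_le: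
  fixes q :: "int poly" and p :: nat
  assumes p: "prime p" and d: "degree q \<le> d" and nd: "\<not> [:int p:] dvd q"
    and k: "k \<ge> 1" "k \<le> i" "d * (k - 1) < i"
  shows "pcount (\<lambda>a. int (p ^ i) dvd poly q a) (p ^ i) \<le> d * p ^ (i - k)"
proof -
  define S where "S = {a \<in> {0..<int (p ^ i)}. int (p ^ i) dvd poly q a}"
  define C where "C = (\<lambda>a. a mod int (p ^ k)) ` S"
  have finS: "finite S" by (rule finite_subset[of _ "{0..<int (p ^ i)}"]) (auto simp: S_def)
  have cardC: "card C \<le> d"
  proof (rule ccontr)
    assume "\<not> card C \<le> d"
    then obtain B where B: "B \<subseteq> C" "card B = Suc d" "finite B"
      by (metis finS C_def finite_imageI finite_subset not_less_eq_eq obtain_subset_with_card_n)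
    have "\<forall>b\<in>B. \<exists>a\<in>S. a mod int (p ^ k) = b" using B by (auto simp: C_def)
    then obtain r where r: "\<And>b. b \<in> B \<Longrightarrow> r b \<in> S" "\<And>b. b \<in> B \<Longrightarrow> r b mod int (p ^ k) = b"
      by metis
    have inj: "inj_on r B" using r by (metis inj_onI)
    have "[:int p ^ (i - d * (k - 1)):] dvd q"
    proof (rule coeffs_dvd_of_values_dvd[OF p k(1) d, where X = "r ` B"])
      show "finite (r ` B)" "card (r ` B) = Suc d" using B inj by (auto simp: card_image)
      fix x y assume "x \<in> r ` B" "y \<in> r ` B" "x \<noteq> y"
      then obtain b b' where "x = r b" "y = r b'" "b \<in> B" "b' \<in> B" "b \<noteq> b'" by auto
      hence "x mod int (p ^ k) \<noteq> y mod int (p ^ k)" using r by metis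
      thus "\<not> int p ^ k dvd x - y" by (simp add: mod_eq_dvd_iff)
    next
      fix x assume "x \<in> r ` B"
      thus "int p ^ i dvd poly q x" using r by (auto simp: S_def)
    qed
    moreover have "[:int p:] dvd [:int p ^ (i - d * (k - 1)):]"
      using k by (simp add: const_poly_dvd_const_poly_iff dvd_power)
    ultimately show False using nd dvd_trans by blast
  qed
  have "pcount (\<lambda>a. int (p ^ i) dvd poly q a) (p ^ i) \<le> pcount (\<lambda>a. a mod int (p ^ k) \<in> C) (p ^ i)"
    unfolding pcount_def
  proof (rule card_mono)
    show "{a \<in> {0..<int (p ^ i)}. int (p ^ i) dvd poly q a} \<subseteq> {a \<in> {0..<int (p ^ i)}. a mod int (p ^ k) \<in> C}"
      unfolding C_def S_def by blast
  qed (rule finite_subset[of _ "{0..<int (p ^ i)}"], auto)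
  also have "\<dots> = p ^ (i - k) * pcount (\<lambda>a. a mod int (p ^ k) \<in> C) (p ^ k)"
  proof -
    have "p ^ i = p ^ (i - k) * p ^ k" using k by (simp flip: power_add)
    thus ?thesis using p pcount_mult[of "\<lambda>a. a mod int (p ^ k) \<in> C" "p ^ k" "p ^ (i - k)"]
      by (simp add: periodic_mod_def prime_gt_0_nat del: of_nat_power)
  qed
  also have "\<dots> \<le> p ^ (i - k) * d"
  proof (rule mult_le_mono2)
    have "pcount (\<lambda>a. a mod int (p ^ k) \<in> C) (p ^ k) \<le> card C"
      unfolding pcount_def
    proof (rule card_mono)
      show "{a \<in> {0..<int (p ^ k)}. a mod int (p ^ k) \<in> C} \<subseteq> C"
        by (auto simp del: of_nat_power)
      show "finite C" using finS by (simp add: C_def)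
    qed
    with cardC show "pcount (\<lambda>a. a mod int (p ^ k) \<in> C) (p ^ k) \<le> d" by simp
  qed
  finally show ?thesis by (simp add: mult.commute)
qed

section \<open>Selberg's sieve\<close>

lemma sum_prod_subsets:
  fixes h :: "'a \<Rightarrow> 'b :: comm_semiring_1"
  assumes "finite A"
  shows "(\<Sum>S\<in>Pow A. \<Prod>p\<in>S. h p) = (\<Prod>p\<in>A. 1 + h p)"
  using prod_add[OF assms, of h "\<lambda>_. 1"] by (simp add: add.commute)

lemma sum_Pow_split:
  fixes F :: "'a set \<Rightarrow> 'b :: comm_monoid_add"
  assumes "finite P" "T \<subseteq> P"
  shows "(\<Sum>S\<in>Pow P. F S) = (\<Sum>U\<in>Pow T. \<Sum>R\<in>Pow (P - T). F (U \<union> R))"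
proof -
  have "(\<Sum>U\<in>Pow T. \<Sum>R\<in>Pow (P - T). F (U \<union> R)) = (\<Sum>(U, R)\<in>Pow T \<times> Pow (P - T). F (U \<union> R))"
    using assms by (intro sum.cartesian_product)
  also have "\<dots> = (\<Sum>S\<in>Pow P. F S)"
    by (rule sum.reindex_bij_witness[of _ "\<lambda>S. (S \<inter> T, S - T)" "\<lambda>(U, R). U \<union> R"]) (use assms in auto)
  finally show ?thesis ..
qed

text \<open>Moebius inversion in the subset lattice: up to sign, the sum is the expansion of
  \<open>(1 - 1)\<close> to the power \<open>card (U - V)\<close>.\<close>

lemma sum_alternating_interval:
  assumes "finite U" "V \<subseteq> U"
  shows "(\<Sum>S\<in>{S. V \<subseteq> S \<and> S \<subseteq> U}. (-1 :: real) ^ card S) = (if U = V then (-1) ^ card V else 0)"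
proof -
  have finV: "finite V" using assms finite_subset by blast
  have "(\<Sum>S\<in>{S. V \<subseteq> S \<and> S \<subseteq> U}. (-1 :: real) ^ card S) = (\<Sum>R\<in>Pow (U - V). (-1) ^ card V * (\<Prod>p\<in>R. -1))"
    by (rule sum.reindex_bij_witness[of _ "\<lambda>R. R \<union> V" "\<lambda>S. S - V"])
       (use assms finV in \<open>auto simp: card_Diff_subset power_add[symmetric] card_mono finite_subset\<close>)
  also have "\<dots> = (-1) ^ card V * (\<Prod>p\<in>U - V. 1 + (-1))"
    using assms by (simp add: sum_distrib_left[symmetric] sum_prod_subsets del: prod_constant)
  also have "\<dots> = (if U = V then (-1) ^ card V else 0)"
    using assms by (auto simp: prod_constant card_gt_0_iff)
  finally show ?thesis .
qed

text \<open>Squarefree moduli are represented by sets of primes: \<open>prod \<delta> S\<close> is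
  the density of the n divisible at every prime of S, \<open>prod d S\<close> the size of the
  modulus and Q the level. Accordingly \<open>D\<close> is the set of divisors below the level,
  \<open>h\<close> the usual multiplicative function \<delta> / (1 - \<delta>), and \<open>J\<close>
  its truncated sum, whose inverse is the sieve density.\<close>

locale selberg =
  fixes P :: "'a set" and \<delta> d :: "'a \<Rightarrow> real" and Q :: real
  assumes finP: "finite P"
    and \<delta>: "\<And>p. p \<in> P \<Longrightarrow> 0 < \<delta> p" "\<And>p. p \<in> P \<Longrightarrow> \<delta> p < 1"
    and d: "\<And>p. p \<in> P \<Longrightarrow> d p \<ge> 1"
    and Q: "Q \<ge> 1"
begin

definition h :: "'a set \<Rightarrow> real" where "h S = (\<Prod>p\<in>S. \<delta> p / (1 - \<delta> p))"
definition D :: "'a set set" where "D = {S. S \<subseteq> P \<and> prod d S \<le> Q}"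
definition J :: real where "J = (\<Sum>S\<in>D. h S)"
text \<open>The weights that minimise the quadratic form below under \<open>lam {} = 1\<close>.\<close>

definition lam :: "'a set \<Rightarrow> real" where
  "lam S = (-1) ^ card S / (prod \<delta> S * J) * (\<Sum>U\<in>{U\<in>D. S \<subseteq> U}. h U)"

lemma finD [simp]: "finite D"
  by (rule finite_subset[of _ "Pow P"]) (use finP in \<open>auto simp: D_def\<close>)

lemma D_sub: "S \<in> D \<Longrightarrow> S \<subseteq> P"
  by (simp add: D_def)

lemma D_fin: "S \<in> D \<Longrightarrow> finite S"
  using D_sub finP finite_subset by blast

lemma h_pos: "S \<subseteq> P \<Longrightarrow> h S > 0"
  unfolding h_def using \<delta> by (intro prod_pos) (auto intro!: divide_pos_pos)

lemma \<delta>_pos: "S \<subseteq> P \<Longrightarrow> prod \<delta> S > 0"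
  using \<delta> by (intro prod_pos) auto

lemma D_down: "S \<in> D \<Longrightarrow> V \<subseteq> S \<Longrightarrow> V \<in> D"
proof -
  assume S: "S \<in> D" and V: "V \<subseteq> S"
  have "prod d V \<le> prod d S"
    using S V d finP D_fin[OF S] by (intro prod_mono2) (auto simp: D_def intro: order_trans[OF zero_le_one])
  thus ?thesis using S V by (auto simp: D_def)
qed

lemma empty_D: "{} \<in> D"
  using Q by (auto simp: D_def)

lemma J_pos: "J > 0"
proof -
  have "h {} \<le> J" unfolding J_def
  proof (rule member_le_sum)
    fix S assume "S \<in> D - {{}}"
    thus "0 \<le> h S" using h_pos[of S] D_sub[of S] by simp
  qed (use empty_D in auto)
  thus ?thesis by (simp add: h_def)
qed

lemma lam_empty: "lam {} = 1"
  using J_pos unfolding lam_def by (simp add: J_def)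

text \<open>Multiply out 1/\<delta> = 1 + (1 - \<delta>)/\<delta> over S. Applied to
  \<open>S \<inter> T\<close>, this is the identity that diagonalises the quadratic form.\<close>

lemma inverse_\<delta>_prod:
  assumes "S \<subseteq> P"
  shows "1 / prod \<delta> S = (\<Sum>V\<in>Pow S. 1 / h V)"
proof -
  have finS: "finite S" using assms finP finite_subset by blast
  have "(\<Sum>V\<in>Pow S. 1 / h V) = (\<Sum>V\<in>Pow S. \<Prod>p\<in>V. (1 - \<delta> p) / \<delta> p)"
    by (intro sum.cong) (auto simp: h_def prod_dividef)
  also have "\<dots> = (\<Prod>p\<in>S. 1 + (1 - \<delta> p) / \<delta> p)" using finS by (rule sum_prod_subsets)
  also have "\<dots> = (\<Prod>p\<in>S. 1 / \<delta> p)"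
  proof (rule prod.cong)
    fix p assume "p \<in> S"
    hence "\<delta> p > 0" using \<delta>(1) assms by blast
    thus "1 + (1 - \<delta> p) / \<delta> p = 1 / \<delta> p" by (simp add: field_simps)
  qed auto
  finally show ?thesis by (simp add: prod_dividef)
qed

text \<open>Group the sets that make up \<open>J\<close> by their intersection U with T. If
  \<open>T \<union> R\<close> lies below the level, so does \<open>U \<union> R\<close> for every
  subset U of T; hence \<open>J\<close> is at least \<open>G\<close> times the sum of
  \<open>h\<close> over the subsets of T. That sum equals \<open>h T / prod \<delta> T\<close>,
  which is exactly the factor in \<open>lam T\<close>.\<close>

lemma abs_lam_le:
  assumes T: "T \<in> D"
  shows "\<bar>lam T\<bar> \<le> 1"
proof -
  have TP: "T \<subseteq> P" using T D_sub by auto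
  have finT: "finite T" using T D_fin by auto
  define ind where "ind = (\<lambda>S. if S \<in> D then h S else 0)"
  have ind0: "ind S \<ge> 0" for S unfolding ind_def using h_pos D_sub by (auto intro: less_imp_le)
  have Dsum: "(\<Sum>S\<in>Pow P. ind S) = J"
    unfolding ind_def J_def using finP by (subst sum.inter_restrict[symmetric]) (auto intro!: sum.cong dest: D_sub)
  have hU: "h (U \<union> R) = h U * h R" if "U \<subseteq> T" "R \<subseteq> P - T" for U R
    unfolding h_def using that finP finT by (subst prod.union_disjoint) (auto intro: finite_subset)
  define G where "G = (\<Sum>R\<in>Pow (P - T). if T \<union> R \<in> D then h R else 0)"
  have eqS: "(\<Sum>U\<in>{U\<in>D. T \<subseteq> U}. h U) = h T * G"
  proof -
    have hT: "h T * h (S - T) = h S" if "S \<in> D" "T \<subseteq> S" for S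
      using hU[of T "S - T"] that D_sub[of S] by (simp add: Un_absorb1 Diff_mono)
    have "(\<Sum>U\<in>{U\<in>D. T \<subseteq> U}. h U) = (\<Sum>R\<in>{R\<in>Pow (P - T). T \<union> R \<in> D}. h T * h R)"
      by (rule sum.reindex_bij_witness[of _ "\<lambda>R. T \<union> R" "\<lambda>S. S - T"])
         (use hT in \<open>auto dest: D_sub simp: Un_absorb1\<close>)
    also have "\<dots> = h T * G" unfolding G_def using finP
      by (subst sum.inter_filter) (auto simp: sum_distrib_left intro!: sum.cong)
    finally show ?thesis .
  qed
  have "J = (\<Sum>U\<in>Pow T. \<Sum>R\<in>Pow (P - T). ind (U \<union> R))"
    unfolding Dsum[symmetric] by (rule sum_Pow_split[OF finP TP])
  also have "\<dots> \<ge> (\<Sum>U\<in>Pow T. \<Sum>R\<in>Pow (P - T). h U * (if T \<union> R \<in> D then h R else 0))"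
  proof (intro sum_mono)
    fix U R assume UR: "U \<in> Pow T" "R \<in> Pow (P - T)"
    show "h U * (if T \<union> R \<in> D then h R else 0) \<le> ind (U \<union> R)"
    proof (cases "T \<union> R \<in> D")
      case True
      hence "U \<union> R \<in> D" using UR by (elim D_down) auto
      thus ?thesis using True hU[of U R] UR by (simp add: ind_def)
    qed (use ind0 in auto)
  qed
  finally have "(\<Sum>U\<in>Pow T. h U) * G \<le> J"
    unfolding G_def by (simp only: sum_product)
  also have "(\<Sum>U\<in>Pow T. h U) = (\<Prod>p\<in>T. 1 + \<delta> p / (1 - \<delta> p))"
    unfolding h_def by (rule sum_prod_subsets[OF finT])
  also have "\<dots> = (\<Prod>p\<in>T. (\<delta> p / (1 - \<delta> p)) / \<delta> p)"
  proof (rule prod.cong)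
    fix p assume "p \<in> T"
    hence "\<delta> p > 0" "\<delta> p < 1" using \<delta> TP by blast+
    thus "1 + \<delta> p / (1 - \<delta> p) = (\<delta> p / (1 - \<delta> p)) / \<delta> p" by (simp add: divide_simps)
  qed auto
  also have "\<dots> = h T / prod \<delta> T" unfolding h_def by (rule prod_dividef)
  finally have le: "h T * G / prod \<delta> T \<le> J" by simp
  have G0: "G \<ge> 0" unfolding G_def using h_pos by (intro sum_nonneg) (auto intro: less_imp_le)
  have "\<bar>lam T\<bar> = h T * G / prod \<delta> T / J"
    unfolding lam_def eqS using J_pos \<delta>_pos[OF TP] h_pos[OF TP] G0 by (simp add: abs_mult power_abs)
  also have "\<dots> \<le> 1" using le J_pos by (simp only: divide_le_eq_1_pos)
  finally show ?thesis .
qed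

text \<open>This inverts the definition of \<open>lam\<close>: after the sums are interchanged, the
  alternating sum over the sets between V and U leaves only the term U = V.\<close>

lemma zeta:
  assumes V: "V \<in> D"
  shows "(\<Sum>S\<in>{S\<in>D. V \<subseteq> S}. lam S * prod \<delta> S) = (-1) ^ card V * h V / J"
proof -
  have "(\<Sum>S\<in>{S\<in>D. V \<subseteq> S}. lam S * prod \<delta> S) =
     (\<Sum>S\<in>{S\<in>D. V \<subseteq> S}. \<Sum>U\<in>{U\<in>D. S \<subseteq> U}. (-1) ^ card S * h U / J)"
  proof (rule sum.cong)
    fix S assume "S \<in> {S\<in>D. V \<subseteq> S}"
    hence "prod \<delta> S \<noteq> 0" using \<delta>_pos D_sub by (metis less_irrefl mem_Collect_eq)
    hence "lam S * prod \<delta> S = (-1) ^ card S / J * (\<Sum>U\<in>{U\<in>D. S \<subseteq> U}. h U)"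
      by (simp add: lam_def)
    thus "lam S * prod \<delta> S = (\<Sum>U\<in>{U\<in>D. S \<subseteq> U}. (-1) ^ card S * h U / J)"
      by (simp add: sum_distrib_left)
  qed auto
  also have "\<dots> = (\<Sum>U\<in>{U\<in>D. V \<subseteq> U}. \<Sum>S\<in>{S. V \<subseteq> S \<and> S \<subseteq> U}. (-1) ^ card S * h U / J)"
  proof -
    have fin1: "finite {S\<in>D. V \<subseteq> S}" "finite {U\<in>D. V \<subseteq> U}" "finite {U\<in>D. S \<subseteq> U}" for S by simp_all
    have fin2: "finite {S. V \<subseteq> S \<and> S \<subseteq> U}" if "U \<in> {U\<in>D. V \<subseteq> U}" for U
      by (rule finite_subset[of _ "Pow U"]) (use that D_fin in auto)
    show ?thesis
      by (subst (1 2) sum.Sigma; (use fin1 fin2 in blast)?)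
         (rule sum.reindex_bij_witness[of _ "\<lambda>(U, S). (S, U)" "\<lambda>(S, U). (U, S)"]; auto intro: D_down)
  qed
  also have "\<dots> = (\<Sum>U\<in>{U\<in>D. V \<subseteq> U}. h U / J * (if U = V then (-1) ^ card V else 0))"
  proof (intro sum.cong refl)
    fix U assume U: "U \<in> {U\<in>D. V \<subseteq> U}"
    have "(\<Sum>S\<in>{S. V \<subseteq> S \<and> S \<subseteq> U}. (-1) ^ card S * h U / J) =
          h U / J * (\<Sum>S\<in>{S. V \<subseteq> S \<and> S \<subseteq> U}. (-1) ^ card S)"
      by (simp add: sum_distrib_left mult_ac)
    also have "(\<Sum>S\<in>{S. V \<subseteq> S \<and> S \<subseteq> U}. (-1 :: real) ^ card S) = (if U = V then (-1) ^ card V else 0)"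
      using U D_fin by (intro sum_alternating_interval) auto
    finally show "(\<Sum>S\<in>{S. V \<subseteq> S \<and> S \<subseteq> U}. (-1) ^ card S * h U / J) = h U / J * (if U = V then (-1) ^ card V else 0)" .
  qed
  also have "\<dots> = (\<Sum>U\<in>{U\<in>D. V \<subseteq> U}. if U = V then (-1) ^ card V * h V / J else 0)"
    by (intro sum.cong) auto
  also have "\<dots> = (-1) ^ card V * h V / J" using V by (simp add: sum.delta')
  finally show ?thesis .
qed

text \<open>With \<open>1 / prod \<delta> (S \<inter> T)\<close> expanded over the common subsets V,
  the form becomes a sum of squares divided by \<open>h V\<close>; by \<open>zeta\<close> each term
  is \<open>h V / J\<^sup>2\<close>, and these sum to 1/J.\<close>

lemma quadratic_form:
  "(\<Sum>S\<in>D. \<Sum>T\<in>D. lam S * lam T * prod \<delta> (S \<union> T)) = 1 / J"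
proof -
  have "(\<Sum>S\<in>D. \<Sum>T\<in>D. lam S * lam T * prod \<delta> (S \<union> T)) =
        (\<Sum>S\<in>D. \<Sum>T\<in>D. \<Sum>V\<in>D. if V \<subseteq> S \<and> V \<subseteq> T then (lam S * prod \<delta> S) * (lam T * prod \<delta> T) / h V else 0)"
  proof (intro sum.cong refl)
    fix S T assume ST: "S \<in> D" "T \<in> D"
    have fin: "finite S" "finite T" using ST D_fin by auto
    have int: "S \<inter> T \<subseteq> P" using ST D_sub by auto
    have "prod \<delta> (S \<union> T) * prod \<delta> (S \<inter> T) = prod \<delta> S * prod \<delta> T"
      using fin by (rule prod.union_inter)
    hence "prod \<delta> (S \<union> T) = prod \<delta> S * prod \<delta> T * (1 / prod \<delta> (S \<inter> T))"
      using \<delta>_pos[OF int] by (simp add: field_simps)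
    also have "\<dots> = prod \<delta> S * prod \<delta> T * (\<Sum>V\<in>Pow (S \<inter> T). 1 / h V)"
      using inverse_\<delta>_prod[OF int] by simp
    finally have "lam S * lam T * prod \<delta> (S \<union> T) =
        (lam S * prod \<delta> S) * (lam T * prod \<delta> T) * (\<Sum>V\<in>Pow (S \<inter> T). 1 / h V)" by simp
    also have "\<dots> = (\<Sum>V\<in>Pow (S \<inter> T). (lam S * prod \<delta> S) * (lam T * prod \<delta> T) / h V)"
      by (simp add: sum_distrib_left)
    also have "\<dots> = (\<Sum>V\<in>{V\<in>D. V \<subseteq> S \<and> V \<subseteq> T}. (lam S * prod \<delta> S) * (lam T * prod \<delta> T) / h V)"
      using ST D_down by (intro sum.cong) auto
    also have "\<dots> = (\<Sum>V\<in>D. if V \<subseteq> S \<and> V \<subseteq> T then (lam S * prod \<delta> S) * (lam T * prod \<delta> T) / h V else 0)"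
      by (rule sum.inter_filter) simp
    finally show "lam S * lam T * prod \<delta> (S \<union> T) = \<dots>" .
  qed
  also have "\<dots> = (\<Sum>S\<in>D. \<Sum>V\<in>D. \<Sum>T\<in>D. if V \<subseteq> S \<and> V \<subseteq> T then (lam S * prod \<delta> S) * (lam T * prod \<delta> T) / h V else 0)"
    by (rule sum.cong[OF refl]) (rule sum.swap)
  also have "\<dots> = (\<Sum>V\<in>D. \<Sum>S\<in>D. \<Sum>T\<in>D. if V \<subseteq> S \<and> V \<subseteq> T then (lam S * prod \<delta> S) * (lam T * prod \<delta> T) / h V else 0)"
    by (rule sum.swap)
  also have "\<dots> = (\<Sum>V\<in>D. (\<Sum>S\<in>{S\<in>D. V \<subseteq> S}. lam S * prod \<delta> S)\<^sup>2 / h V)"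
  proof (intro sum.cong refl)
    fix V assume "V \<in> D"
    have "(\<Sum>S\<in>{S\<in>D. V \<subseteq> S}. lam S * prod \<delta> S)\<^sup>2 / h V =
       (\<Sum>S\<in>D. if V \<subseteq> S then lam S * prod \<delta> S else 0) * (\<Sum>T\<in>D. if V \<subseteq> T then lam T * prod \<delta> T else 0) / h V"
      by (simp add: power2_eq_square sum.inter_filter)
    also have "\<dots> = (\<Sum>S\<in>D. \<Sum>T\<in>D. if V \<subseteq> S \<and> V \<subseteq> T then (lam S * prod \<delta> S) * (lam T * prod \<delta> T) / h V else 0)"
      unfolding sum_product sum_divide_distrib by (intro sum.cong) auto
    finally show "(\<Sum>S\<in>D. \<Sum>T\<in>D. if V \<subseteq> S \<and> V \<subseteq> T then (lam S * prod \<delta> S) * (lam T * prod \<delta> T) / h V else 0)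
      = (\<Sum>S\<in>{S\<in>D. V \<subseteq> S}. lam S * prod \<delta> S)\<^sup>2 / h V" ..
  qed
  also have "\<dots> = (\<Sum>V\<in>D. h V / J\<^sup>2)"
  proof (intro sum.cong refl)
    fix V assume V: "V \<in> D"
    show "(\<Sum>S\<in>{S\<in>D. V \<subseteq> S}. lam S * prod \<delta> S)\<^sup>2 / h V = h V / J\<^sup>2"
      unfolding zeta[OF V] using h_pos[OF D_sub[OF V]] J_pos
      by (simp add: power_mult_distrib power_divide field_simps power2_eq_square flip: power_mult power_add)
  qed
  also have "\<dots> = 1 / J"
    unfolding sum_divide_distrib[symmetric] J_def[symmetric] using J_pos by (simp add: power2_eq_square)
  finally show ?thesis .
qed

text \<open>Since \<open>lam {} = 1\<close>, the square \<open>(F n)\<^sup>2\<close> majorises the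
  indicator of \<open>A n = {}\<close> whatever the other weights are. In the error term
  \<open>\<bar>lam\<bar> \<le> 1\<close> and \<open>prod d (S \<union> T) \<le> Q * Q\<close>, so
  each of the pairs (S, T) costs at most \<open>R * (Q * Q)\<close>.\<close>

theorem selberg_sieve:
  fixes N :: "'n set" and A :: "'n \<Rightarrow> 'a set" and X R :: real
  assumes finN: "finite N" and A: "\<And>n. n \<in> N \<Longrightarrow> A n \<subseteq> P"
    and cnt: "\<And>S. S \<subseteq> P \<Longrightarrow> \<bar>real (card {n\<in>N. S \<subseteq> A n}) - X * prod \<delta> S\<bar> \<le> R * prod d S"
    and R: "R \<ge> 0"
  shows "real (card {n\<in>N. A n = {}}) \<le> X / J + R * (Q * card D)\<^sup>2"
proof -
  define F where "F n = (\<Sum>S\<in>D. if S \<subseteq> A n then lam S else 0)" for n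
  have F1: "F n = 1" if "A n = {}" for n
  proof -
    have "F n = (\<Sum>S\<in>D. if S = {} then lam S else 0)" unfolding F_def that by (intro sum.cong) auto
    thus ?thesis using empty_D lam_empty by (simp add: sum.delta)
  qed
  have "real (card {n\<in>N. A n = {}}) = (\<Sum>n\<in>{n\<in>N. A n = {}}. (F n)\<^sup>2)"
    using F1 by simp
  also have "\<dots> \<le> (\<Sum>n\<in>N. (F n)\<^sup>2)" using finN by (intro sum_mono2) auto
  also have "\<dots> = (\<Sum>n\<in>N. \<Sum>S\<in>D. \<Sum>T\<in>D. lam S * lam T * (if S \<union> T \<subseteq> A n then 1 else 0))"
    unfolding F_def power2_eq_square sum_product by (intro sum.cong) auto
  also have "\<dots> = (\<Sum>S\<in>D. \<Sum>T\<in>D. \<Sum>n\<in>N. lam S * lam T * (if S \<union> T \<subseteq> A n then 1 else 0))"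
    by (subst sum.swap) (intro sum.cong refl, rule sum.swap)
  also have "\<dots> = (\<Sum>S\<in>D. \<Sum>T\<in>D. lam S * lam T * real (card {n\<in>N. S \<union> T \<subseteq> A n}))"
  proof (intro sum.cong refl)
    fix S T
    have "(\<Sum>n\<in>N. (if S \<union> T \<subseteq> A n then 1 else 0 :: real)) = real (card {n\<in>N. S \<union> T \<subseteq> A n})"
      using finN by (subst sum.inter_filter[symmetric]) auto
    thus "(\<Sum>n\<in>N. lam S * lam T * (if S \<union> T \<subseteq> A n then 1 else 0)) = lam S * lam T * real (card {n\<in>N. S \<union> T \<subseteq> A n})"
      by (simp only: sum_distrib_left[symmetric])
  qed
  also have "\<dots> \<le> (\<Sum>S\<in>D. \<Sum>T\<in>D. X * (lam S * lam T * prod \<delta> (S \<union> T)) + R * (Q * Q))"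
  proof (intro sum_mono)
    fix S T assume ST: "S \<in> D" "T \<in> D"
    have fin: "finite S" "finite T" using ST D_fin by auto
    have sub: "S \<union> T \<subseteq> P" using ST D_sub by auto
    define c where "c = real (card {n\<in>N. S \<union> T \<subseteq> A n}) - X * prod \<delta> (S \<union> T)"
    have d0: "prod d U \<ge> 1" if "U \<subseteq> P" for U using d that by (intro prod_ge_1) auto
    have "prod d (S \<union> T) * 1 \<le> prod d (S \<union> T) * prod d (S \<inter> T)"
      using d0[OF sub] d0[of "S \<inter> T"] sub by (intro mult_left_mono) auto
    also have "\<dots> = prod d S * prod d T" using fin by (rule prod.union_inter)
    also have "\<dots> \<le> Q * Q"
    proof (rule mult_mono)
      show "prod d S \<le> Q" "prod d T \<le> Q" using ST by (auto simp: D_def)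
      show "0 \<le> Q" using Q by simp
      show "0 \<le> prod d T" using d0[of T] sub by simp
    qed
    finally have "prod d (S \<union> T) \<le> Q * Q" by simp
    hence "R * prod d (S \<union> T) \<le> R * (Q * Q)" using R by (rule mult_left_mono)
    hence "\<bar>c\<bar> \<le> R * (Q * Q)" using cnt[OF sub] unfolding c_def by linarith
    moreover have "\<bar>lam S * lam T\<bar> \<le> 1" using abs_lam_le ST by (simp add: abs_mult mult_le_one)
    ultimately have "\<bar>lam S * lam T * c\<bar> \<le> 1 * (R * (Q * Q))"
      unfolding abs_mult[of "lam S * lam T" c] by (intro mult_mono) auto
    hence "lam S * lam T * c \<le> R * (Q * Q)" by linarith
    thus "lam S * lam T * real (card {n\<in>N. S \<union> T \<subseteq> A n}) \<le> X * (lam S * lam T * prod \<delta> (S \<union> T)) + R * (Q * Q)"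
      by (simp add: c_def algebra_simps)
  qed
  also have "\<dots> = X * (\<Sum>S\<in>D. \<Sum>T\<in>D. lam S * lam T * prod \<delta> (S \<union> T)) + R * (Q * card D)\<^sup>2"
    by (simp add: sum.distrib sum_distrib_left power2_eq_square mult_ac)
  finally show ?thesis by (simp add: quadratic_form)
qed

end

text \<open>The full sum of \<open>h\<close> over all subsets is the Euler product, and Rankin's
  trick with exponent 1 / ln t shows that the part beyond the level is at most half of it. The tilt
  costs exp(6c), where 6 bounds the 2e of \<open>rankin_cost\<close> with b = 1, and gains at least
  exp(6c + 1); the surplus 1 leaves the factor exp(-1), which is below 1/2.\<close>

lemma J_ge_half:
  fixes P :: "nat set" and \<delta> :: "nat \<Rightarrow> real"
  assumes s: "selberg P \<delta> real Q" and P: "P \<subseteq> primes_le t" and t: "t \<ge> 2"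
    and c: "c \<ge> 0" "\<And>p. p \<in> P \<Longrightarrow> \<delta> p / (1 - \<delta> p) \<le> c / real p"
    and lnQ: "ln Q \<ge> (6 * c + 1) * ln t"
  shows "2 * selberg.J P \<delta> real Q \<ge> (\<Prod>p\<in>P. 1 / (1 - \<delta> p))"
proof -
  interpret selberg P \<delta> real Q by fact
  define \<sigma> where "\<sigma> = 1 / ln t"
  have lt: "ln t > 0" using t by simp
  have \<sigma>0: "\<sigma> > 0" using lt by (simp add: \<sigma>_def)
  let ?h = "\<lambda>p. \<delta> p / (1 - \<delta> p)"
  have Qpos: "Q > 0" using selberg_axioms by (simp add: selberg_def)
  have h0: "?h p > 0" if "p \<in> P" for p using \<delta>[OF that] by simp
  have total: "(\<Sum>S\<in>Pow P. h S) = (\<Prod>p\<in>P. 1 + ?h p)"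
    unfolding h_def by (rule sum_prod_subsets[OF finP])
  have DP: "D \<subseteq> Pow P" using D_sub by auto
  have "(\<Sum>S\<in>Pow P - D. h S) \<le> (\<Sum>S\<in>Pow P - D. Q powr (-\<sigma>) * (\<Prod>p\<in>S. ?h p * real p powr \<sigma>))"
  proof (rule sum_mono)
    fix S assume S: "S \<in> Pow P - D"
    have h: "h S > 0" using S h_pos by auto
    have pos: "prod real S > 0" using S P by (intro prod_pos) (auto dest!: subsetD primes_leD(3))
    have "Q < prod real S" using S by (auto simp: D_def)
    hence "1 \<le> (prod real S / Q) powr \<sigma>" using Qpos \<sigma>0 by (intro ge_one_powr_ge_zero) auto
    also have "\<dots> = Q powr (-\<sigma>) * (\<Prod>p\<in>S. real p) powr \<sigma>"
      using Qpos pos by (simp add: powr_divide powr_minus field_simps)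
    also have "(\<Prod>p\<in>S. real p) powr \<sigma> = (\<Prod>p\<in>S. real p powr \<sigma>)"
      by (subst prod_powr_distrib) auto
    finally have "h S * 1 \<le> h S * (Q powr (-\<sigma>) * (\<Prod>p\<in>S. real p powr \<sigma>))"
      using h by (intro mult_left_mono) auto
    thus "h S \<le> Q powr (-\<sigma>) * (\<Prod>p\<in>S. ?h p * real p powr \<sigma>)"
      unfolding h_def prod.distrib by (simp only: mult_ac mult_1_right mult_1_left)
  qed
  also have "\<dots> \<le> (\<Sum>S\<in>Pow P. Q powr (-\<sigma>) * (\<Prod>p\<in>S. ?h p * real p powr \<sigma>))"
  proof (rule sum_mono2)
    fix S assume "S \<in> Pow P - (Pow P - D)"
    hence "S \<subseteq> P" by auto
    hence "?h p * real p powr \<sigma> \<ge> 0" if "p \<in> S" for p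
      using h0[of p] that by (intro mult_nonneg_nonneg) auto
    hence "(\<Prod>p\<in>S. ?h p * real p powr \<sigma>) \<ge> 0" by (rule prod_nonneg)
    thus "0 \<le> Q powr (-\<sigma>) * (\<Prod>p\<in>S. ?h p * real p powr \<sigma>)" by simp
  qed (use finP in auto)
  also have "\<dots> = Q powr (-\<sigma>) * (\<Prod>p\<in>P. 1 + ?h p * real p powr \<sigma>)"
    unfolding sum_distrib_left[symmetric] by (subst sum_prod_subsets[OF finP]) simp
  \<comment> \<open>The elementary inequality
    \<open>1 + H * a \<le> (1 + H) * (1 + H * (a - 1))\<close> for \<open>a \<ge> 1\<close>
    separates the untilted Euler product from the cost of the tilt.\<close>
  also have "(\<Prod>p\<in>P. 1 + ?h p * real p powr \<sigma>) \<le> (\<Prod>p\<in>P. (1 + ?h p) * exp (c * ((real p powr \<sigma> - 1) / real p)))"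
  proof (rule prod_mono)
    fix p assume p: "p \<in> P"
    have p2: "p \<ge> 2" using p P by (auto dest: primes_leD)
    have ps: "real p powr \<sigma> \<ge> 1" using p2 \<sigma>0 by (intro ge_one_powr_ge_zero) auto
    define H where "H = ?h p"
    have H: "H > 0" "H \<le> c / real p" using h0[OF p] c(2)[OF p] by (auto simp: H_def)
    have "H * (real p powr \<sigma> - 1) \<le> c / real p * (real p powr \<sigma> - 1)"
      using H ps by (intro mult_right_mono) auto
    hence "1 + H * (real p powr \<sigma> - 1) \<le> exp (c * ((real p powr \<sigma> - 1) / real p))"
      using exp_ge_add_one_self[of "c * ((real p powr \<sigma> - 1) / real p)"]
      by (simp only: times_divide_eq_left times_divide_eq_right)
    hence "(1 + H) * (1 + H * (real p powr \<sigma> - 1)) \<le> (1 + H) * exp (c * ((real p powr \<sigma> - 1) / real p))"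
      using H by (intro mult_left_mono) auto
    moreover have "1 + H * real p powr \<sigma> \<le> (1 + H) * (1 + H * (real p powr \<sigma> - 1))"
    proof -
      have "(1 + H) * (1 + H * (real p powr \<sigma> - 1)) = 1 + H * real p powr \<sigma> + H * (H * (real p powr \<sigma> - 1))"
        by (simp add: algebra_simps)
      moreover have "H * (H * (real p powr \<sigma> - 1)) \<ge> 0" using H ps by simp
      ultimately show ?thesis by linarith
    qed
    moreover have "0 \<le> 1 + H * real p powr \<sigma>" using H by simp
    ultimately show "0 \<le> 1 + ?h p * real p powr \<sigma> \<and>
        1 + ?h p * real p powr \<sigma> \<le> (1 + ?h p) * exp (c * ((real p powr \<sigma> - 1) / real p))"
      unfolding H_def by linarith
  qed
  also have "(\<Prod>p\<in>P. (1 + ?h p) * exp (c * ((real p powr \<sigma> - 1) / real p))) =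
      (\<Prod>p\<in>P. 1 + ?h p) * exp (c * (\<Sum>p\<in>P. (real p powr \<sigma> - 1) / real p))"
    using finP by (simp add: prod.distrib exp_sum sum_distrib_left)
  finally have tail: "(\<Sum>S\<in>Pow P - D. h S) \<le>
      Q powr (-\<sigma>) * ((\<Prod>p\<in>P. 1 + ?h p) * exp (c * (\<Sum>p\<in>P. (real p powr \<sigma> - 1) / real p)))"
    by (simp add: mult_left_mono)
  have "(\<Sum>p\<in>P. (real p powr \<sigma> - 1) / real p) \<le> (\<Sum>p\<in>primes_le t. (real p powr \<sigma> - 1) / real p)"
  proof (rule sum_mono2)
    fix p assume "p \<in> primes_le t - P"
    hence "p \<ge> 2" by (auto dest: primes_leD(3))
    thus "0 \<le> (real p powr \<sigma> - 1) / real p" using \<sigma>0 by (simp add: ge_one_powr_ge_zero)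
  qed (use P in auto)
  also have "\<dots> \<le> 2 * 1 * exp 1"
    using t \<sigma>0 lt by (intro rankin_cost) (auto simp: \<sigma>_def)
  also have "\<dots> \<le> 6" using exp_le by simp
  finally have "c * (\<Sum>p\<in>P. (real p powr \<sigma> - 1) / real p) \<le> 6 * c" using c(1) by (simp add: mult_left_mono mult.commute)
  moreover have "\<sigma> * ln Q \<ge> 6 * c + 1"
    using lnQ lt by (simp add: \<sigma>_def le_divide_eq)
  ultimately have "Q powr (-\<sigma>) * exp (c * (\<Sum>p\<in>P. (real p powr \<sigma> - 1) / real p)) \<le> exp (-1)"
    using Qpos by (simp add: powr_def flip: exp_add)
  also have "exp (-1 :: real) \<le> 1 / 2" using exp_ge_add_one_self[of "1::real"] by (simp add: exp_minus field_simps)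
  finally have ee: "Q powr (-\<sigma>) * exp (c * (\<Sum>p\<in>P. (real p powr \<sigma> - 1) / real p)) \<le> 1 / 2" .
  have Pi0: "(\<Prod>p\<in>P. 1 + ?h p) \<ge> 0"
  proof (rule prod_nonneg)
    fix p assume "p \<in> P"
    with h0[OF this] show "1 + ?h p \<ge> 0" by linarith
  qed
  from mult_left_mono[OF ee Pi0] tail have "(\<Sum>S\<in>Pow P - D. h S) \<le> (\<Prod>p\<in>P. 1 + ?h p) / 2"
    by (simp add: mult_ac)
  moreover have "(\<Sum>S\<in>Pow P. h S) = J + (\<Sum>S\<in>Pow P - D. h S)"
    unfolding J_def using DP finP by (subst sum.subset_diff[of D]) auto
  ultimately have "2 * J \<ge> (\<Prod>p\<in>P. 1 + ?h p)" unfolding total by linarith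
  also have "(\<Prod>p\<in>P. 1 + ?h p) = (\<Prod>p\<in>P. 1 / (1 - \<delta> p))"
  proof (rule prod.cong)
    fix p assume "p \<in> P"
    from \<delta>[OF this] show "1 + ?h p = 1 / (1 - \<delta> p)" by (simp add: field_simps)
  qed auto
  finally show ?thesis .
qed

lemma inj_on_prod_primes:
  assumes "\<And>S p. S \<in> A \<Longrightarrow> p \<in> S \<Longrightarrow> prime p" "\<And>S. S \<in> A \<Longrightarrow> finite S"
  shows "inj_on (\<lambda>S. \<Prod>S :: nat) A"
proof (rule inj_onI)
  have sub: "S \<subseteq> T" if ST: "S \<in> A" "T \<in> A" "\<Prod>S = (\<Prod>T :: nat)" for S T
  proof
    fix p assume p: "p \<in> S"
    have "p dvd \<Prod>T" using ST p assms(2) by (metis dvd_prodI)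
    then obtain q where "q \<in> T" "p dvd q"
      using ST p assms by (meson prime_dvd_prod_iff)
    thus "p \<in> T" using assms(1) ST p primes_dvd_imp_eq by blast
  qed
  fix S T assume "S \<in> A" "T \<in> A" "\<Prod>S = (\<Prod>T :: nat)"
  thus "S = T" using sub[of S T] sub[of T S] by simp
qed

text \<open>The condition B modulo m rides along as a factor by the Chinese remainder theorem, which
  makes the bound uniform in B. The exponent 6 is what the error needs: there are at most Q sets in
  D, so the error has a factor Q^4, and \<open>J \<le> Q * Q\<close>; hence
  \<open>Q ^ 6 \<le> y / m\<close> keeps it below the main term X / J. The constant 4 is 2 from this
  doubling times 2 from \<open>J_ge_half\<close>.\<close>

theorem sieve_interval:
  fixes x y t Q :: real and g m :: nat
  assumes B: "periodic_mod B m" and m: "m > 0"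
    and P: "P \<subseteq> primes_le t" and t: "t \<ge> 2"
    and cop: "\<And>p. p \<in> P \<Longrightarrow> coprime m p"
    and Z: "\<And>p. p \<in> P \<Longrightarrow> periodic_mod (Z p) p"
    and Zg: "\<And>p. p \<in> P \<Longrightarrow> pcount (Z p) p \<le> g" "\<And>p. p \<in> P \<Longrightarrow> pcount (Z p) p < p"
    and hQ: "Q \<ge> 1" "Q ^ 6 \<le> y / m" "ln Q \<ge> (6 * real (g * (g + 1)) + 1) * ln t"
  shows "real (card {n :: int. x < n \<and> n \<le> x + y \<and> B n \<and> (\<forall>p\<in>P. \<not> Z p n)})
     \<le> 4 * (real (pcount B m) * (y / m)) * (\<Prod>p\<in>P. 1 - real (pcount (Z p) p) / p)"
proof -
  \<comment> \<open>The sieve asks for positive densities, so primes without a forbidden class are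
    removed; they contribute the factor 1 to the final product.\<close>
  define P' where "P' = {p\<in>P. pcount (Z p) p > 0}"
  define \<delta> where "\<delta> = (\<lambda>p. real (pcount (Z p) p) / real p)"
  have finP: "finite P" using P finite_subset by blast
  have finP': "finite P'" using finP by (simp add: P'_def)
  have pr: "p \<ge> 2" "prime p" if "p \<in> P" for p using that P by (auto dest: primes_leD)
  have y0: "y / m > 0" using hQ(1,2) by (smt (verit) one_le_power)
  hence ypos: "y > 0" using m by (simp add: zero_less_divide_iff)
  interpret selberg P' \<delta> real Q
  proof
    show "finite P'" by fact
    fix p assume p: "p \<in> P'"
    hence "p \<in> P" by (simp add: P'_def)
    note pr[OF this] Zg(2)[OF this]
    thus "0 < \<delta> p" "\<delta> p < 1" "real p \<ge> 1" using p by (auto simp: \<delta>_def P'_def)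
  qed (rule hQ(1))
  let ?N = "{n :: int. x < n \<and> n \<le> x + y \<and> B n}"
  define A where "A = (\<lambda>n. {p\<in>P'. Z p n})"
  define X where "X = real (pcount B m) * (y / m)"
  have X0: "X \<ge> 0" unfolding X_def using y0 by (intro mult_nonneg_nonneg) auto
  have finN: "finite ?N"
    by (rule finite_subset[of _ "{\<lfloor>x\<rfloor>..\<lceil>x+y\<rceil>}"]) (auto simp: floor_le_iff le_ceiling_iff)
  have main: "real (card {n\<in>?N. A n = {}}) \<le> X / J + real (pcount B m) * (Q * card D)\<^sup>2"
  proof (rule selberg_sieve[OF finN])
    fix S assume S: "S \<subseteq> P'"
    hence SP: "S \<subseteq> P" and finS: "finite S" using finP' by (auto simp: P'_def intro: finite_subset)
    have per: "periodic_mod (\<lambda>a. \<forall>p\<in>S. Z p a) (\<Prod>S)"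
      using SP finS Z by (intro periodic_mod_prod) auto
    have cnt: "pcount (\<lambda>a. \<forall>p\<in>S. Z p a) (\<Prod>S) = (\<Prod>p\<in>S. pcount (Z p) p)"
    proof (rule pcount_prod)
      fix p assume "p \<in> S"
      with SP pr(2)[of p] Z show "p > 0" "periodic_mod (Z p) p" by (auto simp: prime_gt_0_nat)
    next
      fix p q assume "p \<in> S" "q \<in> S" "p \<noteq> q"
      thus "coprime p q" using SP pr(2)[of p] pr(2)[of q] by (intro primes_coprime) auto
    qed (rule finS)
    have Spos: "\<Prod>S > 0" using SP pr by (intro prod_pos) (auto dest!: subsetD[of S P] intro: prime_gt_0_nat)
    have cnt': "pcount (\<lambda>a. B a \<and> (\<forall>p\<in>S. Z p a)) (m * \<Prod>S) = pcount B m * (\<Prod>p\<in>S. pcount (Z p) p)"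
      unfolding cnt[symmetric] using SP cop by (intro pcount_crt B per m Spos prod_coprime_right) auto
    have per': "periodic_mod (\<lambda>a. B a \<and> (\<forall>p\<in>S. Z p a)) (m * \<Prod>S)"
      by (intro periodic_mod_conj periodic_mod_dvd[OF B] periodic_mod_dvd[OF per]) auto
    have "\<bar>real (card {n :: int. x < n \<and> n \<le> x + y \<and> (B n \<and> (\<forall>p\<in>S. Z p n))}) -
       real (pcount (\<lambda>a. B a \<and> (\<forall>p\<in>S. Z p a)) (m * \<Prod>S)) * (y / real (m * \<Prod>S))\<bar> \<le> pcount (\<lambda>a. B a \<and> (\<forall>p\<in>S. Z p a)) (m * \<Prod>S)"
      using m Spos ypos by (intro card_periodic_interval[OF per']) auto
    moreover have "{n :: int. x < n \<and> n \<le> x + y \<and> (B n \<and> (\<forall>p\<in>S. Z p n))} = {n\<in>?N. S \<subseteq> A n}"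
      using S by (auto simp: A_def)
    moreover have "real (pcount (\<lambda>a. B a \<and> (\<forall>p\<in>S. Z p a)) (m * \<Prod>S)) * (y / real (m * \<Prod>S)) = X * prod \<delta> S"
      unfolding cnt' X_def \<delta>_def by (simp add: prod_dividef)
    moreover have "real (pcount (\<lambda>a. B a \<and> (\<forall>p\<in>S. Z p a)) (m * \<Prod>S)) \<le> real (pcount B m) * prod real S"
      unfolding cnt' of_nat_mult of_nat_prod using SP by (intro mult_left_mono prod_mono) (auto intro: pcount_le)
    ultimately show "\<bar>real (card {n\<in>?N. S \<subseteq> A n}) - X * prod \<delta> S\<bar> \<le> real (pcount B m) * prod real S"
      by simp
  qed (auto simp: A_def)
  have err: "real (pcount B m) * (Q * card D)\<^sup>2 \<le> X / J"
  proof -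
    have "inj_on (\<lambda>S. \<Prod>S) D"
    proof (rule inj_on_prod_primes)
      fix S p assume "S \<in> D" "p \<in> S"
      hence "p \<in> P'" using D_sub by blast
      thus "prime p" using pr(2) by (simp add: P'_def)
    qed (rule D_fin)
    moreover have "(\<lambda>S. \<Prod>S) ` D \<subseteq> {1..nat \<lfloor>Q\<rfloor>}"
    proof
      fix k assume "k \<in> (\<lambda>S. \<Prod>S) ` D"
      then obtain S where S: "S \<in> D" "k = \<Prod>S" by auto
      have "\<Prod>S > 0" using S D_sub pr by (intro prod_pos) (force simp: P'_def intro: prime_gt_0_nat)
      moreover have "real (\<Prod>S) \<le> Q" using S by (simp add: D_def)
      ultimately show "k \<in> {1..nat \<lfloor>Q\<rfloor>}" using S by (auto intro: le_nat_floor)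
    qed
    ultimately have "card D \<le> card {1..nat \<lfloor>Q\<rfloor>}" by (intro card_inj_on_le) auto
    also have "real \<dots> \<le> Q" using hQ(1) by simp
    finally have cD: "real (card D) \<le> Q" by simp
    \<comment> \<open>With w forbidden classes, \<delta> / (1 - \<delta>) equals w / (p - w), which
      is at most p because p - w is at least 1. Hence \<open>h S\<close> is bounded by the modulus
      of S, and \<open>J\<close> by Q times the number of sets.\<close>
    have "h S \<le> Q" if S: "S \<in> D" for S
    proof -
      have "h S \<le> prod real S" unfolding h_def
      proof (rule prod_mono)
        fix p assume "p \<in> S"
        hence p: "p \<in> P" using D_sub[OF S] by (auto simp: P'_def)
        define w where "w = pcount (Z p) p"
        have w: "w < p" "p \<ge> 2" using Zg(2)[OF p] pr[OF p] by (auto simp: w_def)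
        have "\<delta> p / (1 - \<delta> p) = real w / (real p - real w)" using w by (simp add: \<delta>_def w_def field_simps)
        also have "\<dots> \<le> real w / 1" using w by (intro divide_left_mono) auto
        also have "\<dots> \<le> real p" using w by simp
        finally have "\<delta> p / (1 - \<delta> p) \<le> real p" .
        moreover have "\<delta> p / (1 - \<delta> p) = real w / (real p - real w)" using w by (simp add: \<delta>_def w_def field_simps)
        hence "\<delta> p / (1 - \<delta> p) \<ge> 0" using w by simp
        ultimately show "0 \<le> \<delta> p / (1 - \<delta> p) \<and> \<delta> p / (1 - \<delta> p) \<le> real p" by simp
      qed
      also have "\<dots> \<le> Q" using S by (simp add: D_def)
      finally show ?thesis .
    qed
    hence "J \<le> real (card D) * Q" unfolding J_def by (rule sum_bounded_above)
    also have "\<dots> \<le> Q * Q" using cD hQ by (intro mult_right_mono) auto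
    finally have JQ: "J \<le> Q * Q" .
    have "(Q * card D)\<^sup>2 * J \<le> (Q * Q)\<^sup>2 * (Q * Q)"
      using JQ cD hQ(1) J_pos by (intro mult_mono power_mono mult_left_mono) auto
    also have "\<dots> = Q ^ 6" by (simp add: eval_nat_numeral)
    also have "\<dots> \<le> y / m" by (rule hQ(2))
    finally have "(Q * card D)\<^sup>2 \<le> (y / m) / J" using J_pos by (simp only: le_divide_eq if_True)
    thus ?thesis unfolding X_def using mult_left_mono[of "(Q * card D)\<^sup>2" "(y / m) / J" "real (pcount B m)"] by simp
  qed
  have J: "1 / (2 * J) \<le> (\<Prod>p\<in>P'. 1 - \<delta> p)"
  proof -
    have "2 * J \<ge> (\<Prod>p\<in>P'. 1 / (1 - \<delta> p))"
    proof (rule J_ge_half[OF selberg_axioms _ t])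
      show "P' \<subseteq> primes_le t" using P by (auto simp: P'_def)
      show "(6 * real (g * (g + 1)) + 1) * ln t \<le> ln Q" by fact
      fix p assume "p \<in> P'"
      hence p: "p \<in> P" by (simp add: P'_def)
      define w where "w = pcount (Z p) p"
      have w: "w < p" "p \<ge> 2" "w \<le> g" using Zg[OF p] pr[OF p] by (auto simp: w_def)
      have eq: "\<delta> p / (1 - \<delta> p) = real w / (real p - real w)" using w by (simp add: \<delta>_def w_def field_simps)
      have pw: "real p - real w \<ge> 1" using w by simp
      \<comment> \<open>From p - w at least 1 follows p \<le> (1 + w)(p - w). Thus w / (p - w) is at
        most g(g + 1)/p even for primes not much larger than g.\<close>
      have "real p = (real p - real w) + real w * 1" by simp
      also have "\<dots> \<le> (real p - real w) + real w * (real p - real w)" using pw by (intro add_left_mono mult_left_mono) auto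
      also have "\<dots> = (1 + real w) * (real p - real w)" by (simp add: algebra_simps)
      also have "\<dots> \<le> (real g + 1) * (real p - real w)" using w pw by (intro mult_right_mono) auto
      finally have "real p \<le> (real g + 1) * (real p - real w)" .
      hence "real w * real p \<le> real g * ((real g + 1) * (real p - real w))" using w by (intro mult_mono) auto
      thus "\<delta> p / (1 - \<delta> p) \<le> real (g * (g + 1)) / real p"
        unfolding eq using pw w by (simp add: field_simps)
    qed simp
    moreover have "(\<Prod>p\<in>P'. 1 / (1 - \<delta> p)) = 1 / (\<Prod>p\<in>P'. 1 - \<delta> p)" by (simp add: prod_dividef)
    moreover have "(\<Prod>p\<in>P'. 1 - \<delta> p) > 0" using \<delta> by (intro prod_pos) auto
    ultimately have "1 \<le> (2 * J) * (\<Prod>p\<in>P'. 1 - \<delta> p)" by (simp only: divide_le_eq if_True)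
    thus ?thesis using J_pos by (simp only: divide_le_eq if_True mult_pos_pos zero_less_numeral mult.commute)
  qed
  have eqP: "(\<Prod>p\<in>P'. 1 - \<delta> p) = (\<Prod>p\<in>P. 1 - \<delta> p)"
    by (rule prod.mono_neutral_left[OF \<open>finite P\<close>]) (auto simp: P'_def \<delta>_def)
  show ?thesis
  proof (cases "\<exists>p\<in>P - P'. \<exists>a. Z p a")
    case True
    then obtain p a where p: "p \<in> P" "pcount (Z p) p = 0" "Z p a" by (auto simp: P'_def)
    have "Z p (a mod int p)" using periodic_modD[OF Z[OF p(1)], of a] p by simp
    hence "a mod int p \<in> {a \<in> {0..<int p}. Z p a}" using pr(1)[OF p(1)] by simp
    hence "pcount (Z p) p > 0" unfolding pcount_def by (intro card_gt_0_iff[THEN iffD2]) auto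
    thus ?thesis using p by simp
  next
    case False
    hence "{n\<in>?N. A n = {}} = {n :: int. x < n \<and> n \<le> x + y \<and> B n \<and> (\<forall>p\<in>P. \<not> Z p n)}"
      by (auto simp: A_def P'_def)
    hence "real (card {n :: int. x < n \<and> n \<le> x + y \<and> B n \<and> (\<forall>p\<in>P. \<not> Z p n)}) \<le> 4 * X * (1 / (2 * J))"
      using main err by simp
    also have "\<dots> \<le> 4 * X * (\<Prod>p\<in>P. 1 - \<delta> p)"
      using J X0 unfolding eqP by (intro mult_left_mono) auto
    finally show ?thesis by (simp add: X_def \<delta>_def)
  qed
qed

section \<open>Concentration of sums of independent random vectors\<close>

lemma sin_ge_third:
  fixes x :: real
  assumes "0 \<le> x" "x \<le> pi / 2"
  shows "sin x \<ge> x / 3"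
proof -
  have x2: "x < 2" using assms pi_half_less_two by linarith
  have "\<bar>sin x - (\<Sum>m<3. sin_coeff m * x ^ m)\<bar> \<le> inverse (fact 3) * \<bar>x\<bar> ^ 3"
    by (rule Maclaurin_sin_bound)
  hence "\<bar>sin x - x\<bar> \<le> x ^ 3 / 6"
    using assms by (simp add: eval_nat_numeral sin_coeff_def divide_simps)
  hence "x - sin x \<le> x ^ 3 / 6" by linarith
  hence "sin x \<ge> x - x * (x * x) / 6" by (simp add: power3_eq_cube mult.assoc)
  moreover have "x * (x * x) \<le> x * 4"
    using assms x2 mult_mono[of x 2 x 2] by (intro mult_left_mono) auto
  ultimately show ?thesis by simp
qed

lemma one_minus_cos_ge:
  fixes x :: real
  assumes "0 \<le> x" "x \<le> pi"
  shows "1 - cos x \<ge> x\<^sup>2 / 18"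
proof -
  have "1 - cos x = 2 * (sin (x / 2))\<^sup>2"
    using cos_double_sin[of "x / 2"] by simp
  moreover have "(sin (x / 2))\<^sup>2 \<ge> (x / 2 / 3)\<^sup>2"
    using sin_ge_third[of "x / 2"] assms by (intro power_mono) auto
  ultimately show ?thesis by (simp add: power2_eq_square)
qed

text \<open>Comparison with a telescoping sum. The subtracted last term is what makes the induction
  close.\<close>

lemma sum_inverse_square_linear_le:
  fixes c :: real
  assumes c: "c > 0"
  shows "(\<Sum>h\<le>n. 1 / (1 + c * real h)\<^sup>2) \<le> 1 + 1 / c - 1 / (c * (1 + c * real n))"
proof (induction n)
  case 0
  thus ?case using c by simp
next
  case (Suc n)
  define a where "a = 1 + c * real n"
  have a: "a > 0" using c by (auto simp: a_def intro: add_pos_nonneg)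
  have a': "1 + c * real (Suc n) = a + c" by (simp add: a_def algebra_simps)
  have "1 / (a + c)\<^sup>2 \<le> 1 / (a * (a + c))"
    using a c by (intro divide_left_mono) (auto simp: power2_eq_square intro!: mult_right_mono)
  also have "\<dots> = 1 / (c * a) - 1 / (c * (a + c))"
    using a c by (simp add: divide_simps)
  finally show ?case using Suc unfolding sum.atMost_Suc a' a_def[symmetric] by linarith
qed

lemma exp_cos_reflect:
  assumes "N > 0" "h \<le> N"
  shows "cos (2 * pi * real (N - h) / real N) = cos (2 * pi * real h / real N)"
proof -
  have "2 * pi * real (N - h) / real N = 2 * pi - 2 * pi * real h / real N"
    using assms by (simp add: of_nat_diff field_simps)
  thus ?thesis by (simp add: cos_diff)
qed

text \<open>A discrete form of the estimate exp(-A) I_0(A) << A^(-1/2) for the Bessel function: the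
  integrand is like a Gaussian of width A^(-1/2). The lower bound on N ensures that the single term
  h = 0, which contributes 1/N, does not spoil this.\<close>

lemma average_exp_cos_le:
  fixes A :: real
  assumes A: "A \<ge> 0" and N: "N \<ge> 1" "real N \<ge> A + 1"
  shows "(\<Sum>h<N. exp (- A * (1 - cos (2 * pi * real h / real N)))) / real N \<le> 15 / sqrt (1 + A)"
proof (cases "A \<ge> 1")
  case False
  have "(\<Sum>h<N. exp (- A * (1 - cos (2 * pi * real h / real N)))) \<le> (\<Sum>h<N. 1)"
    using A by (intro sum_mono) (auto simp: mult_nonneg_nonneg)
  hence "(\<Sum>h<N. exp (- A * (1 - cos (2 * pi * real h / real N)))) / real N \<le> 1" using N by simp
  also have "\<dots> \<le> 15 / sqrt (1 + A)"
  proof -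
    have "sqrt (1 + A) \<le> sqrt 225" using False by (intro real_sqrt_le_mono) auto
    also have "sqrt 225 = (15 :: real)" by (rule real_sqrt_unique) auto
    finally show ?thesis using A by simp
  qed
  finally show ?thesis .
next
  case True
  \<comment> \<open>Chosen so that A (h / (2N))^2 = (c h)^2; then exp(-v^2) \<le> 1/(1 + v^2) \<le>
    2/(1 + v)^2 turns the Gaussian into a summable majorant \<open>w\<close>.\<close>
  define c where "c = sqrt A / (2 * real N)"
  have N0: "real N > 0" using N by simp
  have c: "c > 0" using True N0 by (simp add: c_def)
  define w where "w = (\<lambda>h::nat. 2 / (1 + c * real h)\<^sup>2)"
  have w0: "w h \<ge> 0" for h by (simp add: w_def)
  have key: "exp (- A * (1 - cos (2 * pi * real h / real N))) \<le> w h" if h: "2 * h \<le> N" for h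
  proof -
    have "2 * real h \<le> real N" using h by linarith
    hence "2 * pi * real h / real N \<le> pi" using N0 by (simp add: field_simps)
    hence "1 - cos (2 * pi * real h / real N) \<ge> (2 * pi * real h / real N)\<^sup>2 / 18"
      using N0 by (intro one_minus_cos_ge) auto
    moreover have "(2 * pi * real h / real N)\<^sup>2 / 18 \<ge> (real h / real N / 2)\<^sup>2"
    proof -
      have "(2 * pi * real h / real N)\<^sup>2 / 18 = (8 * (pi * pi) / 9) * (real h / real N / 2)\<^sup>2"
        by (simp add: power2_eq_square)
      moreover have "8 * (pi * pi) / 9 \<ge> 1" using pi_ge_two mult_mono[of 2 pi 2 pi] by simp
      ultimately show ?thesis using mult_right_mono[of 1 "8 * (pi * pi) / 9" "(real h / real N / 2)\<^sup>2"] by simp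
    qed
    ultimately have "1 - cos (2 * pi * real h / real N) \<ge> (real h / real N / 2)\<^sup>2" by linarith
    hence "A * (1 - cos (2 * pi * real h / real N)) \<ge> A * (real h / real N / 2)\<^sup>2"
      using A by (rule mult_left_mono)
    moreover have "A * (real h / real N / 2)\<^sup>2 = (c * real h)\<^sup>2"
      using A by (simp add: c_def power_mult_distrib power_divide)
    ultimately have "exp (- A * (1 - cos (2 * pi * real h / real N))) \<le> exp (- ((c * real h)\<^sup>2))" by simp
    also have "\<dots> \<le> 1 / (1 + (c * real h)\<^sup>2)"
      using exp_ge_add_one_self[of "(c * real h)\<^sup>2"]
      by (simp add: exp_minus divide_simps add_pos_nonneg)
    also have "\<dots> \<le> 2 / (1 + c * real h)\<^sup>2"
    proof -
      have "(1 + c * real h)\<^sup>2 \<le> 2 * (1 + (c * real h)\<^sup>2)"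
        using sum_squares_bound[of 1 "c * real h"] by (simp add: power2_sum)
      moreover have "(1 + c * real h)\<^sup>2 > 0" using c by (intro zero_less_power add_pos_nonneg) auto
      ultimately show ?thesis by (simp add: divide_simps add_pos_nonneg)
    qed
    finally show ?thesis by (simp add: w_def)
  qed
  \<comment> \<open>The quadratic lower bound for 1 - cos holds on the first half of the circle; h
    in the second half is reflected to N - h.\<close>
  have "(\<Sum>h<N. exp (- A * (1 - cos (2 * pi * real h / real N)))) \<le> (\<Sum>h<N. w h + w (N - h))"
  proof (rule sum_mono)
    fix h assume h: "h \<in> {..<N}"
    show "exp (- A * (1 - cos (2 * pi * real h / real N))) \<le> w h + w (N - h)"
    proof (cases "2 * h \<le> N")
      case True
      thus ?thesis using key[of h] w0[of "N - h"] by linarith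
    next
      case False
      hence "2 * (N - h) \<le> N" by simp
      from key[OF this] have "exp (- A * (1 - cos (2 * pi * real h / real N))) \<le> w (N - h)"
        using h exp_cos_reflect[of N h] by simp
      thus ?thesis using w0[of h] by linarith
    qed
  qed
  also have "\<dots> = (\<Sum>h<N. w h) + (\<Sum>h<N. w (N - h))" by (rule sum.distrib)
  also have "(\<Sum>h<N. w (N - h)) = (\<Sum>h\<in>{1..N}. w h)"
    by (rule sum.reindex_bij_witness[of _ "\<lambda>h. N - h" "\<lambda>h. N - h"]) auto
  also have "(\<Sum>h<N. w h) + (\<Sum>h\<in>{1..N}. w h) \<le> (\<Sum>h\<le>N. w h) + (\<Sum>h\<le>N. w h)"
    using w0 by (intro add_mono sum_mono2) auto
  also have "\<dots> = 4 * (\<Sum>h\<le>N. 1 / (1 + c * real h)\<^sup>2)"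
    by (simp add: w_def sum_distrib_left)
  also have "\<dots> \<le> 4 * (1 + 1 / c)"
  proof -
    define u where "u = 1 / (c * (1 + c * real N))"
    have "u \<ge> 0" using c by (simp add: u_def)
    hence "(\<Sum>h\<le>N. 1 / (1 + c * real h)\<^sup>2) \<le> 1 + 1 / c"
      using sum_inverse_square_linear_le[OF c, of N] unfolding u_def[symmetric] by linarith
    thus ?thesis by (rule mult_left_mono) simp
  qed
  finally have "(\<Sum>h<N. exp (- A * (1 - cos (2 * pi * real h / real N)))) / real N \<le> 4 * (1 + 1 / c) / real N"
    using N0 by (simp add: divide_right_mono)
  also have "\<dots> = 4 / real N + 8 / sqrt A" using N0 by (simp add: c_def field_simps)
  also have "\<dots> \<le> 15 / sqrt (1 + A)"
  proof -
    define s where "s = sqrt (1 + A)"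
    have s: "s > 0" "s * s = 1 + A" using A by (auto simp: s_def)
    have "s \<ge> 1" using A by (simp add: s_def)
    have r: "sqrt 2 \<le> 1.5" by (rule real_le_lsqrt) (auto simp: power2_eq_square)
    have s2: "sqrt 2 \<ge> 1.4" by (rule real_le_rsqrt) (auto simp: power2_eq_square)
    have "s \<le> sqrt (2 * A)" using True by (simp add: s_def)
    also have "\<dots> = sqrt 2 * sqrt A" by (rule real_sqrt_mult)
    also have "\<dots> \<le> 1.5 * sqrt A" using r A by (intro mult_right_mono) auto
    finally have "8 * s / sqrt A \<le> 12" using True by (simp add: divide_simps)
    moreover have "4 * s / real N \<le> 3"
    proof -
      have "s \<ge> sqrt 2" using True by (simp add: s_def)
      hence "s \<ge> 1.4" using s2 by linarith
      hence "s * 1.4 \<le> s * s" using s by (intro mult_left_mono) auto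
      also have "s * s \<le> real N" using N s by simp
      finally show ?thesis using N0 by (simp add: divide_simps)
    qed
    ultimately have "(4 / real N + 8 / sqrt A) * s \<le> 15" by (simp add: algebra_simps)
    thus ?thesis using s by (simp add: s_def[symmetric] le_divide_eq)
  qed
  finally show ?thesis .
qed

text \<open>The square of the modulus falls short of its maximum by a sum over pairs of nonnegative
  terms \<open>W e * W d * (1 - cos ...)\<close>. Only the pairs that contain the base point
  \<open>e0\<close> and an element of D are kept.\<close>

lemma norm_sum_cis_le:
  fixes W \<theta> :: "'e \<Rightarrow> real"
  assumes fin: "finite E" and W: "\<And>e. e \<in> E \<Longrightarrow> W e \<ge> 0" and e0: "e0 \<in> E" and D: "D \<subseteq> E"
  shows "(cmod (\<Sum>e\<in>E. of_real (W e) * cis (\<theta> e)))\<^sup>2 \<le> (\<Sum>e\<in>E. W e)\<^sup>2 - (\<Sum>d\<in>D. W e0 * W d * (1 - cos (\<theta> d - \<theta> e0)))"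
proof -
  have "(cmod (\<Sum>e\<in>E. of_real (W e) * cis (\<theta> e)))\<^sup>2 = (\<Sum>e\<in>E. W e * cos (\<theta> e))\<^sup>2 + (\<Sum>e\<in>E. W e * sin (\<theta> e))\<^sup>2"
    by (simp add: cmod_power2 Re_sum Im_sum)
  also have "\<dots> = (\<Sum>e\<in>E. \<Sum>d\<in>E. W e * W d * cos (\<theta> d - \<theta> e))"
    unfolding power2_eq_square sum_product sum.distrib[symmetric]
    by (intro sum.cong refl) (simp add: cos_diff algebra_simps)
  finally have "(\<Sum>e\<in>E. W e)\<^sup>2 - (cmod (\<Sum>e\<in>E. of_real (W e) * cis (\<theta> e)))\<^sup>2 =
     (\<Sum>e\<in>E. \<Sum>d\<in>E. W e * W d * (1 - cos (\<theta> d - \<theta> e)))"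
    by (simp add: power2_eq_square sum_product sum_subtractf[symmetric] algebra_simps)
  also have "\<dots> \<ge> (\<Sum>d\<in>E. W e0 * W d * (1 - cos (\<theta> d - \<theta> e0)))"
    by (rule member_le_sum[of e0]) (use fin W e0 in \<open>auto intro!: sum_nonneg mult_nonneg_nonneg\<close>)
  also have "(\<Sum>d\<in>E. W e0 * W d * (1 - cos (\<theta> d - \<theta> e0))) \<ge> (\<Sum>d\<in>D. W e0 * W d * (1 - cos (\<theta> d - \<theta> e0)))"
    using fin D W e0 by (intro sum_mono2) (auto intro!: mult_nonneg_nonneg)
  finally show ?thesis by linarith
qed

lemma norm_sum_cis_le_exp:
  fixes W \<theta> :: "'e \<Rightarrow> real"
  assumes fin: "finite E" and W: "\<And>e. e \<in> E \<Longrightarrow> W e \<ge> 0" and e0: "e0 \<in> E" and D: "D \<subseteq> E"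
    and m: "(\<Sum>e\<in>E. W e) \<le> m" "m > 0"
  shows "cmod (\<Sum>e\<in>E. of_real (W e) * cis (\<theta> e)) \<le>
    m * exp (- (\<Sum>d\<in>D. W e0 * W d * (1 - cos (\<theta> d - \<theta> e0))) / (2 * m\<^sup>2))"
proof -
  define X where "X = (\<Sum>d\<in>D. W e0 * W d * (1 - cos (\<theta> d - \<theta> e0)))"
  have "(cmod (\<Sum>e\<in>E. of_real (W e) * cis (\<theta> e)))\<^sup>2 \<le> (\<Sum>e\<in>E. W e)\<^sup>2 - X"
    unfolding X_def by (rule norm_sum_cis_le[OF fin W e0 D])
  also have "(\<Sum>e\<in>E. W e)\<^sup>2 \<le> m\<^sup>2" using m W by (intro power_mono sum_nonneg) auto
  also have "m\<^sup>2 - X = m\<^sup>2 * (1 + (- X / m\<^sup>2))" using m by (simp add: field_simps)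
  also have "\<dots> \<le> m\<^sup>2 * exp (- X / m\<^sup>2)" by (intro mult_left_mono exp_ge_add_one_self) auto
  also have "\<dots> = (m * exp (- X / (2 * m\<^sup>2)))\<^sup>2"
    by (simp add: power_mult_distrib flip: exp_double)
  finally show ?thesis using m unfolding X_def[symmetric] by (simp add: power2_le_iff_abs_le abs_le_iff power_mono_iff)
qed

text \<open>Jensen's inequality for exp with weights q / E. It replaces a product over all p by a
  mean of terms that involve a single p, so that no joint information about the frequencies at
  different primes is required afterwards.\<close>

lemma exp_weighted_sum_le:
  fixes q c :: "'p \<Rightarrow> real"
  assumes fin: "finite P" and q: "\<And>p. p \<in> P \<Longrightarrow> q p \<ge> 0" and S: "(\<Sum>p\<in>P. q p) > 0"
  shows "exp (- (\<Sum>p\<in>P. q p * c p)) \<le> (\<Sum>p\<in>P. q p / (\<Sum>p\<in>P. q p) * exp (- (\<Sum>p\<in>P. q p) * c p))"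
proof -
  define E where "E = (\<Sum>p\<in>P. q p)"
  have "exp (\<Sum>p\<in>P. (q p / E) *\<^sub>R (- E * c p)) \<le> (\<Sum>p\<in>P. q p / E * exp (- E * c p))"
  proof (rule convex_on_sum[OF fin _ exp_convex])
    show "P \<noteq> {}" using S by auto
    show "(\<Sum>p\<in>P. q p / E) = 1" using S by (simp add: E_def flip: sum_divide_distrib)
  qed (use q S in \<open>auto simp: E_def\<close>)
  moreover have "(\<Sum>p\<in>P. (q p / E) *\<^sub>R (- E * c p)) = - (\<Sum>p\<in>P. q p * c p)"
    using S by (simp add: E_def[symmetric] sum_negf)
  ultimately show ?thesis by (simp add: E_def)
qed

text \<open>Multiplication by a permutes the residues modulo the prime N. So the average over h
  forgets the value a and sees only that it is not divisible by N; this is why only the vanishing of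
  \<open>f p\<close> matters in E.\<close>

lemma sum_cos_multiple:
  fixes F :: "real \<Rightarrow> real" and a :: int
  assumes N: "prime N" and a: "\<not> int N dvd a"
  shows "(\<Sum>h<N. F (cos (2 * pi * (real h * real_of_int a) / real N))) = (\<Sum>h<N. F (cos (2 * pi * real h / real N)))"
proof -
  have N0: "N > 0" using N prime_gt_0_nat by auto
  define \<pi> where "\<pi> = (\<lambda>h. nat ((int h * a) mod int N))"
  have \<pi>int: "int (\<pi> h) = (int h * a) mod int N" for h using N0 by (simp add: \<pi>_def)
  have "inj_on \<pi> {..<N}"
  proof (rule inj_onI)
    fix h k assume hk: "h \<in> {..<N}" "k \<in> {..<N}" "\<pi> h = \<pi> k"
    hence "(int h * a) mod int N = (int k * a) mod int N" by (metis \<pi>int)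
    hence "int N dvd (int h - int k) * a" by (simp add: mod_eq_dvd_iff algebra_simps)
    hence "int N dvd int h - int k" using a N by (simp add: prime_dvd_mult_iff)
    hence "int h mod int N = int k mod int N" by (simp add: mod_eq_dvd_iff)
    thus "h = k" using hk by simp
  qed
  moreover have "\<pi> ` {..<N} \<subseteq> {..<N}" using N0 by (auto simp: \<pi>_def nat_less_iff)
  ultimately have bij: "bij_betw \<pi> {..<N} {..<N}"
    by (simp add: bij_betw_def endo_inj_surj)
  have "cos (2 * pi * (real h * real_of_int a) / real N) = cos (2 * pi * real (\<pi> h) / real N)" for h
  proof -
    have "real (\<pi> h) = real_of_int ((int h * a) mod int N)" by (simp flip: \<pi>int)
    also have "\<dots> = real h * real_of_int a - real N * real_of_int ((int h * a) div int N)"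
      by (simp add: minus_div_mult_eq_mod[symmetric] mult.commute)
    finally have "2 * pi * real (\<pi> h) / real N =
        2 * pi * (real h * real_of_int a - real N * real_of_int ((int h * a) div int N)) / real N" by simp
    also have "\<dots> = 2 * pi * (real h * real_of_int a) / real N - 2 * pi * real_of_int ((int h * a) div int N)"
      using N0 by (simp add: right_diff_distrib diff_divide_distrib)
    finally have "2 * pi * real (\<pi> h) / real N = 2 * pi * (real h * real_of_int a) / real N - 2 * pi * real_of_int ((int h * a) div int N)" .
    thus ?thesis by (simp add: cos_diff)
  qed
  hence "(\<Sum>h<N. F (cos (2 * pi * (real h * real_of_int a) / real N))) = (\<Sum>h<N. F (cos (2 * pi * real (\<pi> h) / real N)))"
    by simp
  also have "\<dots> = (\<Sum>h<N. F (cos (2 * pi * real h / real N)))"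
    by (rule sum.reindex_bij_betw[OF bij])
  finally show ?thesis .
qed

lemma average_exp_weighted_cos_le:
  fixes q :: "'p \<Rightarrow> real" and a :: "'p \<Rightarrow> int"
  assumes fin: "finite P" and q: "\<And>p. p \<in> P \<Longrightarrow> q p \<ge> 0"
    and N: "prime N" "real N \<ge> (\<Sum>p\<in>P. q p) + 1"
    and a: "\<And>p. p \<in> P \<Longrightarrow> q p > 0 \<Longrightarrow> \<not> int N dvd a p"
  shows "(\<Sum>h<N. exp (- (\<Sum>p\<in>P. q p * (1 - cos (2 * pi * (real h * real_of_int (a p)) / real N))))) / real N
    \<le> 15 / sqrt (1 + (\<Sum>p\<in>P. q p))"
proof -
  define A where "A = (\<Sum>p\<in>P. q p)"
  have A0: "A \<ge> 0" using q by (simp add: A_def sum_nonneg)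
  have N0: "N \<ge> 1" using N(1) prime_ge_1_nat by auto
  show ?thesis
  proof (cases "A > 0")
    case False
    hence "q p = 0" if "p \<in> P" for p
      using A0 that fin q by (metis A_def less_eq_real_def sum_nonneg_eq_0_iff)
    thus ?thesis using N0 by simp
  next
    case True
    let ?c = "\<lambda>p h. 1 - cos (2 * pi * (real h * real_of_int (a p)) / real N)"
    have "(\<Sum>h<N. exp (- (\<Sum>p\<in>P. q p * ?c p h))) \<le> (\<Sum>h<N. \<Sum>p\<in>P. q p / A * exp (- A * ?c p h))"
      unfolding A_def using fin q True by (intro sum_mono exp_weighted_sum_le) (auto simp: A_def)
    also have "\<dots> = (\<Sum>p\<in>P. q p / A * (\<Sum>h<N. exp (- A * ?c p h)))"
      by (subst sum.swap) (simp add: sum_distrib_left)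
    also have "\<dots> \<le> (\<Sum>p\<in>P. q p / A * (real N * (15 / sqrt (1 + A))))"
    proof (rule sum_mono)
      fix p assume p: "p \<in> P"
      show "q p / A * (\<Sum>h<N. exp (- A * ?c p h)) \<le> q p / A * (real N * (15 / sqrt (1 + A)))"
      proof (cases "q p > 0")
        case True
        have "(\<Sum>h<N. exp (- A * ?c p h)) = (\<Sum>h<N. exp (- A * (1 - cos (2 * pi * real h / real N))))"
          by (rule sum_cos_multiple[of N "a p" "\<lambda>x. exp (- A * (1 - x))", OF N(1) a[OF p True]])
        also have "\<dots> \<le> real N * (15 / sqrt (1 + A))"
          using average_exp_cos_le[OF A0 N0] N(2) N0 unfolding A_def[symmetric] by (simp add: field_simps)
        finally show ?thesis using True \<open>A > 0\<close> by (intro mult_left_mono) auto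
      next
        case False
        with q[OF p] show ?thesis by simp
      qed
    qed
    also have "\<dots> = (\<Sum>p\<in>P. q p) / A * (real N * (15 / sqrt (1 + A)))"
      by (simp add: sum_distrib_right sum_divide_distrib)
    also have "\<dots> = real N * (15 / sqrt (1 + A))" using True by (simp add: A_def)
    finally show ?thesis using N0 unfolding A_def[symmetric] by (simp add: field_simps)
  qed
qed

text \<open>Simultaneous Dirichlet approximation turns finitely many reals into integers such that all
  short additive relations persist and nonzero numbers stay nonzero. Characters modulo a large
  prime can then replace those of the real line.\<close>

lemma integer_model:
  fixes X :: "real set" and M :: nat
  assumes finX: "finite X"
  obtains \<phi> :: "real \<Rightarrow> int" where "\<And>x. x \<in> X \<Longrightarrow> x \<noteq> 0 \<Longrightarrow> \<phi> x \<noteq> 0"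
    "\<And>(I :: 'i set) s c. finite I \<Longrightarrow> card I \<le> M \<Longrightarrow> (\<And>i. i \<in> I \<Longrightarrow> s i \<in> X) \<Longrightarrow> c \<in> X \<Longrightarrow>
       (\<Sum>i\<in>I. s i) = c \<Longrightarrow> (\<Sum>i\<in>I. \<phi> (s i)) = \<phi> c"
proof -
  obtain \<theta> :: "nat \<Rightarrow> real" and n where \<theta>: "X = \<theta> ` {i. i < n}"
    using finite_imp_nat_seg_image_inj_on[OF finX] by metis
  obtain \<epsilon> where \<epsilon>: "\<epsilon> > 0" "\<And>x. x \<in> X \<Longrightarrow> x \<noteq> 0 \<Longrightarrow> \<epsilon> \<le> \<bar>x\<bar>"
  proof (cases "X - {0} = {}")
    case True
    thus ?thesis using that[of 1] by auto
  next
    case False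
    define \<epsilon> where "\<epsilon> = Min (abs ` (X - {0}))"
    have "\<epsilon> \<in> abs ` (X - {0})" unfolding \<epsilon>_def using finX False by (intro Min_in) auto
    hence "\<epsilon> > 0" by auto
    moreover have "\<epsilon> \<le> \<bar>x\<bar>" if "x \<in> X" "x \<noteq> 0" for x
      unfolding \<epsilon>_def using finX that by (intro Min_le) auto
    ultimately show ?thesis using that by blast
  qed
  \<comment> \<open>Each approximation errs by less than 1/N. With N at least M + 1, the errors of M
    summands and of their sum together stay below 1, so the integer they measure vanishes; with 1/N
    \<le> \<epsilon>, no nonzero number is rounded to 0.\<close>
  define N where "N = max (M + 1) (nat \<lceil>1 / \<epsilon>\<rceil>)"
  have N: "N > 0" "real (M + 1) \<le> real N" by (auto simp: N_def)
  have "1 / \<epsilon> \<le> real N" unfolding N_def using real_nat_ceiling_ge[of "1 / \<epsilon>"] by linarith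
  hence N\<epsilon>: "1 / real N \<le> \<epsilon>" using \<epsilon>(1) N by (simp add: field_simps)
  obtain q p where qp: "0 < q" "\<And>i. i < n \<Longrightarrow> \<bar>of_int q * \<theta> i - of_int (p i)\<bar> < 1 / real N"
    using Dirichlet_approx_simult[OF N(1), of n \<theta>] by blast
  define \<phi> where "\<phi> x = p (SOME i. i < n \<and> \<theta> i = x)" for x
  have \<phi>: "\<bar>of_int q * x - of_int (\<phi> x)\<bar> < 1 / real N" if "x \<in> X" for x
  proof -
    have "\<exists>i. i < n \<and> \<theta> i = x" using that \<theta> by auto
    from someI_ex[OF this] qp(2) show ?thesis unfolding \<phi>_def by metis
  qed
  show ?thesis
  proof
    fix x assume x: "x \<in> X" "x \<noteq> 0"
    show "\<phi> x \<noteq> 0"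
    proof
      assume "\<phi> x = 0"
      hence "\<bar>of_int q * x\<bar> < 1 / real N" using \<phi>[OF x(1)] by simp
      also have "\<dots> \<le> \<bar>x\<bar>" using N\<epsilon> \<epsilon>(2)[OF x] by linarith
      also have "\<dots> \<le> of_int q * \<bar>x\<bar>" using qp(1) mult_right_mono[of 1 "real_of_int q" "\<bar>x\<bar>"] by simp
      finally show False using qp(1) by (simp add: abs_mult)
    qed
  next
    fix I :: "'i set" and s c
    assume I: "finite I" "card I \<le> M" "\<And>i. i \<in> I \<Longrightarrow> s i \<in> X" "c \<in> X" "(\<Sum>i\<in>I. s i) = c"
    have "(\<Sum>i\<in>I. of_int q * s i - of_int (\<phi> (s i))) = of_int q * c - of_int (\<Sum>i\<in>I. \<phi> (s i))"
      by (simp add: sum_subtractf flip: I(5) sum_distrib_left)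
    moreover have "\<bar>\<Sum>i\<in>I. of_int q * s i - of_int (\<phi> (s i))\<bar> \<le> real (card I) * (1 / real N)"
      by (rule order_trans[OF sum_abs], rule sum_bounded_above) (use \<phi> I(3) in \<open>auto intro: less_imp_le\<close>)
    moreover have "real (card I) * (1 / real N) \<le> real M * (1 / real N)" using I(2) by (intro mult_right_mono) auto
    ultimately have "\<bar>real_of_int (\<phi> c - (\<Sum>i\<in>I. \<phi> (s i)))\<bar> < real M * (1 / real N) + 1 / real N"
      using \<phi>[OF I(4)] by (simp only: of_int_diff)
    also have "\<dots> = real (M + 1) / real N" by (simp add: add_divide_distrib)
    also have "\<dots> \<le> 1" using N by simp
    finally show "(\<Sum>i\<in>I. \<phi> (s i)) = \<phi> c" by linarith
  qed
qed

section \<open>Detection of prescribed values by characters modulo a prime\<close>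

lemma sum_cis_roots_of_unity:
  fixes a :: int
  assumes N: "N \<ge> (1 :: nat)"
  shows "(\<Sum>h<N. cis (2 * pi * (real h * real_of_int a) / real N)) = (if int N dvd a then of_nat N else 0)"
proof (cases "int N dvd a")
  case True
  then obtain b where "a = int N * b" by (elim dvdE)
  hence "2 * pi * (real h * real_of_int a) / real N = 2 * pi * (real h * real_of_int b)" for h
    using N by simp
  hence "cis (2 * pi * (real h * real_of_int a) / real N) = 1" for h
    by simp
  thus ?thesis using True by simp
next
  case False
  define w where "w = cis (2 * pi * real_of_int a / real N)"
  have pow: "cis (2 * pi * (real h * real_of_int a) / real N) = w ^ h" for h
    unfolding w_def Complex.DeMoivre by (rule arg_cong[of _ _ cis]) simp
  have "w \<noteq> 1"
  proof
    assume "w = 1"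
    hence "cos (2 * pi * real_of_int a / real N) = 1" by (simp add: w_def complex_eq_iff)
    then obtain k :: int where "2 * pi * real_of_int a / real N = real_of_int k * 2 * pi"
      using cos_one_2pi_int by metis
    hence "real_of_int a = real_of_int (k * int N)" using N by (simp add: field_simps)
    hence "a = k * int N" by (simp only: of_int_eq_iff)
    thus False using False by simp
  qed
  moreover have "w ^ N = 1"
  proof -
    have "cis (2 * pi * real_of_int a) = 1" by (rule cis_multiple_2pi) simp
    thus ?thesis using pow[of N] N by (simp add: mult.assoc)
  qed
  ultimately show ?thesis using False by (simp add: pow geometric_sum)
qed

lemma cis_sum: "finite A \<Longrightarrow> cis (\<Sum>i\<in>A. x i) = (\<Prod>i\<in>A. cis (x i))"
  by (induction A rule: finite_induct) (auto simp flip: cis_mult)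

lemma exists_large_prime:
  fixes b :: real
  obtains N :: nat where "prime N" "real N > b"
  using bigger_prime[of "nat \<lceil>b\<rceil>"] by (metis real_nat_ceiling_ge of_nat_less_iff order_le_less_trans)

text \<open>The equalities are relaxed to congruences modulo N, which only enlarges the sum and
  makes it a finite character sum over h, with one component per j. For fixed h it factorises over p
  by independence. The assumed bound on each local factor has an exponent additive in j, so the sum
  over h factorises over j as well and each factor is an average already treated.\<close>

theorem concentration_int:
  fixes P :: "'p set" and E :: "'e set" and J :: "'j set"
    and W :: "'p \<Rightarrow> 'e \<Rightarrow> real" and \<phi> :: "'j \<Rightarrow> 'p \<Rightarrow> 'e \<Rightarrow> int" and q :: "'j \<Rightarrow> 'p \<Rightarrow> real"
  assumes fin: "finite P" "finite E" "finite J"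
    and W: "\<And>p e. p \<in> P \<Longrightarrow> e \<in> E \<Longrightarrow> W p e \<ge> 0"
    and N: "prime N" "\<And>j. j \<in> J \<Longrightarrow> real N \<ge> (\<Sum>p\<in>P. q j p) + 1"
    and q: "\<And>j p. j \<in> J \<Longrightarrow> p \<in> P \<Longrightarrow> q j p \<ge> 0"
      "\<And>j p. j \<in> J \<Longrightarrow> p \<in> P \<Longrightarrow> q j p > 0 \<Longrightarrow> \<not> int N dvd a j p"
    and m: "\<And>p. p \<in> P \<Longrightarrow> m p \<ge> 0"
    and \<Phi>: "\<And>p h. p \<in> P \<Longrightarrow>
       cmod (\<Sum>e\<in>E. of_real (W p e) * cis (\<Sum>j\<in>J. 2 * pi * (real (h j) * real_of_int (\<phi> j p e)) / real N))
       \<le> m p * exp (- (\<Sum>j\<in>J. q j p * (1 - cos (2 * pi * (real (h j) * real_of_int (a j p)) / real N))))"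
  shows "(\<Sum>\<nu>\<in>{\<nu> \<in> PiE P (\<lambda>_. E). \<forall>j\<in>J. (\<Sum>p\<in>P. \<phi> j p (\<nu> p)) = k j}. \<Prod>p\<in>P. W p (\<nu> p))
    \<le> (\<Prod>p\<in>P. m p) * (\<Prod>j\<in>J. 15 / sqrt (1 + (\<Sum>p\<in>P. q j p)))"
proof -
  have N0: "N \<ge> 1" using N(1) prime_ge_1_nat by auto
  let ?V = "PiE P (\<lambda>_. E)" and ?H = "PiE J (\<lambda>_. {..<N})"
  let ?t = "\<lambda>h x. 2 * pi * (real h * real_of_int x) / real N"
  define S where "S j \<nu> = (\<Sum>p\<in>P. \<phi> j p (\<nu> p)) - k j" for j \<nu>
  define w where "w \<nu> = (\<Prod>p\<in>P. W p (\<nu> p))" for \<nu>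
  have w0: "w \<nu> \<ge> 0" if "\<nu> \<in> ?V" for \<nu> unfolding w_def using W that by (intro prod_nonneg) auto
  have finV: "finite ?V" and finH: "finite ?H" using fin by (auto intro: finite_PiE)
  define ind where "ind \<nu> = (\<Prod>j\<in>J. if int N dvd S j \<nu> then 1 else 0 :: real)" for \<nu>
  have ind: "complex_of_real (ind \<nu>) = (\<Sum>h\<in>?H. \<Prod>j\<in>J. cis (?t (h j) (S j \<nu>)) / of_nat N)" for \<nu>
  proof -
    have "complex_of_real (ind \<nu>) = (\<Prod>j\<in>J. if int N dvd S j \<nu> then 1 else 0)"
      unfolding ind_def of_real_prod by (intro prod.cong) auto
    also have "\<dots> = (\<Prod>j\<in>J. \<Sum>h<N. cis (?t h (S j \<nu>)) / of_nat N)"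
      unfolding sum_divide_distrib[symmetric] sum_cis_roots_of_unity[OF N0] using N0 by (intro prod.cong) auto
    also have "\<dots> = (\<Sum>h\<in>?H. \<Prod>j\<in>J. cis (?t (h j) (S j \<nu>)) / of_nat N)"
      using fin by (subst prod_sum_PiE) auto
    finally show ?thesis .
  qed
  have "(\<Sum>\<nu>\<in>{\<nu> \<in> ?V. \<forall>j\<in>J. (\<Sum>p\<in>P. \<phi> j p (\<nu> p)) = k j}. w \<nu>) \<le> (\<Sum>\<nu>\<in>?V. w \<nu> * ind \<nu>)"
  proof -
    have "(\<Sum>\<nu>\<in>{\<nu> \<in> ?V. \<forall>j\<in>J. (\<Sum>p\<in>P. \<phi> j p (\<nu> p)) = k j}. w \<nu>) =
          (\<Sum>\<nu>\<in>{\<nu> \<in> ?V. \<forall>j\<in>J. (\<Sum>p\<in>P. \<phi> j p (\<nu> p)) = k j}. w \<nu> * ind \<nu>)"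
      by (intro sum.cong refl) (auto simp: ind_def S_def)
    also have "\<dots> \<le> (\<Sum>\<nu>\<in>?V. w \<nu> * ind \<nu>)"
      using finV w0 by (intro sum_mono2) (auto simp: ind_def intro!: mult_nonneg_nonneg prod_nonneg)
    finally show ?thesis .
  qed
  also have "\<dots> \<le> cmod (complex_of_real (\<Sum>\<nu>\<in>?V. w \<nu> * ind \<nu>))"
    unfolding norm_of_real by (rule abs_ge_self)
  also have "complex_of_real (\<Sum>\<nu>\<in>?V. w \<nu> * ind \<nu>) =
     (\<Sum>\<nu>\<in>?V. \<Sum>h\<in>?H. of_real (w \<nu>) * (\<Prod>j\<in>J. cis (?t (h j) (S j \<nu>)) / of_nat N))"
    unfolding of_real_sum of_real_mult ind sum_distrib_left ..
  also have "\<dots> = (\<Sum>h\<in>?H. \<Sum>\<nu>\<in>?V. of_real (w \<nu>) * (\<Prod>j\<in>J. cis (?t (h j) (S j \<nu>)) / of_nat N))"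
    by (rule sum.swap)
  also have "cmod \<dots> \<le> (\<Sum>h\<in>?H. (\<Prod>p\<in>P. m p) * (\<Prod>j\<in>J. exp (- (\<Sum>p\<in>P. q j p * (1 - cos (?t (h j) (a j p))))) / real N))"
  proof (rule sum_norm_le)
    fix h
    define c where "c = cis (- (\<Sum>j\<in>J. ?t (h j) (k j))) / of_nat N ^ card J"
    have "of_real (w \<nu>) * (\<Prod>j\<in>J. cis (?t (h j) (S j \<nu>)) / of_nat N) =
          c * (\<Prod>p\<in>P. of_real (W p (\<nu> p)) * cis (\<Sum>j\<in>J. ?t (h j) (\<phi> j p (\<nu> p))))" for \<nu>
    proof -
      have "(\<Sum>j\<in>J. ?t (h j) (S j \<nu>)) = - (\<Sum>j\<in>J. ?t (h j) (k j)) + (\<Sum>p\<in>P. \<Sum>j\<in>J. ?t (h j) (\<phi> j p (\<nu> p)))"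
      proof -
        have "?t (h j) (S j \<nu>) = (\<Sum>p\<in>P. ?t (h j) (\<phi> j p (\<nu> p))) - ?t (h j) (k j)" for j
          by (simp add: S_def sum_distrib_left sum_divide_distrib right_diff_distrib diff_divide_distrib)
        thus ?thesis by (subst sum.swap) (simp add: sum_subtractf)
      qed
      hence "(\<Prod>j\<in>J. cis (?t (h j) (S j \<nu>))) =
          cis (- (\<Sum>j\<in>J. ?t (h j) (k j))) * (\<Prod>p\<in>P. cis (\<Sum>j\<in>J. ?t (h j) (\<phi> j p (\<nu> p))))"
        by (simp only: cis_sum[OF fin(3), symmetric] cis_sum[OF fin(1), symmetric] cis_mult)
      thus ?thesis
        unfolding w_def c_def prod_dividef of_real_prod prod.distrib prod_constant by simp
    qed
    hence "(\<Sum>\<nu>\<in>?V. of_real (w \<nu>) * (\<Prod>j\<in>J. cis (?t (h j) (S j \<nu>)) / of_nat N)) =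
        c * (\<Sum>\<nu>\<in>?V. \<Prod>p\<in>P. of_real (W p (\<nu> p)) * cis (\<Sum>j\<in>J. ?t (h j) (\<phi> j p (\<nu> p))))"
      by (simp only: sum_distrib_left)
    also have "(\<Sum>\<nu>\<in>?V. \<Prod>p\<in>P. of_real (W p (\<nu> p)) * cis (\<Sum>j\<in>J. ?t (h j) (\<phi> j p (\<nu> p)))) =
        (\<Prod>p\<in>P. \<Sum>e\<in>E. of_real (W p e) * cis (\<Sum>j\<in>J. ?t (h j) (\<phi> j p e)))"
      using fin by (subst prod_sum_PiE) auto
    finally have "cmod (\<Sum>\<nu>\<in>?V. of_real (w \<nu>) * (\<Prod>j\<in>J. cis (?t (h j) (S j \<nu>)) / of_nat N)) =
       (\<Prod>p\<in>P. cmod (\<Sum>e\<in>E. of_real (W p e) * cis (\<Sum>j\<in>J. ?t (h j) (\<phi> j p e)))) / real N ^ card J"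
      by (simp add: norm_mult norm_divide c_def prod_norm norm_power)
    also have "\<dots> \<le> (\<Prod>p\<in>P. m p * exp (- (\<Sum>j\<in>J. q j p * (1 - cos (?t (h j) (a j p)))))) / real N ^ card J"
      using \<Phi> by (intro divide_right_mono prod_mono) auto
    also have "(\<Prod>p\<in>P. m p * exp (- (\<Sum>j\<in>J. q j p * (1 - cos (?t (h j) (a j p)))))) =
        (\<Prod>p\<in>P. m p) * (\<Prod>j\<in>J. exp (- (\<Sum>p\<in>P. q j p * (1 - cos (?t (h j) (a j p))))))"
    proof -
      have "(\<Prod>p\<in>P. exp (- (\<Sum>j\<in>J. q j p * (1 - cos (?t (h j) (a j p)))))) =
            exp (- (\<Sum>p\<in>P. \<Sum>j\<in>J. q j p * (1 - cos (?t (h j) (a j p)))))"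
        using fin by (simp only: exp_sum[symmetric] sum_negf)
      also have "\<dots> = exp (- (\<Sum>j\<in>J. \<Sum>p\<in>P. q j p * (1 - cos (?t (h j) (a j p)))))"
        by (subst sum.swap) (rule refl)
      also have "\<dots> = (\<Prod>j\<in>J. exp (- (\<Sum>p\<in>P. q j p * (1 - cos (?t (h j) (a j p))))))"
        using fin by (simp only: exp_sum[symmetric] sum_negf)
      finally show ?thesis by (simp only: prod.distrib)
    qed
    finally show "cmod (\<Sum>\<nu>\<in>?V. of_real (w \<nu>) * (\<Prod>j\<in>J. cis (?t (h j) (S j \<nu>)) / of_nat N)) \<le>
       (\<Prod>p\<in>P. m p) * (\<Prod>j\<in>J. exp (- (\<Sum>p\<in>P. q j p * (1 - cos (?t (h j) (a j p))))) / real N)"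
      by (simp only: prod_dividef prod_constant times_divide_eq_right)
  qed
  also have "\<dots> = (\<Prod>p\<in>P. m p) * (\<Prod>j\<in>J. \<Sum>h<N. exp (- (\<Sum>p\<in>P. q j p * (1 - cos (?t h (a j p))))) / real N)"
    using fin by (subst prod_sum_PiE) (auto simp: sum_distrib_left)
  also have "\<dots> \<le> (\<Prod>p\<in>P. m p) * (\<Prod>j\<in>J. 15 / sqrt (1 + (\<Sum>p\<in>P. q j p)))"
  proof (rule mult_left_mono)
    show "(\<Prod>j\<in>J. \<Sum>h<N. exp (- (\<Sum>p\<in>P. q j p * (1 - cos (?t h (a j p))))) / real N) \<le>
       (\<Prod>j\<in>J. 15 / sqrt (1 + (\<Sum>p\<in>P. q j p)))"
    proof (rule prod_mono)
      fix j assume j: "j \<in> J"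
      have "(\<Sum>h<N. exp (- (\<Sum>p\<in>P. q j p * (1 - cos (?t h (a j p)))))) / real N \<le> 15 / sqrt (1 + (\<Sum>p\<in>P. q j p))"
        using j q N fin by (intro average_exp_weighted_cos_le) auto
      thus "0 \<le> (\<Sum>h<N. exp (- (\<Sum>p\<in>P. q j p * (1 - cos (?t h (a j p))))) / real N) \<and>
          (\<Sum>h<N. exp (- (\<Sum>p\<in>P. q j p * (1 - cos (?t h (a j p))))) / real N) \<le> 15 / sqrt (1 + (\<Sum>p\<in>P. q j p))"
        by (auto simp: sum_divide_distrib intro!: sum_nonneg)
    qed
    show "0 \<le> (\<Prod>p\<in>P. m p)" using m by (intro prod_nonneg)
  qed
  finally show ?thesis by (simp only: w_def)
qed

text \<open>In the application \<open>e0\<close> means that p divides no \<open>Q_j(n)\<close> and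
  \<open>e1 j\<close> that p divides only \<open>Q_j(n)\<close>, exactly once. Comparing just these
  atoms suffices: at \<open>e1 j\<close> only the j-th coordinate moves, so the decay of the local
  factor is a sum of terms each involving one j. Primes outside G are estimated trivially. The
  weights need not have total mass 1, which is what permits the Rankin tilt.\<close>

theorem concentration:
  fixes P :: "'p set" and E :: "'e set" and J :: "'j set"
    and W :: "'p \<Rightarrow> 'e \<Rightarrow> real" and f :: "'j \<Rightarrow> 'p \<Rightarrow> 'e \<Rightarrow> real" and r :: "'j \<Rightarrow> 'p \<Rightarrow> real"
  assumes fin: "finite P" "finite E" "finite J"
    and W: "\<And>p e. p \<in> P \<Longrightarrow> e \<in> E \<Longrightarrow> W p e \<ge> 0"
    and e0: "e0 \<in> E" "\<And>j p. j \<in> J \<Longrightarrow> p \<in> P \<Longrightarrow> f j p e0 = 0"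
    and e1: "inj_on e1 J" "\<And>j. j \<in> J \<Longrightarrow> e1 j \<in> E"
      "\<And>i j p. i \<in> J \<Longrightarrow> j \<in> J \<Longrightarrow> i \<noteq> j \<Longrightarrow> p \<in> P \<Longrightarrow> f i p (e1 j) = 0"
    and G: "G \<subseteq> P" "\<And>p. p \<in> G \<Longrightarrow> W p e0 \<ge> 1 / 2" "\<And>j p. j \<in> J \<Longrightarrow> p \<in> G \<Longrightarrow> W p (e1 j) \<ge> r j p / 2"
      "\<And>j p. j \<in> J \<Longrightarrow> p \<in> G \<Longrightarrow> r j p \<ge> 0"
    and m: "\<And>p. p \<in> P \<Longrightarrow> (\<Sum>e\<in>E. W p e) \<le> m p" "\<And>p. p \<in> P \<Longrightarrow> m p > 0" "\<And>p. p \<in> P \<Longrightarrow> m p \<le> B" "B \<ge> 1"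
  shows "(\<Sum>\<nu>\<in>{\<nu> \<in> PiE P (\<lambda>_. E). \<forall>j\<in>J. (\<Sum>p\<in>P. f j p (\<nu> p)) = k j}. \<Prod>p\<in>P. W p (\<nu> p))
    \<le> (\<Prod>p\<in>P. m p) * (\<Prod>j\<in>J. 60 * B / sqrt (1 + (\<Sum>p | p \<in> G \<and> f j p (e1 j) \<noteq> 0. r j p)))"
proof -
  \<comment> \<open>The atoms give at least (1/2)(r/2), divided by 2 m^2 with m \<le> B. Since sqrt
    \<kappa> is at least 1/(4B), the constant 15 becomes 60 B.\<close>
  define \<kappa> where "\<kappa> = 1 / (8 * B\<^sup>2)"
  have B2: "B\<^sup>2 \<ge> 1" using m(4) by simp
  have \<kappa>: "\<kappa> > 0" "\<kappa> \<le> 1" using B2 by (auto simp: \<kappa>_def divide_le_eq)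
  \<comment> \<open>All values and all targets are modelled together; 0 is included so that the
    model fixes 0.\<close>
  define X where "X = {0} \<union> (\<Union>j\<in>J. \<Union>p\<in>P. f j p ` E) \<union> k ` J"
  have finX: "finite X" using fin by (auto simp: X_def)
  obtain \<phi> :: "real \<Rightarrow> int" where \<phi>: "\<And>x. x \<in> X \<Longrightarrow> x \<noteq> 0 \<Longrightarrow> \<phi> x \<noteq> 0"
    "\<And>(I :: 'p set) s c. finite I \<Longrightarrow> card I \<le> card P \<Longrightarrow> (\<And>i. i \<in> I \<Longrightarrow> s i \<in> X) \<Longrightarrow> c \<in> X \<Longrightarrow>
       (\<Sum>i\<in>I. s i) = c \<Longrightarrow> (\<Sum>i\<in>I. \<phi> (s i)) = \<phi> c"
    using integer_model[OF finX, of "card P"] by blast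
  have \<phi>0: "\<phi> 0 = 0" using \<phi>(2)[of "{}" "\<lambda>_. 0" 0] by (simp add: X_def)
  define q where "q j p = (if p \<in> G \<and> f j p (e1 j) \<noteq> 0 then \<kappa> * r j p else 0)" for j p
  have q0: "q j p \<ge> 0" if "j \<in> J" for j p using that G(4) \<kappa> by (simp add: q_def)
  have finG: "finite G" using G(1) fin(1) finite_subset by blast
  have qsum: "(\<Sum>p\<in>P. q j p) = \<kappa> * (\<Sum>p | p \<in> G \<and> f j p (e1 j) \<noteq> 0. r j p)" for j
  proof -
    have "(\<Sum>p\<in>P. q j p) = (\<Sum>p\<in>{p \<in> P. p \<in> G \<and> f j p (e1 j) \<noteq> 0}. \<kappa> * r j p)"
      unfolding q_def using fin(1) by (rule sum.inter_filter[symmetric])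
    also have "{p \<in> P. p \<in> G \<and> f j p (e1 j) \<noteq> 0} = {p. p \<in> G \<and> f j p (e1 j) \<noteq> 0}" using G(1) by auto
    finally show ?thesis by (simp add: sum_distrib_left)
  qed
  \<comment> \<open>N must exceed every total weight plus 1, for the averages, and every modelled
    integer in absolute value, so that nonzero values stay nonzero modulo N.\<close>
  define b where "b = (\<Sum>j\<in>J. (\<Sum>p\<in>P. q j p) + 1) + (\<Sum>x\<in>X. real_of_int \<bar>\<phi> x\<bar>)"
  obtain N :: nat where N: "prime N" "real N > b" by (rule exists_large_prime)
  have b1: "(\<Sum>p\<in>P. q j p) + 1 \<le> b" if j: "j \<in> J" for j
  proof -
    have "(\<Sum>p\<in>P. q j p) + 1 \<le> (\<Sum>j\<in>J. (\<Sum>p\<in>P. q j p) + 1)"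
      using j fin q0 by (intro member_le_sum[of j J]) (auto intro!: add_nonneg_nonneg sum_nonneg)
    moreover have "(\<Sum>x\<in>X. real_of_int \<bar>\<phi> x\<bar>) \<ge> 0" by (intro sum_nonneg) auto
    ultimately show ?thesis by (simp only: b_def)
  qed
  have b2: "real_of_int \<bar>\<phi> x\<bar> \<le> b" if x: "x \<in> X" for x
  proof -
    have "real_of_int \<bar>\<phi> x\<bar> \<le> (\<Sum>x\<in>X. real_of_int \<bar>\<phi> x\<bar>)"
      using x finX by (intro member_le_sum[of x X]) auto
    moreover have "(\<Sum>j\<in>J. (\<Sum>p\<in>P. q j p) + 1) \<ge> 0"
      using q0 by (intro sum_nonneg add_nonneg_nonneg) auto
    ultimately show ?thesis by (simp only: b_def)
  qed
  have "(\<Sum>\<nu>\<in>{\<nu> \<in> PiE P (\<lambda>_. E). \<forall>j\<in>J. (\<Sum>p\<in>P. f j p (\<nu> p)) = k j}. \<Prod>p\<in>P. W p (\<nu> p)) \<le>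
        (\<Sum>\<nu>\<in>{\<nu> \<in> PiE P (\<lambda>_. E). \<forall>j\<in>J. (\<Sum>p\<in>P. \<phi> (f j p (\<nu> p))) = \<phi> (k j)}. \<Prod>p\<in>P. W p (\<nu> p))"
  proof (rule sum_mono2)
    show "finite {\<nu> \<in> PiE P (\<lambda>_. E). \<forall>j\<in>J. (\<Sum>p\<in>P. \<phi> (f j p (\<nu> p))) = \<phi> (k j)}"
      by (rule finite_subset[of _ "PiE P (\<lambda>_. E)"]) (use fin in \<open>auto intro: finite_PiE\<close>)
    show "{\<nu> \<in> PiE P (\<lambda>_. E). \<forall>j\<in>J. (\<Sum>p\<in>P. f j p (\<nu> p)) = k j} \<subseteq>
          {\<nu> \<in> PiE P (\<lambda>_. E). \<forall>j\<in>J. (\<Sum>p\<in>P. \<phi> (f j p (\<nu> p))) = \<phi> (k j)}"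
    proof
      fix \<nu> assume \<nu>: "\<nu> \<in> {\<nu> \<in> PiE P (\<lambda>_. E). \<forall>j\<in>J. (\<Sum>p\<in>P. f j p (\<nu> p)) = k j}"
      have "(\<Sum>p\<in>P. \<phi> (f j p (\<nu> p))) = \<phi> (k j)" if j: "j \<in> J" for j
      proof (rule \<phi>(2)[OF fin(1)])
        show "f j p (\<nu> p) \<in> X" if "p \<in> P" for p using \<nu> j that unfolding X_def by blast
        show "k j \<in> X" using j by (simp add: X_def)
        show "(\<Sum>p\<in>P. f j p (\<nu> p)) = k j" using \<nu> j by blast
      qed simp
      with \<nu> show "\<nu> \<in> {\<nu> \<in> PiE P (\<lambda>_. E). \<forall>j\<in>J. (\<Sum>p\<in>P. \<phi> (f j p (\<nu> p))) = \<phi> (k j)}" by blast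
    qed
    show "0 \<le> (\<Prod>p\<in>P. W p (\<nu> p))"
      if "\<nu> \<in> {\<nu> \<in> PiE P (\<lambda>_. E). \<forall>j\<in>J. (\<Sum>p\<in>P. \<phi> (f j p (\<nu> p))) = \<phi> (k j)} -
        {\<nu> \<in> PiE P (\<lambda>_. E). \<forall>j\<in>J. (\<Sum>p\<in>P. f j p (\<nu> p)) = k j}" for \<nu>
      using that W by (intro prod_nonneg) auto
  qed
  also have "\<dots> \<le> (\<Prod>p\<in>P. m p) * (\<Prod>j\<in>J. 15 / sqrt (1 + (\<Sum>p\<in>P. q j p)))"
  proof (rule concentration_int[OF fin W N(1), where a = "\<lambda>j p. \<phi> (f j p (e1 j))"])
    show "(\<Sum>p\<in>P. q j p) + 1 \<le> real N" if "j \<in> J" for j using b1[OF that] N(2) by simp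
    show "0 \<le> q j p" if "j \<in> J" for j p using q0 that .
    show "0 \<le> m p" if "p \<in> P" for p using m(2)[OF that] by simp
    show "\<not> int N dvd \<phi> (f j p (e1 j))" if jp: "j \<in> J" "p \<in> P" "0 < q j p" for j p
    proof -
      have X: "f j p (e1 j) \<in> X" using jp e1(2) unfolding X_def by blast
      have nz: "f j p (e1 j) \<noteq> 0" using jp(3) by (auto simp: q_def split: if_splits)
      have "\<bar>\<phi> (f j p (e1 j))\<bar> < int N" using b2[OF X] N(2) by linarith
      thus ?thesis using \<phi>(1)[OF X nz] zdvd_imp_le[of "int N" "\<bar>\<phi> (f j p (e1 j))\<bar>"] by auto
    qed
    fix p and h :: "'j \<Rightarrow> nat"
    assume p: "p \<in> P"
    let ?\<theta> = "\<lambda>e. \<Sum>j\<in>J. 2 * pi * (real (h j) * real_of_int (\<phi> (f j p e))) / real N"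
    show "cmod (\<Sum>e\<in>E. of_real (W p e) * cis (?\<theta> e)) \<le> m p *
      exp (- (\<Sum>j\<in>J. q j p * (1 - cos (2 * pi * (real (h j) * real_of_int (\<phi> (f j p (e1 j)))) / real N))))"
    proof (cases "p \<in> G")
      case False
      have "cmod (\<Sum>e\<in>E. of_real (W p e) * cis (?\<theta> e)) \<le> (\<Sum>e\<in>E. W p e)"
        by (rule sum_norm_le) (use W p in \<open>auto simp: norm_mult\<close>)
      thus ?thesis using False m(1)[OF p] by (simp add: q_def)
    next
      case True
      have \<theta>0: "?\<theta> e0 = 0" using e0(2) p \<phi>0 by simp
      have \<theta>1: "?\<theta> (e1 j) = 2 * pi * (real (h j) * real_of_int (\<phi> (f j p (e1 j)))) / real N" if j: "j \<in> J" for j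
      proof -
        have "?\<theta> (e1 j) = (\<Sum>i\<in>J. if i = j then 2 * pi * (real (h j) * real_of_int (\<phi> (f j p (e1 j)))) / real N else 0)"
          using e1(3)[OF _ j _ p] \<phi>0 by (intro sum.cong) auto
        thus ?thesis using fin(3) j by simp
      qed
      define Y where "Y = (\<Sum>d\<in>e1 ` J. W p e0 * W p d * (1 - cos (?\<theta> d - ?\<theta> e0)))"
      have "cmod (\<Sum>e\<in>E. of_real (W p e) * cis (?\<theta> e)) \<le> m p * exp (- Y / (2 * (m p)\<^sup>2))"
        unfolding Y_def using fin W p e0 e1 m by (intro norm_sum_cis_le_exp) auto
      also have "\<dots> \<le> m p * exp (- (\<Sum>j\<in>J. q j p * (1 - cos (2 * pi * (real (h j) * real_of_int (\<phi> (f j p (e1 j)))) / real N))))"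
      proof -
        have "Y = (\<Sum>j\<in>J. W p e0 * W p (e1 j) * (1 - cos (2 * pi * (real (h j) * real_of_int (\<phi> (f j p (e1 j)))) / real N)))"
          unfolding Y_def using e1(1) \<theta>0 \<theta>1 by (simp add: sum.reindex)
        hence "Y / (2 * (m p)\<^sup>2) = (\<Sum>j\<in>J. W p e0 * W p (e1 j) / (2 * (m p)\<^sup>2) * (1 - cos (2 * pi * (real (h j) * real_of_int (\<phi> (f j p (e1 j)))) / real N)))"
          by (simp add: sum_divide_distrib)
        also have "\<dots> \<ge> (\<Sum>j\<in>J. q j p * (1 - cos (2 * pi * (real (h j) * real_of_int (\<phi> (f j p (e1 j)))) / real N)))"
        proof (intro sum_mono mult_right_mono)
          fix j assume j: "j \<in> J"
          have "q j p \<le> \<kappa> * r j p" using G(4)[OF j True] \<kappa> by (simp add: q_def)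
          also have "\<dots> = (1 / 2) * (r j p / 2) / (2 * B\<^sup>2)" by (simp add: \<kappa>_def)
          also have "\<dots> \<le> W p e0 * W p (e1 j) / (2 * (m p)\<^sup>2)"
          proof (rule frac_le)
            show "1 / 2 * (r j p / 2) \<le> W p e0 * W p (e1 j)"
              using G(2)[OF True] G(3,4)[OF j True] by (intro mult_mono) auto
            show "0 \<le> W p e0 * W p (e1 j)" using W p e0 e1(2)[OF j] by simp
            show "0 < 2 * (m p)\<^sup>2" using m(2)[OF p] by simp
            show "2 * (m p)\<^sup>2 \<le> 2 * B\<^sup>2" using m(2,3)[OF p] by (simp add: power_mono)
          qed
          finally show "q j p \<le> W p e0 * W p (e1 j) / (2 * (m p)\<^sup>2)" .
        qed simp
        finally show ?thesis using m(2)[OF p] by (intro mult_left_mono) auto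
      qed
      finally show ?thesis .
    qed
  qed
  also have "\<dots> \<le> (\<Prod>p\<in>P. m p) * (\<Prod>j\<in>J. 60 * B / sqrt (1 + (\<Sum>p | p \<in> G \<and> f j p (e1 j) \<noteq> 0. r j p)))"
  proof (intro mult_left_mono prod_mono conjI)
    fix j assume j: "j \<in> J"
    define e where "e = (\<Sum>p | p \<in> G \<and> f j p (e1 j) \<noteq> 0. r j p)"
    have e: "e \<ge> 0" unfolding e_def using G(4)[OF j] by (intro sum_nonneg) auto
    have "\<kappa> * (1 + e) \<le> 1 + \<kappa> * e" using \<kappa> by (simp add: algebra_simps)
    hence "sqrt \<kappa> * sqrt (1 + e) \<le> sqrt (1 + \<kappa> * e)" by (simp flip: real_sqrt_mult)
    moreover have "sqrt \<kappa> \<ge> 1 / (4 * B)"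
    proof (rule real_le_rsqrt)
      show "(1 / (4 * B))\<^sup>2 \<le> \<kappa>" using B2 by (simp add: \<kappa>_def power_divide power_mult_distrib divide_simps)
    qed
    hence "1 / (4 * B) * sqrt (1 + e) \<le> sqrt \<kappa> * sqrt (1 + e)" using e by (intro mult_right_mono) auto
    ultimately have "1 / (4 * B) * sqrt (1 + e) \<le> sqrt (1 + \<kappa> * e)" by linarith
    hence "sqrt (1 + e) \<le> 4 * B * sqrt (1 + \<kappa> * e)" using m(4) by (simp add: divide_le_eq mult_ac)
    moreover have "sqrt (1 + e) > 0" "sqrt (1 + \<kappa> * e) > 0" using e \<kappa> by (auto intro: add_pos_nonneg)
    ultimately show "15 / sqrt (1 + (\<Sum>p\<in>P. q j p)) \<le> 60 * B / sqrt (1 + (\<Sum>p | p \<in> G \<and> f j p (e1 j) \<noteq> 0. r j p))"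
      unfolding qsum e_def[symmetric] by (simp add: divide_simps mult_ac)
    show "0 \<le> 15 / sqrt (1 + (\<Sum>p\<in>P. q j p))" using q0[OF j] by (simp add: sum_nonneg)
  next
    show "0 \<le> prod m P" using m(2) by (intro prod_nonneg) (auto intro: less_imp_le)
  qed
  finally show ?thesis .
qed

section \<open>Families of polynomials\<close>

text \<open>The matrix \<open>subresultant_mat 0 f h\<close> is the Sylvester matrix with its last
  row replaced by multiples of f and h by powers of X. Expanding its determinant along that row
  exhibits the resultant as a combination of f and h over Z[X], which is then evaluated at
  c.\<close>

lemma poly_resultant_dvd:
  fixes f h :: "int poly"
  assumes "d dvd poly f c" "d dvd poly h c" "degree f + degree h > 0"
  shows "d dvd resultant f h"
proof -
  let ?M = "subresultant_mat 0 f h"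
  let ?n = "degree f + degree h"
  have carr: "?M \<in> carrier_mat ?n ?n" by auto
  have "[:resultant f h:] = det ?M"
    using subresultant_resultant[of f h] by (simp add: subresultant_def)
  also have "\<dots> = (\<Sum>j<?n. ?M $$ (?n - 1, j) * cofactor ?M (?n - 1) j)"
    using assms(3) by (intro laplace_expansion_row[OF carr]) auto
  finally have "poly [:resultant f h:] c = poly (\<Sum>j<?n. ?M $$ (?n - 1, j) * cofactor ?M (?n - 1) j) c"
    by (rule arg_cong)
  hence "resultant f h = (\<Sum>j<?n. poly (?M $$ (?n - 1, j)) c * poly (cofactor ?M (?n - 1) j) c)"
    unfolding poly_sum poly_mult by simp
  moreover have "d dvd poly (?M $$ (?n - 1, j)) c" if "j < ?n" for j
    using that assms by (subst subresultant_index_mat) (auto simp: Let_def)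
  ultimately show ?thesis by (auto intro!: dvd_sum)
qed

lemma lead_coeff_dvd_resultant_pderiv:
  fixes q :: "int poly"
  assumes q: "degree q \<ge> 1"
  shows "lead_coeff q dvd resultant q (pderiv q)"
proof -
  let ?S = "sylvester_mat q (pderiv q)"
  let ?n = "degree q + degree (pderiv q)"
  have carr: "?S \<in> carrier_mat ?n ?n" by (rule sylvester_carrier_mat)
  have "resultant q (pderiv q) = (\<Sum>i<?n. ?S $$ (i, 0) * cofactor ?S i 0)"
    unfolding resultant_def using q by (intro laplace_expansion_column[OF carr]) auto
  moreover have "lead_coeff q dvd ?S $$ (i, 0)" if "i < ?n" for i
  proof -
    have "i = degree q - 1 \<longrightarrow> lead_coeff q dvd coeff (pderiv q) i"
      using q by (auto simp: coeff_pderiv)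
    moreover have "\<not> i < degree q - Suc 0 \<Longrightarrow> Suc i \<le> degree q \<Longrightarrow> i = degree q - 1" by linarith
    ultimately show ?thesis using that q by (subst sylvester_index_mat) (auto simp: degree_pderiv)
  qed
  ultimately show ?thesis by (auto intro!: dvd_sum)
qed

lemma lead_coeff_mult_discriminant:
  assumes "degree q \<ge> 1"
  shows "\<bar>lead_coeff q * poly_discriminant q\<bar> = \<bar>resultant q (pderiv q)\<bar>"
proof -
  obtain k where k: "resultant q (pderiv q) = lead_coeff q * k"
    using lead_coeff_dvd_resultant_pderiv[OF assms] by (elim dvdE)
  have "lead_coeff q \<noteq> 0" using assms by auto
  thus ?thesis unfolding poly_discriminant_def k by (simp add: abs_mult power_abs)
qed

lemma poly_taylor_dvd:
  fixes q :: "int poly"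
  shows "h\<^sup>2 dvd poly q (a + h) - poly q a - h * poly (pderiv q) a"
proof (induction q)
  case (pCons c q)
  have "poly (pCons c q) (a + h) - poly (pCons c q) a - h * poly (pderiv (pCons c q)) a =
     (a + h) * (poly q (a + h) - poly q a - h * poly (pderiv q) a) + h\<^sup>2 * poly (pderiv q) a"
    by (simp add: pderiv_pCons algebra_simps power2_eq_square)
  with pCons show ?case by simp
qed auto

lemma prime_elem_dvd_prodE:
  fixes \<pi> :: "'a :: comm_semiring_1"
  assumes "prime_elem \<pi>" "finite A" "\<pi> dvd (\<Prod>i\<in>A. f i)"
  obtains i where "i \<in> A" "\<pi> dvd f i"
proof -
  from assms(2,3) have "\<exists>i\<in>A. \<pi> dvd f i"
  proof (induction A rule: finite_induct)
    case empty
    thus ?case using assms(1) by (simp add: prime_elem_def)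
  next
    case (insert x A)
    thus ?case using assms(1) by (auto simp: prime_elem_dvd_mult_iff)
  qed
  thus ?thesis using that by blast
qed

locale poly_fam =
  fixes r g :: nat and Q :: "nat \<Rightarrow> int poly"
  assumes fam: "poly_family r g Q" and r: "r \<ge> 1" and g: "g \<ge> 1"
begin

definition Qp :: "int poly" where "Qp = (\<Prod>j=1..r. Q j)"
definition rho0 :: "nat \<Rightarrow> nat" where "rho0 p = num_roots_mod Qp p"
definition rho :: "nat \<Rightarrow> nat \<Rightarrow> nat" where "rho j p = num_roots_mod (Q j) p"
definition N0 :: nat where "N0 = nat \<bar>lead_coeff Qp * poly_discriminant Qp\<bar>"

lemma degQp: "degree Qp = g"
  using fam by (simp add: poly_family_def Qp_def)

lemma Qp_nz: "Qp \<noteq> 0"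
  using degQp g by auto

lemma irr: "j \<in> {1..r} \<Longrightarrow> irreducible (Q j)"
  using fam by (auto simp: poly_family_def)

lemma prime_elem_Q: "j \<in> {1..r} \<Longrightarrow> prime_elem (Q j)"
  using irr by (intro irreducible_imp_prime_elem_gcd) auto

lemma not_const_dvd_Q:
  assumes j: "j \<in> {1..r}" and p: "prime p"
  shows "\<not> [:int p:] dvd Q j"
proof
  assume "[:int p:] dvd Q j"
  then obtain h where "Q j = [:int p:] * h" by (elim dvdE)
  hence "int p dvd poly (Q j) n" for n by simp
  moreover have "no_fixed_divisor (Q j)" using fam j by (simp add: poly_family_def)
  ultimately show False using p unfolding no_fixed_divisor_def by blast
qed

lemma not_const_dvd_Qp:
  assumes p: "prime p"
  shows "\<not> [:int p:] dvd Qp"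
proof
  assume *: "[:int p:] dvd Qp"
  have "prime_elem [:int p:]" using p by (intro lift_prime_elem_poly) auto
  with * obtain j where "j \<in> {1..r}" "[:int p:] dvd Q j"
    unfolding Qp_def by (elim prime_elem_dvd_prodE[rotated 2]) auto
  thus False using not_const_dvd_Q p by blast
qed

text \<open>An irreducible constant of Z[X] is not a unit, so it has a prime divisor, and that prime
  would be a fixed divisor.\<close>

lemma degQ: "j \<in> {1..r} \<Longrightarrow> degree (Q j) \<ge> 1"
proof (rule ccontr)
  assume j: "j \<in> {1..r}" and "\<not> degree (Q j) \<ge> 1"
  then obtain c where c: "Q j = [:c:]" by (metis degree_eq_zeroE not_one_le_zero less_one linorder_not_le)
  have "\<not> is_unit (Q j)" using irr[OF j] by (simp add: irreducible_def)
  hence "\<bar>c\<bar> \<noteq> 1" unfolding c by (auto simp: is_unit_const_poly_iff)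
  hence "nat \<bar>c\<bar> \<noteq> 1" by linarith
  then obtain p where p: "prime p" "p dvd nat \<bar>c\<bar>" using prime_factor_nat[of "nat \<bar>c\<bar>"] by blast
  have "int p dvd int (nat \<bar>c\<bar>)" using p(2) by (simp only: int_dvd_int_iff)
  hence "int p dvd c" by simp
  hence "[:int p:] dvd Q j" unfolding c by (simp add: const_poly_dvd_const_poly_iff)
  thus False using not_const_dvd_Q[OF j p(1)] by simp
qed

lemma Qp_split: "j \<in> {1..r} \<Longrightarrow> Qp = Q j * (\<Prod>i\<in>{1..r}-{j}. Q i)"
  unfolding Qp_def by (intro prod.remove) auto

lemma poly_Qp: "poly Qp a = (\<Prod>j=1..r. poly (Q j) a)"
  by (simp add: Qp_def poly_prod)

text \<open>Q is squarefree: a prime factor common to Q and Q' is an associate of some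
  \<open>Q j\<close>, which would then divide another member of the family or its own
  derivative.\<close>

lemma gcd_Qp_pderiv: "degree (gcd Qp (pderiv Qp)) = 0"
proof (rule ccontr)
  assume nz: "degree (gcd Qp (pderiv Qp)) \<noteq> 0"
  define h where "h = gcd Qp (pderiv Qp)"
  have "\<not> is_unit h" using nz unfolding h_def[symmetric] by (auto simp: is_unit_iff_degree is_unit_poly_iff)
  moreover have "h \<noteq> 0" using Qp_nz by (simp add: h_def)
  ultimately obtain \<pi> where \<pi>: "\<pi> dvd h" "prime \<pi>" using prime_divisor_exists by blast
  have \<pi>Q: "\<pi> dvd Qp" "\<pi> dvd pderiv Qp" using \<pi>(1) by (auto simp: h_def)
  then obtain j where j: "j \<in> {1..r}" "\<pi> dvd Q j"
    unfolding Qp_def using prime_imp_prime_elem[OF \<pi>(2)] by (elim prime_elem_dvd_prodE[rotated 2]) auto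
  have "Q j dvd \<pi>" using irreducibleD'[OF irr[OF j(1)] j(2)] \<pi>(2) by auto
  hence "Q j dvd pderiv Qp" using \<pi>Q(2) dvd_trans by blast
  moreover define R where "R = (\<Prod>i\<in>{1..r}-{j}. Q i)"
  have "pderiv Qp = Q j * pderiv R + R * pderiv (Q j)"
    unfolding Qp_split[OF j(1)] R_def[symmetric] by (rule pderiv_mult)
  ultimately have "Q j dvd R * pderiv (Q j)" by (simp add: dvd_add_right_iff)
  hence "Q j dvd R \<or> Q j dvd pderiv (Q j)" using prime_elem_Q[OF j(1)] by (simp add: prime_elem_dvd_mult_iff)
  thus False
  proof
    assume "Q j dvd pderiv (Q j)"
    moreover have "pderiv (Q j) \<noteq> 0" using degQ[OF j(1)] by (simp add: pderiv_eq_0_iff)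
    ultimately have "degree (Q j) \<le> degree (pderiv (Q j))" by (rule dvd_imp_degree_le)
    thus False using degQ[OF j(1)] by (simp add: degree_pderiv)
  next
    assume "Q j dvd R"
    then obtain i where i: "i \<in> {1..r}-{j}" "Q j dvd Q i"
      unfolding R_def using prime_elem_Q[OF j(1)] by (elim prime_elem_dvd_prodE[rotated 2]) auto
    hence "coprime (Q j) (Q i)" using fam j by (auto simp: poly_family_def)
    hence "is_unit (Q j)" using i(2) by (metis coprime_common_divisor dvd_refl)
    thus False using irr[OF j(1)] by (simp add: irreducible_def)
  qed
qed

lemma N0_eq: "int N0 = \<bar>resultant Qp (pderiv Qp)\<bar>"
  unfolding N0_def using degQp g lead_coeff_mult_discriminant[of Qp] by simp

lemma N0_pos: "N0 > 0"
proof -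
  have "resultant Qp (pderiv Qp) \<noteq> 0" using gcd_Qp_pderiv by (simp add: resultant_0_gcd)
  thus ?thesis using N0_eq by (metis abs_eq_0 bot_nat_0.not_eq_extremum of_nat_0)
qed

lemma simple_roots:
  assumes "\<not> p dvd N0" "int p dvd poly Qp a"
  shows "\<not> int p dvd poly (pderiv Qp) a"
proof
  assume "int p dvd poly (pderiv Qp) a"
  hence "int p dvd resultant Qp (pderiv Qp)" using assms(2) degQp g by (intro poly_resultant_dvd) auto
  hence "int p dvd int N0" unfolding N0_eq by simp
  thus False using assms(1) by simp
qed

text \<open>Away from \<beta>D a root of Q modulo p is simple, hence a root of exactly one factor
  and a simple one there. This is the reason why the coordinates decouple at such primes.\<close>

lemma simple_rootsD:
  assumes p: "\<not> p dvd N0" and j: "j \<in> {1..r}" "int p dvd poly (Q j) a"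
  shows "\<not> int p dvd poly (pderiv (Q j)) a" "\<And>i. i \<in> {1..r} \<Longrightarrow> i \<noteq> j \<Longrightarrow> \<not> int p dvd poly (Q i) a"
proof -
  define R where "R = (\<Prod>i\<in>{1..r}-{j}. Q i)"
  have Qp: "Qp = Q j * R" unfolding R_def by (rule Qp_split[OF j(1)])
  have d: "int p dvd poly Qp a" using j(2) by (simp add: Qp)
  have pd: "poly (pderiv Qp) a = poly (Q j) a * poly (pderiv R) a + poly R a * poly (pderiv (Q j)) a"
    by (simp add: Qp pderiv_mult)
  have nd: "\<not> int p dvd poly R a * poly (pderiv (Q j)) a"

    using simple_roots[OF p d] j(2) unfolding pd by (metis dvd_add dvd_mult2)
  thus "\<not> int p dvd poly (pderiv (Q j)) a" by auto
  fix i assume i: "i \<in> {1..r}" "i \<noteq> j"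
  have "poly (Q i) a dvd poly R a" unfolding R_def poly_prod using i by (intro dvd_prodI) auto
  thus "\<not> int p dvd poly (Q i) a" using nd by (meson dvd_mult2 dvd_trans)
qed

lemma rho0_prime_power_le:
  assumes "prime p" "i \<ge> 1" "k \<ge> 1" "k \<le> i" "g * (k - 1) < i"
  shows "pcount (\<lambda>a. int (p ^ i) dvd poly Qp a) (p ^ i) \<le> g * p ^ (i - k)"
  using assms not_const_dvd_Qp degQp by (intro pcount_roots_prime_power_le) auto

lemma rho0_le: "prime p \<Longrightarrow> rho0 p \<le> g"
  using rho0_prime_power_le[of p 1 1] by (simp add: rho0_def num_roots_mod_eq_pcount)

lemma rho_le_rho0: "j \<in> {1..r} \<Longrightarrow> rho j p \<le> rho0 p"
  unfolding rho_def rho0_def num_roots_mod_eq_pcount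
  by (intro pcount_mono) (auto simp: Qp_split)

text \<open>\<open>wd p e\<close> is the density of the \<open>n\<close> with \<open>v_p(Q_j(n)) = e j\<close> for all \<open>j\<close>; the condition
  depends only on \<open>n\<close> modulo \<open>p ^ Suc (esum e)\<close>.\<close>

definition vcond :: "nat \<Rightarrow> (nat \<Rightarrow> nat) \<Rightarrow> int \<Rightarrow> bool" where
  "vcond p e a \<longleftrightarrow> (\<forall>j\<in>{1..r}. int (p ^ e j) dvd poly (Q j) a \<and> \<not> int (p ^ Suc (e j)) dvd poly (Q j) a)"

definition esum :: "(nat \<Rightarrow> nat) \<Rightarrow> nat" where "esum e = (\<Sum>j=1..r. e j)"

definition wd :: "nat \<Rightarrow> (nat \<Rightarrow> nat) \<Rightarrow> real" where
  "wd p e = real (pcount (vcond p e) (p ^ Suc (esum e))) / real (p ^ Suc (esum e))"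

text \<open>Exponent tuples are kept extensional off \<open>{1..r}\<close>, so that distinct tuples
  describe disjoint events.\<close>

definition e0 :: "nat \<Rightarrow> nat" where "e0 = (\<lambda>j\<in>{1..r}. 0)"
definition e1 :: "nat \<Rightarrow> nat \<Rightarrow> nat" where "e1 i = (\<lambda>j\<in>{1..r}. if j = i then 1 else 0)"

lemma wd_nonneg [simp]: "wd p e \<ge> 0"
  by (simp add: wd_def)

lemma esum_ge: "j \<in> {1..r} \<Longrightarrow> e j \<le> esum e"
  unfolding esum_def by (rule member_le_sum) auto

lemma periodic_vcond: "esum e \<le> i \<Longrightarrow> periodic_mod (vcond p e) (p ^ Suc i)"
proof -
  assume i: "esum e \<le> i"
  have "periodic_mod (\<lambda>a. int (p ^ e j) dvd poly (Q j) a \<and> \<not> int (p ^ Suc (e j)) dvd poly (Q j) a) (p ^ Suc i)"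
    if j: "j \<in> {1..r}" for j
    using esum_ge[OF j, of e] i
    by (intro periodic_mod_conj periodic_mod_not periodic_mod_dvd[OF periodic_mod_dvd_poly] le_imp_power_dvd) auto
  hence "periodic_mod (\<lambda>a. \<forall>j\<in>{1..r}. int (p ^ e j) dvd poly (Q j) a \<and> \<not> int (p ^ Suc (e j)) dvd poly (Q j) a) (p ^ Suc i)"
    by (rule periodic_mod_all)
  thus ?thesis by (simp only: vcond_def[abs_def])
qed

lemma density_power_eq:
  assumes "periodic_mod P (p ^ i)" "i \<le> k" "p > 0"
  shows "real (pcount P (p ^ k)) / real (p ^ k) = real (pcount P (p ^ i)) / real (p ^ i)"
proof -
  have "p ^ k = p ^ (k - i) * p ^ i" using assms by (simp flip: power_add)
  hence "real (pcount P (p ^ k)) = real (p ^ (k - i)) * real (pcount P (p ^ i))"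
    using pcount_mult[OF assms(1), of "p ^ (k - i)"] assms(3) by simp
  moreover have "real (p ^ k) = real (p ^ (k - i)) * real (p ^ i)"
    using \<open>p ^ k = _\<close> by (metis of_nat_mult)
  ultimately show ?thesis using assms(3) by simp
qed

lemma vcond_dvd: "vcond p e a \<Longrightarrow> int (p ^ esum e) dvd poly Qp a"
  unfolding poly_Qp esum_def power_sum of_nat_prod by (intro prod_dvd_prod) (auto simp: vcond_def)

lemma vcond_unique:
  assumes "vcond p e a" "vcond p e' a" "j \<in> {1..r}"
  shows "e j = e' j"
proof (rule ccontr)
  assume "e j \<noteq> e' j"
  then consider "Suc (e j) \<le> e' j" | "Suc (e' j) \<le> e j" by linarith
  thus False
  proof cases
    case 1
    hence "int (p ^ Suc (e j)) dvd int (p ^ e' j)" by (simp only: int_dvd_int_iff le_imp_power_dvd)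
    thus False using assms unfolding vcond_def by (meson dvd_trans)
  next
    case 2
    hence "int (p ^ Suc (e' j)) dvd int (p ^ e j)" by (simp only: int_dvd_int_iff le_imp_power_dvd)
    thus False using assms unfolding vcond_def by (meson dvd_trans)
  qed
qed

text \<open>Lifted to a common modulus \<open>p ^ L\<close>, the events of distinct tuples are
  disjoint, and all are contained in the event that \<open>p ^ i\<close> divides Q(n).\<close>

lemma sum_wd_le:
  assumes p: "prime p" and F: "finite F" "F \<subseteq> extensional {1..r}" "\<And>e. e \<in> F \<Longrightarrow> i \<le> esum e"
  shows "(\<Sum>e\<in>F. wd p e) \<le> real (pcount (\<lambda>a. int (p ^ i) dvd poly Qp a) (p ^ i)) / real (p ^ i)"
proof -
  have p0: "p > 0" using p prime_gt_0_nat by blast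
  define L where "L = i + (\<Sum>e\<in>F. Suc (esum e))"
  have L: "Suc (esum e) \<le> L" if "e \<in> F" for e
  proof -
    have "Suc (esum e) \<le> (\<Sum>e\<in>F. Suc (esum e))" using F(1) that by (rule member_le_sum[rotated -1]) auto
    thus ?thesis by (simp add: L_def)
  qed
  let ?A = "\<lambda>e. {a \<in> {0..<int (p ^ L)}. vcond p e a}"
  have fin: "finite {a \<in> {0..<int (p ^ L)}. R a}" for R by (rule finite_subset[of _ "{0..<int (p ^ L)}"]) auto
  have "(\<Sum>e\<in>F. wd p e) = (\<Sum>e\<in>F. real (pcount (vcond p e) (p ^ L)) / real (p ^ L))"
    unfolding wd_def using L p0 by (intro sum.cong refl density_power_eq[symmetric] periodic_vcond) auto
  also have "\<dots> = real (\<Sum>e\<in>F. card (?A e)) / real (p ^ L)"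
    by (simp add: sum_divide_distrib pcount_def)
  also have "(\<Sum>e\<in>F. card (?A e)) = card (\<Union>e\<in>F. ?A e)"
  proof (rule card_UN_disjoint[symmetric])
    show "\<forall>e\<in>F. \<forall>e'\<in>F. e \<noteq> e' \<longrightarrow> ?A e \<inter> ?A e' = {}"
    proof (intro ballI impI)
      fix e e' assume e: "e \<in> F" "e' \<in> F" "e \<noteq> e'"
      show "?A e \<inter> ?A e' = {}"
      proof (rule ccontr)
        assume "?A e \<inter> ?A e' \<noteq> {}"
        then obtain a where "vcond p e a" "vcond p e' a" by blast
        hence "e j = e' j" if "j \<in> {1..r}" for j using vcond_unique that by blast
        hence "e = e'" using F(2) e by (intro extensionalityI[of e "{1..r}" e']) auto
        thus False using e by simp
      qed
    qed
  qed (use F(1) fin in auto)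
  also have "card (\<Union>e\<in>F. ?A e) \<le> pcount (\<lambda>a. int (p ^ i) dvd poly Qp a) (p ^ L)"
    unfolding pcount_def
  proof (rule card_mono[OF fin])
    show "(\<Union>e\<in>F. ?A e) \<subseteq> {a \<in> {0..<int (p ^ L)}. int (p ^ i) dvd poly Qp a}"
    proof
      fix a assume "a \<in> (\<Union>e\<in>F. ?A e)"
      then obtain e where e: "e \<in> F" "a \<in> {0..<int (p ^ L)}" "vcond p e a" by blast
      have "int (p ^ i) dvd int (p ^ esum e)" using F(3)[OF e(1)] by (simp only: int_dvd_int_iff le_imp_power_dvd)
      hence "int (p ^ i) dvd poly Qp a" using vcond_dvd[OF e(3)] by (rule dvd_trans)
      thus "a \<in> {a \<in> {0..<int (p ^ L)}. int (p ^ i) dvd poly Qp a}" using e(2) by simp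
    qed
  qed
  also have "real (pcount (\<lambda>a. int (p ^ i) dvd poly Qp a) (p ^ L)) / real (p ^ L) =
     real (pcount (\<lambda>a. int (p ^ i) dvd poly Qp a) (p ^ i)) / real (p ^ i)"
    by (rule density_power_eq[OF periodic_mod_dvd_poly _ p0]) (simp add: L_def)
  finally show ?thesis by (simp add: divide_right_mono)
qed

lemma esum_e0: "esum e0 = 0" by (simp add: esum_def e0_def)

lemma esum_e1: "j \<in> {1..r} \<Longrightarrow> esum (e1 j) = 1"
  by (simp add: esum_def e1_def)

lemma vcond_e0:
  assumes "prime p"
  shows "vcond p e0 a \<longleftrightarrow> \<not> int p dvd poly Qp a"
  using assms by (auto simp: vcond_def e0_def poly_Qp prime_dvd_prod_iff)

lemma wd_e0:
  assumes p: "prime p"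
  shows "wd p e0 = 1 - real (rho0 p) / real p"
proof -
  have "pcount (vcond p e0) p = pcount (\<lambda>a. \<not> int p dvd poly Qp a) p"
    using vcond_e0[OF p] by (simp add: pcount_def)
  also have "\<dots> = p - rho0 p" unfolding pcount_not rho0_def num_roots_mod_eq_pcount ..
  finally have "real (pcount (vcond p e0) p) = real p - real (rho0 p)"
    using pcount_le[of "\<lambda>a. int p dvd poly Qp a" p] by (simp add: rho0_def num_roots_mod_eq_pcount of_nat_diff)
  thus ?thesis using p by (simp add: wd_def esum_e0 diff_divide_distrib prime_gt_0_nat)
qed

text \<open>Of the \<open>p * rho j p\<close> classes modulo p^2 where p divides \<open>Q_j\<close>,
  at most \<open>rho j p\<close> have p^2 dividing it: if two of these agree modulo p, Taylor's
  formula shows that p^2 divides their difference times a derivative prime to p. The remaining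
  proportion 1 - 1/p is at least 1/2.\<close>

lemma wd_e1_ge:
  assumes p: "prime p" and nd: "\<not> p dvd N0" and j: "j \<in> {1..r}"
  shows "wd p (e1 j) \<ge> real (rho j p) / real p / 2"
proof -
  have p0: "p > 0" "p \<ge> 2" using p prime_gt_0_nat prime_ge_2_nat by auto
  let ?A = "{a \<in> {0..<int (p ^ 2)}. int p dvd poly (Q j) a}"
  let ?B = "{a \<in> {0..<int (p ^ 2)}. int (p ^ 2) dvd poly (Q j) a}"
  have fin: "finite {a \<in> {0..<int (p ^ 2)}. R a}" for R by (rule finite_subset[of _ "{0..<int (p ^ 2)}"]) auto
  have cA: "card ?A = p * rho j p"
    using pcount_mult[OF periodic_mod_dvd_poly[of p "Q j"] p0(1), of p]
    unfolding rho_def num_roots_mod_eq_pcount by (simp add: pcount_def power2_eq_square)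
  have "card ?B \<le> card {a \<in> {0..<int p}. int p dvd poly (Q j) a}"
  proof (rule card_inj_on_le)
    show "inj_on (\<lambda>a. a mod int p) ?B"
    proof (rule inj_onI)
      fix a b assume ab: "a \<in> ?B" "b \<in> ?B" "a mod int p = b mod int p"
      define h where "h = b - a"
      have ph: "int p dvd h" using ab(3) by (metis h_def mod_eq_dvd_iff)
      have "int (p ^ 2) dvd h\<^sup>2" using ph by (simp add: dvd_power_same)
      moreover have "h\<^sup>2 dvd poly (Q j) b - poly (Q j) a - h * poly (pderiv (Q j)) a"
        using poly_taylor_dvd[of h "Q j" a] by (simp add: h_def)
      ultimately have "int (p ^ 2) dvd poly (Q j) b - poly (Q j) a - h * poly (pderiv (Q j)) a" by (rule dvd_trans)
      moreover have "int (p ^ 2) dvd poly (Q j) b - poly (Q j) a" using ab by auto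
      ultimately have "int (p ^ 2) dvd h * poly (pderiv (Q j)) a"
        using dvd_diff[of "int (p ^ 2)" "poly (Q j) b - poly (Q j) a"] by fastforce
      moreover have "int p dvd poly (Q j) a" using ab(1) by (auto intro: dvd_trans[of _ "int (p ^ 2)"])
      hence "\<not> int p dvd poly (pderiv (Q j)) a" by (rule simple_rootsD(1)[OF nd j])
      hence "coprime (int (p ^ 2)) (poly (pderiv (Q j)) a)"
        using p by (simp add: prime_imp_coprime)
      ultimately have "int (p ^ 2) dvd h" by (simp add: coprime_dvd_mult_left_iff)
      hence "a mod int (p ^ 2) = b mod int (p ^ 2)" by (metis h_def mod_eq_dvd_iff)
      thus "a = b" using ab by simp
    qed
    show "(\<lambda>a. a mod int p) ` ?B \<subseteq> {a \<in> {0..<int p}. int p dvd poly (Q j) a}"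
    proof
      fix b assume "b \<in> (\<lambda>a. a mod int p) ` ?B"
      then obtain a where a: "b = a mod int p" "int (p ^ 2) dvd poly (Q j) a" by blast
      have "int p dvd poly (Q j) a" using a(2) by (auto intro: dvd_trans[of _ "int (p ^ 2)"])
      hence "int p dvd poly (Q j) b" using periodic_modD[OF periodic_mod_dvd_poly, of p "Q j" a] a(1) by simp
      thus "b \<in> {a \<in> {0..<int p}. int p dvd poly (Q j) a}" using a(1) p0 by simp
    qed
  qed (rule finite_subset[of _ "{0..<int p}"], auto)
  hence cB: "card ?B \<le> rho j p" by (simp add: rho_def num_roots_mod_def)
  have "?A - ?B \<subseteq> {a \<in> {0..<int (p ^ 2)}. vcond p (e1 j) a}"
  proof
    fix a assume a: "a \<in> ?A - ?B"
    have "vcond p (e1 j) a" unfolding vcond_def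
    proof
      fix i assume i: "i \<in> {1..r}"
      show "int (p ^ e1 j i) dvd poly (Q i) a \<and> \<not> int (p ^ Suc (e1 j i)) dvd poly (Q i) a"
        using a i simple_rootsD(2)[OF nd j, of a i] by (auto simp: e1_def power2_eq_square)
    qed
    thus "a \<in> {a \<in> {0..<int (p ^ 2)}. vcond p (e1 j) a}" using a by simp
  qed
  hence "card (?A - ?B) \<le> pcount (vcond p (e1 j)) (p ^ 2)" unfolding pcount_def by (rule card_mono[OF fin])
  moreover have "card (?A - ?B) \<ge> card ?A - card ?B" by (rule diff_card_le_card_Diff[OF fin])
  ultimately have "p * rho j p - rho j p \<le> pcount (vcond p (e1 j)) (p ^ 2)" using cA cB by linarith
  hence "real (p * rho j p) - real (rho j p) \<le> real (pcount (vcond p (e1 j)) (p ^ 2))" by linarith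
  moreover have "2 * real (rho j p) \<le> real p * real (rho j p)" using p0 by (intro mult_right_mono) auto
  ultimately have "real p * real (rho j p) / 2 \<le> real (pcount (vcond p (e1 j)) (p ^ 2))" by simp
  hence "real p * real (rho j p) / 2 / real (p ^ 2) \<le> real (pcount (vcond p (e1 j)) (p ^ 2)) / real (p ^ 2)"
    by (rule divide_right_mono) simp
  moreover have "real p * real (rho j p) / 2 / real (p ^ 2) = real (rho j p) / real p / 2"
    using p0 by (simp add: power2_eq_square)
  moreover have "wd p (e1 j) = real (pcount (vcond p (e1 j)) (p ^ 2)) / real (p ^ 2)"
    using esum_e1[OF j] by (simp add: wd_def numeral_2_eq_2)
  ultimately show ?thesis by simp
qed

end

section \<open>Counting with a prescribed smooth part\<close>

context poly_fam
begin

section \<open>The local measures and their Rankin tilt\<close>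

definition EN :: "nat \<Rightarrow> (nat \<Rightarrow> nat) set" where "EN N = PiE {1..r} (\<lambda>_. {..N})"
definition W :: "real \<Rightarrow> nat \<Rightarrow> (nat \<Rightarrow> nat) \<Rightarrow> real" where
  "W \<sigma> p e = wd p e * real p powr (\<sigma> * real (esum e))"
text \<open>The sum of a geometric series with ratio 2^(-3/(4g)): it bounds the tilted mass of
  exponent sums beyond 2g, with p replaced by 2 in the ratio.\<close>

definition tailC :: real where "tailC = real g / (1 - 2 powr (- (3 / (4 * real g))))"

lemma finite_EN [simp]: "finite (EN N)"
  unfolding EN_def by (intro finite_PiE) auto

lemma EN_ext: "F \<subseteq> EN N \<Longrightarrow> F \<subseteq> extensional {1..r}"
  by (auto simp: EN_def PiE_def)

lemma tailC_base: "2 powr (- (3 / (4 * real g))) < (1 :: real)"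
  using g by (intro powr_less_one) auto

lemma tailC_nonneg: "tailC \<ge> 0"
  unfolding tailC_def using tailC_base by (intro divide_nonneg_nonneg) auto

lemma density_prime_power_le:
  assumes p: "prime p" and i: "i \<ge> 1"
  shows "real (pcount (\<lambda>a. int (p ^ i) dvd poly Qp a) (p ^ i)) / real (p ^ i) \<le> real g * real p powr (- (real i / real g))"
proof -
  have p2: "p \<ge> 2" using p prime_ge_2_nat by auto
  \<comment> \<open>This is i / g rounded up, the largest k with g(k - 1) < i.\<close>
  define k where "k = (i - 1) div g + 1"
  have k: "k \<ge> 1" "k \<le> i" "g * (k - 1) < i" "i \<le> g * k"
  proof -
    show "k \<ge> 1" by (simp add: k_def)
    have "(i - 1) div g \<le> i - 1" by (rule div_le_dividend)
    thus "k \<le> i" using i unfolding k_def by linarith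
    have "g * (k - 1) \<le> i - 1" unfolding k_def by simp
    thus "g * (k - 1) < i" using i by linarith
    have "i - 1 < g * ((i - 1) div g) + g" using g dividend_less_times_div[of g "i - 1"] by simp
    thus "i \<le> g * k" using i by (simp add: k_def)
  qed
  have "real (pcount (\<lambda>a. int (p ^ i) dvd poly Qp a) (p ^ i)) / real (p ^ i) \<le> real (g * p ^ (i - k)) / real (p ^ i)"
    using rho0_prime_power_le[OF p i k(1-3)] by (intro divide_right_mono) (simp_all only: of_nat_le_iff of_nat_0_le_iff)
  also have "\<dots> = real g * real p powr (- real k)"
  proof -
    have "real (p ^ i) = real (p ^ (i - k)) * real p ^ k" using k by (simp flip: power_add)
    thus ?thesis using p2 by (simp add: powr_minus powr_realpow field_simps)
  qed
  also have "\<dots> \<le> real g * real p powr (- (real i / real g))"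
  proof -
    have "real i \<le> real g * real k" using k(4) by (metis of_nat_le_iff of_nat_mult)
    hence "real i / real g \<le> real k" using g by (simp add: divide_le_eq mult.commute)
    thus ?thesis using p2 by (intro mult_left_mono powr_mono) auto
  qed
  finally show ?thesis .
qed

text \<open>Three ranges of the exponent sum. The untilted total is at most 1. Up to 2g the tilt
  adds at most a factor p^(2g\<sigma>) - 1 on an event of density at most g/p. For i beyond 2g the
  density p^(-i/g) absorbs the tilt p^(\<sigma> i), because \<sigma> is at most 1/(4g): what
  remains, p^(-3i/(4g)), is at most p^(-3/2) and decays geometrically, so it is summable over
  p.\<close>

lemma sum_W_le:
  assumes p: "prime p" and \<sigma>: "\<sigma> \<ge> 0" "\<sigma> \<le> 1 / (4 * real g)"
  shows "(\<Sum>e\<in>EN N. W \<sigma> p e) \<le> 1 + real g * ((real p powr (2 * real g * \<sigma>) - 1) / real p) + tailC * real p powr (- (3 / 2))"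
proof -
  have p2: "p \<ge> 2" using p prime_ge_2_nat by auto
  let ?d = "\<lambda>i. real (pcount (\<lambda>a. int (p ^ i) dvd poly Qp a) (p ^ i)) / real (p ^ i)"
  let ?F = "\<lambda>P. {e\<in>EN N. P (esum e)}"
  define c where "c = real p powr (2 * real g * \<sigma>) - 1"
  have c0: "c \<ge> 0" unfolding c_def using p2 \<sigma> by (simp add: ge_one_powr_ge_zero)
  have "W \<sigma> p e \<le> wd p e + (if 1 \<le> esum e then wd p e * c else 0) +
      (if 2 * g < esum e then W \<sigma> p e else 0)" for e
  proof (cases "2 * g < esum e")
    case True
    thus ?thesis using c0 by simp
  next
    case False
    show ?thesis
    proof (cases "1 \<le> esum e")
      case True
      have "\<sigma> * real (esum e) \<le> \<sigma> * real (2 * g)" using False \<sigma>(1) by (intro mult_left_mono) auto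
      hence "real p powr (\<sigma> * real (esum e)) \<le> 1 + c"
        unfolding c_def using p2 by (simp add: mult_ac)
      hence "wd p e * real p powr (\<sigma> * real (esum e)) \<le> wd p e * (1 + c)" by (rule mult_left_mono) simp
      thus ?thesis using True False by (simp add: W_def algebra_simps)
    next
      case 2: False
      hence "esum e = 0" by simp
      thus ?thesis using p2 by (simp add: W_def)
    qed
  qed
  hence "(\<Sum>e\<in>EN N. W \<sigma> p e) \<le> (\<Sum>e\<in>EN N. wd p e + (if 1 \<le> esum e then wd p e * c else 0) +
      (if 2 * g < esum e then W \<sigma> p e else 0))" by (rule sum_mono)
  also have "\<dots> = (\<Sum>e\<in>EN N. wd p e) + (\<Sum>e\<in>?F (\<lambda>i. 1 \<le> i). wd p e) * c + (\<Sum>e\<in>?F (\<lambda>i. 2 * g < i). W \<sigma> p e)"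
    unfolding sum.distrib sum_distrib_right by (simp add: sum.inter_filter)
  also have "(\<Sum>e\<in>EN N. wd p e) \<le> 1"
  proof -
    have "(\<Sum>e\<in>EN N. wd p e) \<le> ?d 0" by (rule sum_wd_le[OF p]) (use EN_ext in auto)
    also have "?d 0 \<le> 1" using pcount_le[of "\<lambda>a. int (p ^ 0) dvd poly Qp a" "p ^ 0"] by simp
    finally show ?thesis .
  qed
  also have "(\<Sum>e\<in>?F (\<lambda>i. 1 \<le> i). wd p e) * c \<le> real g / real p * c"
  proof (rule mult_right_mono[OF _ c0])
    have "(\<Sum>e\<in>?F (\<lambda>i. 1 \<le> i). wd p e) \<le> ?d 1"
      by (rule sum_wd_le[OF p]) (use EN_ext[of "?F (\<lambda>i. 1 \<le> i)"] in auto)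
    also have "\<dots> \<le> real g / real p"
      using rho0_le[OF p] unfolding rho0_def num_roots_mod_eq_pcount by (simp add: divide_right_mono)
    finally show "(\<Sum>e\<in>?F (\<lambda>i. 1 \<le> i). wd p e) \<le> real g / real p" .
  qed
  also have "(\<Sum>e\<in>?F (\<lambda>i. 2 * g < i). W \<sigma> p e) \<le> tailC * real p powr (- (3 / 2))"
  proof -
    define L where "L = (\<Sum>e\<in>EN N. esum e)"
    have eL: "esum e \<le> L" if "e \<in> EN N" for e
      unfolding L_def using that by (intro member_le_sum) auto
    have "(\<Sum>e\<in>?F (\<lambda>i. 2 * g < i). W \<sigma> p e) = (\<Sum>l\<le>L. \<Sum>e\<in>?F (\<lambda>i. i = 2 * g + 1 + l). W \<sigma> p e)"
    proof -
      have "(\<Sum>l\<le>L. \<Sum>e\<in>?F (\<lambda>i. i = 2 * g + 1 + l). W \<sigma> p e) = (\<Sum>e\<in>(\<Union>l\<in>{..L}. ?F (\<lambda>i. i = 2 * g + 1 + l)). W \<sigma> p e)"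
        by (rule sum.UNION_disjoint[symmetric]) auto
      also have "(\<Union>l\<in>{..L}. ?F (\<lambda>i. i = 2 * g + 1 + l)) = ?F (\<lambda>i. 2 * g < i)"
      proof (intro equalityI subsetI)
        fix e assume e: "e \<in> ?F (\<lambda>i. 2 * g < i)"
        hence "esum e - (2 * g + 1) \<le> L" using eL[of e] by simp
        moreover have "esum e = 2 * g + 1 + (esum e - (2 * g + 1))" using e by simp
        ultimately show "e \<in> (\<Union>l\<in>{..L}. ?F (\<lambda>i. i = 2 * g + 1 + l))" using e by blast
      qed auto
      finally show ?thesis ..
    qed
    also have "\<dots> \<le> (\<Sum>l\<le>L. real g * real p powr (- (3 / 2)) * (2 powr (- (3 / (4 * real g)))) ^ l)"
    proof (rule sum_mono)
      fix l
      define i where "i = 2 * g + 1 + l"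
      have i1: "i \<ge> 1" by (simp add: i_def)
      have "(\<Sum>e\<in>?F (\<lambda>k. k = i). W \<sigma> p e) = (\<Sum>e\<in>?F (\<lambda>k. k = i). wd p e) * real p powr (\<sigma> * real i)"
        by (simp add: W_def sum_distrib_right)
      also have "\<dots> \<le> ?d i * real p powr (\<sigma> * real i)"
        by (intro mult_right_mono sum_wd_le[OF p]) (use EN_ext[of "?F (\<lambda>k. k = i)"] in auto)
      also have "\<dots> \<le> real g * real p powr (- (real i / real g)) * real p powr (\<sigma> * real i)"
        by (intro mult_right_mono density_prime_power_le[OF p i1]) auto
      also have "\<dots> = real g * real p powr (\<sigma> * real i - real i / real g)"
        by (simp add: powr_add[symmetric])
      also have "\<dots> \<le> real g * real p powr (- (3 / 2) + - (3 / (4 * real g)) * real l)"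
      proof (intro mult_left_mono powr_mono)
        have "\<sigma> * real i \<le> 1 / (4 * real g) * real i" using \<sigma> by (intro mult_right_mono) auto
        hence "\<sigma> * real i - real i / real g \<le> - (3 / (4 * real g)) * real i"
          using g by (simp add: field_simps)
        also have "\<dots> \<le> - (3 / (4 * real g)) * (2 * real g + real l)"
          using g by (intro mult_left_mono_neg) (auto simp: i_def)
        also have "\<dots> = - (3 / 2) + - (3 / (4 * real g)) * real l" using g by (simp add: field_simps)
        finally show "\<sigma> * real i - real i / real g \<le> - (3 / 2) + - (3 / (4 * real g)) * real l" .
      qed (use p2 in auto)
      also have "\<dots> = real g * real p powr (- (3 / 2)) * (real p powr (- (3 / (4 * real g)))) ^ l"
        unfolding powr_add powr_powr[symmetric] using p2 by (simp add: powr_realpow)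
      also have "\<dots> \<le> real g * real p powr (- (3 / 2)) * (2 powr (- (3 / (4 * real g)))) ^ l"
        using p2 g by (intro mult_left_mono power_mono powr_mono2') auto
      finally show "(\<Sum>e\<in>?F (\<lambda>i. i = 2 * g + 1 + l). W \<sigma> p e) \<le> real g * real p powr (- (3 / 2)) * (2 powr (- (3 / (4 * real g)))) ^ l"
        unfolding i_def .
    qed
    also have "\<dots> = real g * real p powr (- (3 / 2)) * (\<Sum>l\<le>L. (2 powr (- (3 / (4 * real g)))) ^ l)"
      by (simp add: sum_distrib_left)
    also have "\<dots> \<le> real g * real p powr (- (3 / 2)) * (1 / (1 - 2 powr (- (3 / (4 * real g)))))"
    proof (rule mult_left_mono)
      have "(\<Sum>l\<le>L. (2 powr (- (3 / (4 * real g)))) ^ l) \<le> (\<Sum>l. (2 powr (- (3 / (4 * real g)))) ^ l)"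
        using tailC_base by (intro sum_le_suminf summable_geometric) auto
      also have "\<dots> = 1 / (1 - 2 powr (- (3 / (4 * real g))))"
        using tailC_base by (intro suminf_geometric) auto
      finally show "(\<Sum>l\<le>L. (2 powr (- (3 / (4 * real g)))) ^ l) \<le> 1 / (1 - 2 powr (- (3 / (4 * real g))))" .
    qed simp
    finally show ?thesis by (simp add: tailC_def mult_ac)
  qed
  finally show ?thesis by (simp add: c_def)
qed

text \<open>Bounds for one local factor and for their product over p up to T. They depend on T and
  \<sigma> only through b, an upper bound for \<sigma> ln T; this makes them uniform over all
  blocks.\<close>

definition massB :: "real \<Rightarrow> real" where "massB b = 1 + real g * exp (2 * real g * b) + tailC"
definition massC :: "real \<Rightarrow> real" where
  "massC b = exp (real g * (2 * (2 * real g * b) * exp (2 * real g * b)) + tailC * (\<Sum>n. real n powr (- (3 / 2))))"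
definition mass :: "real \<Rightarrow> nat \<Rightarrow> real" where
  "mass \<sigma> p = 1 + real g * ((real p powr (2 * real g * \<sigma>) - 1) / real p) + tailC * real p powr (- (3 / 2))"

lemma mass_props:
  assumes T: "T \<ge> 1" and \<sigma>: "\<sigma> \<ge> 0" "\<sigma> * ln T \<le> b" and p: "p \<in> primes_le T"
  shows "mass \<sigma> p > 0" "mass \<sigma> p \<le> massB b"
proof -
  have p2: "p \<ge> 2" "real p \<le> T" using p by (auto dest: primes_leD)
  have ge: "real p powr (2 * real g * \<sigma>) \<ge> 1" using p2 \<sigma> by (intro ge_one_powr_ge_zero) auto
  have "(real p powr (2 * real g * \<sigma>) - 1) / real p \<ge> 0" using ge by simp
  thus "mass \<sigma> p > 0" unfolding mass_def using tailC_nonneg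
    by (intro add_pos_nonneg mult_nonneg_nonneg) auto
  have "\<sigma> * ln (real p) \<le> \<sigma> * ln T" using p2 \<sigma> by (intro mult_left_mono ln_mono) auto
  hence "2 * real g * (\<sigma> * ln (real p)) \<le> 2 * real g * b" using \<sigma> by (intro mult_left_mono) auto
  hence "real p powr (2 * real g * \<sigma>) \<le> exp (2 * real g * b)" using p2 by (simp add: powr_def mult_ac)
  hence "(real p powr (2 * real g * \<sigma>) - 1) / real p \<le> exp (2 * real g * b) / 1"
    using p2 ge by (intro frac_le) auto
  moreover have "real p powr (- (3 / 2)) \<le> 1" using p2 powr_mono[of "- (3 / 2)" 0 "real p"] by simp
  hence "tailC * real p powr (- (3 / 2)) \<le> tailC * 1" using tailC_nonneg by (rule mult_left_mono)
  ultimately show "mass \<sigma> p \<le> massB b" unfolding mass_def massB_def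
    using mult_left_mono[of "(real p powr (2 * real g * \<sigma>) - 1) / real p" "exp (2 * real g * b)" "real g"] by simp
qed

lemma massB_ge_1: "massB b \<ge> 1"
  using tailC_nonneg by (simp add: massB_def)

lemma prod_exp_linear:
  fixes u v :: "nat \<Rightarrow> real"
  shows "(\<Prod>p\<in>primes_le T. exp (c * u p + d * v p)) = exp (c * (\<Sum>p\<in>primes_le T. u p) + d * (\<Sum>p\<in>primes_le T. v p))"
  by (simp add: exp_sum exp_add sum_distrib_left prod.distrib)

lemma prod_mass_le:
  assumes T: "T \<ge> 1" and \<sigma>: "\<sigma> \<ge> 0" "\<sigma> * ln T \<le> b"
  shows "(\<Prod>p\<in>primes_le T. mass \<sigma> p) \<le> massC b"
proof -
  have "(\<Prod>p\<in>primes_le T. mass \<sigma> p) \<le> (\<Prod>p\<in>primes_le T. exp (real g * ((real p powr (2 * real g * \<sigma>) - 1) / real p) + tailC * real p powr (- (3 / 2))))"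
  proof (rule prod_mono)
    fix p assume p: "p \<in> primes_le T"
    show "0 \<le> mass \<sigma> p \<and> mass \<sigma> p \<le> exp (real g * ((real p powr (2 * real g * \<sigma>) - 1) / real p) + tailC * real p powr (- (3 / 2)))"
      using mass_props(1)[OF T \<sigma> p] exp_ge_add_one_self[of "real g * ((real p powr (2 * real g * \<sigma>) - 1) / real p) + tailC * real p powr (- (3 / 2))"]
      unfolding mass_def by linarith
  qed
  also have "\<dots> = exp (real g * (\<Sum>p\<in>primes_le T. (real p powr (2 * real g * \<sigma>) - 1) / real p) + tailC * (\<Sum>p\<in>primes_le T. real p powr (- (3 / 2))))"
    by (rule prod_exp_linear)
  also have "\<dots> \<le> massC b"
    unfolding massC_def
  proof (subst exp_le_cancel_iff, intro add_mono mult_left_mono)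
    show "(\<Sum>p\<in>primes_le T. (real p powr (2 * real g * \<sigma>) - 1) / real p) \<le> 2 * (2 * real g * b) * exp (2 * real g * b)"
    proof (rule rankin_cost[OF T])
      have "2 * real g * (\<sigma> * ln T) \<le> 2 * real g * b" using \<sigma> by (intro mult_left_mono) auto
      thus "2 * real g * \<sigma> * ln T \<le> 2 * real g * b" by (simp only: mult.assoc)
    qed (use \<sigma> in simp)
    show "(\<Sum>p\<in>primes_le T. real p powr (- (3 / 2))) \<le> (\<Sum>n. real n powr (- (3 / 2)))"
      by (intro sum_le_suminf) (auto simp: summable_real_powr_iff)
  qed (use tailC_nonneg in auto)
  finally show ?thesis .
qed

text \<open>At p > 2g the base event has probability at least 1/2, since Q has at most g roots
  modulo p; at p not dividing \<beta>D the coordinates decouple.\<close>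

definition good :: "real \<Rightarrow> nat set" where
  "good T = {p \<in> primes_le T. p > 2 * g \<and> \<not> p dvd N0}"

definition Esum :: "(nat \<Rightarrow> real) \<Rightarrow> nat \<Rightarrow> real \<Rightarrow> real" where
  "Esum f j T = (\<Sum>p | p \<in> good T \<and> f p \<noteq> 0. real (rho j p) / real p)"

lemma e0_EN: "e0 \<in> EN N" by (auto simp: EN_def e0_def)

lemma inj_on_e1: "inj_on e1 {1..r}"
proof (rule inj_onI)
  fix i j assume ij: "i \<in> {1..r}" "j \<in> {1..r}" "e1 i = e1 j"
  have a: "e1 i i = 1" using ij(1) by (simp add: e1_def)
  have b: "e1 j i = 0" if "i \<noteq> j" using ij(1) that by (simp add: e1_def)
  have c: "e1 i i = e1 j i" by (rule fun_cong[OF ij(3)])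
  show "i = j"
  proof (rule ccontr)
    assume "i \<noteq> j"
    from b[OF this] a c show False by linarith
  qed
qed

lemma e1_EN:
  assumes N: "N \<ge> 1"
  shows "e1 j \<in> EN N"
  unfolding EN_def
proof (rule PiE_I)
  show "e1 j i \<in> {..N}" if "i \<in> {1..r}" for i using N that by (simp add: e1_def)
  show "e1 j i = undefined" if "i \<notin> {1..r}" for i using that by (simp only: e1_def restrict_apply if_False)
qed

lemma tuple_concentration:
  fixes f :: "nat \<Rightarrow> nat \<Rightarrow> real"
  assumes f1: "\<And>j. j \<in> {1..r} \<Longrightarrow> f j 1 = 0" and N: "N \<ge> 1"
    and T: "T \<ge> 1" and \<sigma>: "\<sigma> \<ge> 0" "\<sigma> \<le> 1 / (4 * real g)" "\<sigma> * ln T \<le> b"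
  shows "(\<Sum>\<nu>\<in>{\<nu> \<in> PiE (primes_le T) (\<lambda>_. EN N). \<forall>j\<in>{1..r}. (\<Sum>p\<in>primes_le T. f j (p ^ \<nu> p j)) = k j}. \<Prod>p\<in>primes_le T. W \<sigma> p (\<nu> p))
     \<le> massC b * (\<Prod>j=1..r. 60 * massB b / sqrt (1 + Esum (f j) j T))"
proof -
  have "(\<Sum>\<nu>\<in>{\<nu> \<in> PiE (primes_le T) (\<lambda>_. EN N). \<forall>j\<in>{1..r}. (\<Sum>p\<in>primes_le T. f j (p ^ \<nu> p j)) = k j}. \<Prod>p\<in>primes_le T. W \<sigma> p (\<nu> p))
     \<le> (\<Prod>p\<in>primes_le T. mass \<sigma> p) * (\<Prod>j\<in>{1..r}. 60 * massB b / sqrt (1 + (\<Sum>p | p \<in> good T \<and> f j (p ^ e1 j j) \<noteq> 0. real (rho j p) / real p)))"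
  proof (rule concentration[where f = "\<lambda>j p e. f j (p ^ e j)" and ?e0.0 = e0 and ?e1.0 = e1 and G = "good T"])
    show "W \<sigma> p e \<ge> 0" for p e by (simp add: W_def)
    show "e0 \<in> EN N" by (rule e0_EN)
    show "f j (p ^ e0 j) = 0" if "j \<in> {1..r}" for j p using f1 that by (simp add: e0_def)
    show "inj_on e1 {1..r}" by (rule inj_on_e1)
    show "e1 j \<in> EN N" for j by (rule e1_EN[OF N])
    show "f i (p ^ e1 j i) = 0" if "i \<in> {1..r}" "i \<noteq> j" for i j p using f1 that by (simp add: e1_def)
    show "good T \<subseteq> primes_le T" by (auto simp: good_def)
    show "1 / 2 \<le> W \<sigma> p e0" if p: "p \<in> good T" for p
    proof -
      have p': "prime p" "p > 2 * g" using p by (auto simp: good_def dest: primes_leD)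
      hence "real (rho0 p) \<le> real p / 2" using rho0_le[OF p'(1)] by linarith
      hence "real (rho0 p) / real p \<le> 1 / 2" using p' by (simp add: divide_le_eq)
      thus ?thesis using p' wd_e0[OF p'(1)] by (simp add: W_def esum_e0)
    qed
    show "real (rho j p) / real p / 2 \<le> W \<sigma> p (e1 j)" if j: "j \<in> {1..r}" and p: "p \<in> good T" for j p
    proof -
      have p': "prime p" "\<not> p dvd N0" "p \<ge> 2" using p by (auto simp: good_def dest: primes_leD)
      have "real (rho j p) / real p / 2 \<le> wd p (e1 j) * 1" using wd_e1_ge[OF p'(1,2) j] by simp
      also have "\<dots> \<le> W \<sigma> p (e1 j)" unfolding W_def
        using p' \<sigma>(1) by (intro mult_left_mono ge_one_powr_ge_zero) auto
      finally show ?thesis .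
    qed
    show "(\<Sum>e\<in>EN N. W \<sigma> p e) \<le> mass \<sigma> p" if "p \<in> primes_le T" for p
      unfolding mass_def using that \<sigma> by (intro sum_W_le) (auto dest: primes_leD)
    show "mass \<sigma> p > 0" "mass \<sigma> p \<le> massB b" if "p \<in> primes_le T" for p
      using mass_props[OF T \<sigma>(1,3) that] by auto
  qed (auto simp: massB_ge_1)
  also have "\<dots> \<le> massC b * (\<Prod>j=1..r. 60 * massB b / sqrt (1 + Esum (f j) j T))"
  proof (rule mult_mono)
    show "(\<Prod>p\<in>primes_le T. mass \<sigma> p) \<le> massC b" using prod_mass_le[OF T \<sigma>(1) \<sigma>(3)] .
    show "(\<Prod>j\<in>{1..r}. 60 * massB b / sqrt (1 + (\<Sum>p | p \<in> good T \<and> f j (p ^ e1 j j) \<noteq> 0. real (rho j p) / real p)))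
      \<le> (\<Prod>j=1..r. 60 * massB b / sqrt (1 + Esum (f j) j T))"
      unfolding Esum_def by (intro eq_refl prod.cong) (auto simp: e1_def)
    show "0 \<le> massC b" by (simp add: massC_def)
    show "0 \<le> (\<Prod>j\<in>{1..r}. 60 * massB b / sqrt (1 + (\<Sum>p | p \<in> good T \<and> f j (p ^ e1 j j) \<noteq> 0. real (rho j p) / real p)))"
    proof (rule prod_nonneg)
      fix j
      have "(\<Sum>p | p \<in> good T \<and> f j (p ^ e1 j j) \<noteq> 0. real (rho j p) / real p) \<ge> 0" by (rule sum_nonneg) simp
      thus "0 \<le> 60 * massB b / sqrt (1 + (\<Sum>p | p \<in> good T \<and> f j (p ^ e1 j j) \<noteq> 0. real (rho j p) / real p))"
        using massB_ge_1[of b] by simp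
    qed
  qed
  finally show ?thesis .
qed


section \<open>Exponent vectors of Q(n), and the sieve for a prescribed smooth part\<close>

definition val :: "nat \<Rightarrow> int \<Rightarrow> nat \<Rightarrow> nat" where
  "val p n = (\<lambda>j\<in>{1..r}. multiplicity (int p) (poly (Q j) n))"

definition smooth_part :: "nat \<Rightarrow> int \<Rightarrow> nat" where
  "smooth_part s n = (\<Prod>p | prime p \<and> p < s. p ^ esum (val p n))"

lemma vcond_val:
  assumes p: "prime p" and n: "poly Qp n \<noteq> 0"
  shows "vcond p (val p n) n"
  unfolding vcond_def
proof
  fix j assume j: "j \<in> {1..r}"
  have nz: "poly (Q j) n \<noteq> 0" using n j by (auto simp: poly_Qp)
  have nu: "\<not> is_unit (int p)" using p by (auto dest: prime_gt_1_nat)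
  have "int p ^ val p n j dvd poly (Q j) n" using j by (simp add: val_def multiplicity_dvd)
  moreover have "\<not> int p ^ Suc (val p n j) dvd poly (Q j) n"
    using j power_dvd_iff_le_multiplicity[OF nz nu, of "Suc (val p n j)"] by (simp add: val_def del: power_Suc)
  ultimately show "int (p ^ val p n j) dvd poly (Q j) n \<and> \<not> int (p ^ Suc (val p n j)) dvd poly (Q j) n"
    by simp
qed

lemma val_eq_e0:
  assumes p: "prime p" and n: "poly Qp n \<noteq> 0" "val p n = e0"
  shows "\<not> int p dvd poly Qp n"
  using vcond_val[OF p n(1)] unfolding n(2) vcond_e0[OF p] .

lemma esum_eq_0:
  assumes "e \<in> EN N" "esum e = 0"
  shows "e = e0"
proof (rule extensionalityI[of e "{1..r}" e0])
  show "e \<in> extensional {1..r}" using assms(1) by (simp add: EN_def PiE_def)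
  show "e0 \<in> extensional {1..r}" by (simp add: e0_def)
  fix j assume j: "j \<in> {1..r}"
  thus "e j = e0 j" using esum_ge[OF j, of e] assms(2) by (simp add: e0_def)
qed

definition blockC :: "real \<Rightarrow> real" where
  "blockC b = 4 * exp (8 * real g) * massC b * (60 * massB b) ^ r"

text \<open>The primes with a nonzero tuple give congruences modulo m, those up to t with the zero
  tuple are sieved, and each group contributes precisely its densities \<open>wd\<close>. Primes
  between t and T with the zero tuple are left free; their densities are restored at the price
  exp(8g), as T is at most t^2. The smooth part below y^(1/4) makes m at most sqrt y, so the sieve
  level depends on y alone.\<close>

lemma card_local_conditions_le:
  fixes x y t T Qb :: real
  assumes t: "t \<ge> 2" "t \<ge> 2 * real g" "T \<ge> t" "T \<le> t ^ 2"
    and Qb: "Qb \<ge> 1" "Qb ^ 6 \<le> sqrt y" "ln Qb \<ge> (6 * real (g * (g + 1)) + 1) * ln t"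
    and \<nu>: "\<nu> \<in> PiE (primes_le T) (\<lambda>_. EN N)"
    and a: "real (\<Prod>p\<in>primes_le T. p ^ esum (\<nu> p)) ^ 4 \<le> y"
  shows "real (card {n :: int. x < n \<and> n \<le> x + y \<and> (\<forall>p\<in>primes_le T. \<nu> p \<noteq> e0 \<longrightarrow> vcond p (\<nu> p) n) \<and>
       (\<forall>p\<in>primes_le t. \<nu> p = e0 \<longrightarrow> \<not> int p dvd poly Qp n)})
     \<le> 4 * exp (8 * real g) * y * (\<Prod>p\<in>primes_le T. wd p (\<nu> p))"
    (is "real (card ?S) \<le> _")
proof -
  define U where "U = {p \<in> primes_le T. \<nu> p \<noteq> e0}"
  define P where "P = {p \<in> primes_le t. \<nu> p = e0}"
  have finU: "finite U" and UT: "U \<subseteq> primes_le T" by (auto simp: U_def)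
  have finP: "finite P" and Pt: "P \<subseteq> primes_le t" by (auto simp: P_def)
  have PT: "P \<subseteq> primes_le T" using Pt primes_le_mono[OF t(3)] by blast
  define m where "m = (\<Prod>p\<in>U. p ^ Suc (esum (\<nu> p)))"
  define B where "B a = (\<forall>p\<in>U. vcond p (\<nu> p) a)" for a
  have prU: "prime p" "p \<ge> 2" if "p \<in> U" for p using that UT by (auto dest: primes_leD)
  have m0: "m > 0" unfolding m_def using prU by (intro prod_pos) (auto intro: prime_gt_0_nat)
  have Bper: "periodic_mod B m" unfolding B_def[abs_def] m_def
    using finU by (intro periodic_mod_prod periodic_vcond) auto
  have Bcount: "pcount B m = (\<Prod>p\<in>U. pcount (vcond p (\<nu> p)) (p ^ Suc (esum (\<nu> p))))"
    unfolding B_def[abs_def] m_def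
  proof (rule pcount_prod[OF finU])
    fix p q assume "p \<in> U" "q \<in> U" "p \<noteq> q"
    hence "coprime p q" using prU by (intro primes_coprime) auto
    thus "coprime (p ^ Suc (esum (\<nu> p))) (q ^ Suc (esum (\<nu> q)))" by (simp del: power_Suc)
  next
    fix p assume "p \<in> U"
    thus "p ^ Suc (esum (\<nu> p)) > 0" using prU(2)[of p] by simp
  qed (rule periodic_vcond, rule order_refl)
  have Bdens: "real (pcount B m) / real m = (\<Prod>p\<in>U. wd p (\<nu> p))"
    unfolding Bcount unfolding m_def wd_def of_nat_prod prod_dividef ..
  have y0: "y > 0"
  proof -
    have "sqrt y \<ge> 1" using Qb(1,2) by (meson one_le_power order_trans)
    hence "sqrt y > 0" by linarith
    thus ?thesis by simp
  qed
  have my: "sqrt y \<le> y / m"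
  proof -
    define A where "A = (\<Prod>p\<in>primes_le T. p ^ esum (\<nu> p))"
    \<comment> \<open>A nonzero tuple has exponent sum e at least 1, so e + 1 \<le> 2e: the extra
      factor p that separates exact from plain divisibility at most squares the modulus.\<close>
    have "m \<le> (\<Prod>p\<in>U. p ^ (2 * esum (\<nu> p)))" unfolding m_def
    proof (rule prod_mono)
      fix p assume p: "p \<in> U"
      have "\<nu> p \<in> EN N" using p UT \<nu> by auto
      hence "esum (\<nu> p) \<noteq> 0" using esum_eq_0 p by (auto simp: U_def)
      thus "0 \<le> p ^ Suc (esum (\<nu> p)) \<and> p ^ Suc (esum (\<nu> p)) \<le> p ^ (2 * esum (\<nu> p))"
        using prU(2)[OF p] by (intro conjI power_increasing) auto
    qed
    also have "\<dots> = (\<Prod>p\<in>U. p ^ esum (\<nu> p))\<^sup>2" by (simp add: power_mult[symmetric] mult.commute prod_power_distrib)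
    also have "(\<Prod>p\<in>U. p ^ esum (\<nu> p)) = A" unfolding A_def
      by (rule prod.mono_neutral_left) (auto simp: U_def esum_e0)
    finally have "real m \<le> real (A\<^sup>2)" by (simp only: of_nat_le_iff)
    hence "real m ^ 2 \<le> (real A ^ 2) ^ 2" by (intro power_mono) auto
    also have "\<dots> \<le> y" using a by (simp add: A_def flip: power_mult)
    finally have "real m \<le> sqrt y" by (rule real_le_rsqrt)
    hence "sqrt y * real m \<le> sqrt y * sqrt y" using y0 by (intro mult_left_mono) auto
    thus ?thesis using y0 m0 by (simp add: le_divide_eq)
  qed
  have wd0: "wd p e0 = 1 - real (pcount (\<lambda>n. int p dvd poly Qp n) p) / real p" if "p \<in> P" for p
    using wd_e0[of p] that Pt by (auto simp: rho0_def num_roots_mod_eq_pcount dest: primes_leD)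
  have RHS0: "4 * exp (8 * real g) * y * (\<Prod>p\<in>primes_le T. wd p (\<nu> p)) \<ge> 0"
    using y0 by (intro mult_nonneg_nonneg prod_nonneg) auto
  show ?thesis
  \<comment> \<open>If every class modulo some sieved p is a root of Q, the set is empty. This can
    occur although no single \<open>Q_j\<close> has a fixed divisor, since their product may have
    one.\<close>
  proof (cases "\<exists>p\<in>P. pcount (\<lambda>n. int p dvd poly Qp n) p \<ge> p")
    case True
    then obtain p where p: "p \<in> P" "pcount (\<lambda>n. int p dvd poly Qp n) p \<ge> p" by blast
    have "p \<in> primes_le t" using p(1) Pt by blast
    from primes_leD(3)[OF this] have p0: "p > 0" by simp
    have sub: "{a \<in> {0..<int p}. int p dvd poly Qp a} = {0..<int p}"
    proof (rule card_subset_eq)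
      show "card {a \<in> {0..<int p}. int p dvd poly Qp a} = card {0..<int p}"
        using p(2) pcount_le[of "\<lambda>n. int p dvd poly Qp n" p] by (simp add: pcount_def)
    qed auto
    have "int p dvd poly Qp n" for n
    proof -
      have "n mod int p \<in> {a \<in> {0..<int p}. int p dvd poly Qp a}" unfolding sub using p0 by simp
      thus ?thesis using periodic_modD[OF periodic_mod_dvd_poly, of p Qp n] by simp
    qed
    hence "?S = {}" using p(1) by (auto simp: P_def)
    hence "real (card ?S) = 0" by (simp only: card.empty of_nat_0)
    thus ?thesis using RHS0 by linarith
  next
    case False
    have "?S = {n :: int. x < n \<and> n \<le> x + y \<and> B n \<and> (\<forall>p\<in>P. \<not> int p dvd poly Qp n)}"
      by (auto simp: B_def U_def P_def)
    hence "real (card ?S) = real (card {n :: int. x < n \<and> n \<le> x + y \<and> B n \<and> (\<forall>p\<in>P. \<not> int p dvd poly Qp n)})" by simp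
    also have "\<dots> \<le> 4 * (real (pcount B m) * (y / m)) * (\<Prod>p\<in>P. 1 - real (pcount (\<lambda>n. int p dvd poly Qp n) p) / p)"
    proof (rule sieve_interval[OF Bper m0 Pt t(1), where g = g and Q = Qb])
      fix p assume p: "p \<in> P"
      hence pr: "prime p" using Pt by (auto dest: primes_leD)
      show "coprime m p" unfolding m_def
      proof (rule prod_coprime_left)
        fix q assume q: "q \<in> U"
        have "q \<noteq> p" using p q by (auto simp: U_def P_def)
        hence "coprime q p" using prU(1)[OF q] pr by (intro primes_coprime) auto
        thus "coprime (q ^ Suc (esum (\<nu> q))) p" by (simp del: power_Suc)
      qed
      show "periodic_mod (\<lambda>n. int p dvd poly Qp n) p" by (rule periodic_mod_dvd_poly)
      show "pcount (\<lambda>n. int p dvd poly Qp n) p \<le> g"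
        using rho0_le[OF pr] by (simp add: rho0_def num_roots_mod_eq_pcount)
      show "pcount (\<lambda>n. int p dvd poly Qp n) p < p" using False p by auto
    qed (use Qb my in auto)
    also have "\<dots> = 4 * y * (\<Prod>p\<in>U. wd p (\<nu> p)) * (\<Prod>p\<in>P. wd p (\<nu> p))"
    proof -
      have "(\<Prod>p\<in>P. 1 - real (pcount (\<lambda>n. int p dvd poly Qp n) p) / p) = (\<Prod>p\<in>P. wd p (\<nu> p))"
        by (intro prod.cong) (auto simp: wd0[symmetric] P_def)
      thus ?thesis unfolding Bdens[symmetric] by simp
    qed
    also have "\<dots> \<le> 4 * y * (\<Prod>p\<in>U. wd p (\<nu> p)) * ((\<Prod>p\<in>P. wd p (\<nu> p)) * (exp (8 * real g) * (\<Prod>p\<in>primes_le T - U - P. wd p (\<nu> p))))"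
    proof -
      let ?R = "primes_le T - U - P"
      \<comment> \<open>For u = g/p at most 1/2 one has (1 - u) exp(2u) \<ge> 1; with the sum of 1/p
        at most 4 this produces 2g * 4 = 8g.\<close>
      have R: "wd p (\<nu> p) * exp (2 * real g * (1 / real p)) \<ge> 1" if p: "p \<in> ?R" for p
      proof -
        have pr: "prime p" "p \<ge> 2" and pt: "real p > t" and \<nu>p: "\<nu> p = e0"
          using p by (auto simp: U_def P_def primes_le_def prime_ge_2_nat)
        define u where "u = real g / real p"
        have u: "0 \<le> u" "u \<le> 1 / 2" using pt t pr by (auto simp: u_def divide_le_eq)
        have "real (rho0 p) / real p \<le> u" unfolding u_def using rho0_le[OF pr(1)] by (intro divide_right_mono) auto
        hence "wd p (\<nu> p) \<ge> 1 - u" unfolding \<nu>p wd_e0[OF pr(1)] by simp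
        hence "wd p (\<nu> p) * exp (2 * u) \<ge> (1 - u) * exp (2 * u)" by (intro mult_right_mono) auto
        moreover have "(1 - u) * exp (2 * u) \<ge> (1 - u) * (1 + 2 * u)" using u by (intro mult_left_mono exp_ge_add_one_self) auto
        moreover have "(1 - u) * (1 + 2 * u) = 1 + u * (1 - 2 * u)" by (simp add: algebra_simps)
        moreover have "u * (1 - 2 * u) \<ge> 0" using u by simp
        ultimately have "wd p (\<nu> p) * exp (2 * u) \<ge> 1" by linarith
        thus ?thesis by (simp add: u_def)
      qed
      have "1 \<le> (\<Prod>p\<in>?R. wd p (\<nu> p) * exp (2 * real g * (1 / real p)))"
        using R by (intro prod_ge_1) auto
      also have "\<dots> = (\<Prod>p\<in>?R. wd p (\<nu> p)) * exp (2 * real g * (\<Sum>p\<in>?R. 1 / real p))"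
        unfolding prod.distrib sum_distrib_left by (subst exp_sum) auto
      also have "\<dots> \<le> (\<Prod>p\<in>?R. wd p (\<nu> p)) * exp (8 * real g)"
      proof (intro mult_left_mono prod_nonneg)
        have "(\<Sum>p\<in>?R. 1 / real p) \<le> (\<Sum>p\<in>primes_le T - primes_le t. 1 / real p)"
          by (intro sum_mono2) (auto simp: U_def P_def)
        also have "\<dots> \<le> 4" using t by (intro sum_inverse_primes_between_le) auto
        finally have "2 * real g * (\<Sum>p\<in>?R. 1 / real p) \<le> 2 * real g * 4" by (intro mult_left_mono) auto
        thus "exp (2 * real g * (\<Sum>p\<in>?R. 1 / real p)) \<le> exp (8 * real g)" by simp
      qed auto
      finally have "1 \<le> exp (8 * real g) * (\<Prod>p\<in>?R. wd p (\<nu> p))" by (simp add: mult.commute)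
      hence "(\<Prod>p\<in>P. wd p (\<nu> p)) * 1 \<le> (\<Prod>p\<in>P. wd p (\<nu> p)) * (exp (8 * real g) * (\<Prod>p\<in>?R. wd p (\<nu> p)))"
        by (intro mult_left_mono prod_nonneg) auto
      thus ?thesis using y0 by (intro mult_left_mono mult_nonneg_nonneg prod_nonneg) auto
    qed
    also have "\<dots> = 4 * exp (8 * real g) * y * (\<Prod>p\<in>primes_le T. wd p (\<nu> p))"
    proof -
      have "(\<Prod>p\<in>primes_le T. wd p (\<nu> p)) = (\<Prod>p\<in>U. wd p (\<nu> p)) * (\<Prod>p\<in>primes_le T - U. wd p (\<nu> p))"
        by (subst prod.subset_diff[OF UT]) (auto simp: mult.commute)
      moreover have "(\<Prod>p\<in>primes_le T - U. wd p (\<nu> p)) = (\<Prod>p\<in>P. wd p (\<nu> p)) * (\<Prod>p\<in>primes_le T - U - P. wd p (\<nu> p))"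
        using PT by (subst prod.subset_diff[of P]) (auto simp: mult.commute U_def P_def)
      ultimately show ?thesis by (simp add: mult_ac)
    qed
    finally show ?thesis .
  qed
qed

text \<open>Each n is assigned the tuple of its exponents at the primes below \<open>s n\<close>.
  For a fixed tuple the sieve bounds the number of n by the product of densities, that is by the
  probability of the tuple in the independent model. The smooth part being at least Y, Rankin's
  trick extracts \<open>Y powr (-\<sigma>)\<close> at the price of the tilt, and the concentration
  theorem bounds the tilted probability that the sums take the values \<open>k\<close>.\<close>

theorem block_count:
  fixes x y t T Qb Y \<sigma> b :: real and f :: "nat \<Rightarrow> nat \<Rightarrow> real" and k :: "nat \<Rightarrow> real"
  assumes t: "t \<ge> 2" "t \<ge> 2 * real g" "T \<ge> t" "T \<le> t ^ 2"
    and Qb: "Qb \<ge> 1" "Qb ^ 6 \<le> sqrt y" "ln Qb \<ge> (6 * real (g * (g + 1)) + 1) * ln t"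
    and f1: "\<And>j. j \<in> {1..r} \<Longrightarrow> f j 1 = 0"
    and \<sigma>: "\<sigma> \<ge> 0" "\<sigma> \<le> 1 / (4 * real g)" "\<sigma> * ln T \<le> b" and Y: "Y > 0"
    and Nn: "\<And>n. n \<in> Nn \<Longrightarrow> x < real_of_int n" "\<And>n. n \<in> Nn \<Longrightarrow> real_of_int n \<le> x + y"
       "\<And>n. n \<in> Nn \<Longrightarrow> poly Qp n \<noteq> 0"
    and s: "\<And>n. n \<in> Nn \<Longrightarrow> t < real (s n)" "\<And>n. n \<in> Nn \<Longrightarrow> real (s n) \<le> T + 1"
       "\<And>n. n \<in> Nn \<Longrightarrow> Y \<le> real (smooth_part (s n) n)" "\<And>n. n \<in> Nn \<Longrightarrow> real (smooth_part (s n) n) ^ 4 \<le> y"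
       "\<And>n j. n \<in> Nn \<Longrightarrow> j \<in> {1..r} \<Longrightarrow> (\<Sum>p | prime p \<and> p < s n. f j (p ^ val p n j)) = k j"
  shows "real (card Nn) \<le> blockC b * y * Y powr (-\<sigma>) * (\<Prod>j=1..r. 1 / sqrt (1 + Esum (f j) j T))"
proof -
  have y1: "y \<ge> 1"
  proof -
    have "sqrt y \<ge> 1" using Qb(1,2) by (meson one_le_power order_trans)
    thus ?thesis by simp
  qed
  \<comment> \<open>An exponent is smaller than the prime power it belongs to, hence than y; so
    truncating exponents at N loses nothing.\<close>
  define N where "N = nat \<lceil>y\<rceil> + 1"
  let ?P = "primes_le T"
  \<comment> \<open>The cut varies with n, yet all tuples live on the primes up to T. Primes from
    \<open>s n\<close> to T receive \<open>e0\<close> as a mere placeholder, whether or not they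
    divide Q(n); this is consistent because non-divisibility is demanded only up to t, and t <
    \<open>s n\<close>.\<close>
  define \<nu> where "\<nu> n = (\<lambda>p\<in>?P. if p < s n then val p n else e0)" for n
  define a where "a v = (\<Prod>p\<in>?P. p ^ esum (v p))" for v :: "nat \<Rightarrow> nat \<Rightarrow> nat"
  define S where "S v = {n :: int. x < n \<and> n \<le> x + y \<and> (\<forall>p\<in>?P. v p \<noteq> e0 \<longrightarrow> vcond p (v p) n) \<and>
       (\<forall>p\<in>primes_le t. v p = e0 \<longrightarrow> \<not> int p dvd poly Qp n)}" for v
  define V where "V = {v \<in> PiE ?P (\<lambda>_. EN N). Y \<le> real (a v) \<and> real (a v) ^ 4 \<le> y \<and>
       (\<forall>j\<in>{1..r}. (\<Sum>p\<in>?P. f j (p ^ v p j)) = k j)}"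
  have finPi: "finite (PiE ?P (\<lambda>_. EN N))" by (intro finite_PiE) auto
  have finV: "finite V" unfolding V_def using finPi by simp
  have ps: "{p. prime p \<and> p < s n} = {p\<in>?P. p < s n}" if n: "n \<in> Nn" for n
  proof -
    \<comment> \<open>The smooth part takes primes strictly below \<open>s n\<close>, so
      \<open>s n\<close> may be as large as T + 1.\<close>
    have "real p \<le> T" if "p < s n" for p using s(2)[OF n] that by linarith
    thus ?thesis by (auto simp: primes_le_def)
  qed
  have \<nu>V: "\<nu> n \<in> V" if n: "n \<in> Nn" for n
  proof -
    have av: "a (\<nu> n) = smooth_part (s n) n"
    proof -
      have "a (\<nu> n) = (\<Prod>p\<in>?P. if p < s n then p ^ esum (val p n) else 1)"
        unfolding a_def \<nu>_def by (intro prod.cong) (auto simp: esum_e0)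
      also have "\<dots> = (\<Prod>p\<in>{p\<in>?P. p < s n}. p ^ esum (val p n))"
        by (rule prod.inter_filter[symmetric]) auto
      finally show ?thesis unfolding smooth_part_def ps[OF n] .
    qed
    have kv: "(\<Sum>p\<in>?P. f j (p ^ \<nu> n p j)) = k j" if j: "j \<in> {1..r}" for j
    proof -
      have "(\<Sum>p\<in>?P. f j (p ^ \<nu> n p j)) = (\<Sum>p\<in>?P. if p < s n then f j (p ^ val p n j) else 0)"
        unfolding \<nu>_def using j f1[OF j] by (intro sum.cong) (auto simp: e0_def)
      also have "\<dots> = (\<Sum>p\<in>{p\<in>?P. p < s n}. f j (p ^ val p n j))"
        by (rule sum.inter_filter[symmetric]) auto
      finally show ?thesis using s(5)[OF n j] unfolding ps[OF n] by simp
    qed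
    have sp1: "smooth_part (s n) n \<ge> 1" unfolding smooth_part_def
      by (intro prod_ge_1) (auto simp: Suc_le_eq prime_gt_0_nat)
    have spy: "real (smooth_part (s n) n) \<le> y"
    proof -
      have "real (smooth_part (s n) n) ^ 1 \<le> real (smooth_part (s n) n) ^ 4" using sp1 by (intro power_increasing) auto
      thus ?thesis using s(4)[OF n] unfolding power_one_right by linarith
    qed
    have "\<nu> n p \<in> EN N" if p: "p \<in> ?P" for p
    proof (cases "p < s n")
      case True
      have p': "prime p" "p \<ge> 2" using p by (auto dest: primes_leD)
      have fin: "finite {p. prime p \<and> p < s n}" unfolding ps[OF n] by simp
      have "p ^ esum (val p n) dvd smooth_part (s n) n"
        unfolding smooth_part_def using p' True fin by (intro dvd_prodI) auto
      hence "p ^ esum (val p n) \<le> smooth_part (s n) n" using sp1 by (intro dvd_imp_le) auto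
      moreover have "esum (val p n) < p ^ esum (val p n)"
        using p' by (meson less_exp order_less_le_trans power_mono zero_le)
      ultimately have "real (esum (val p n)) \<le> y" using spy by linarith
      hence "esum (val p n) \<le> N" unfolding N_def by linarith
      hence "val p n j \<le> N" if "j \<in> {1..r}" for j using esum_ge[OF that, of "val p n"] by linarith
      hence "val p n \<in> EN N" unfolding EN_def by (intro PiE_I) (auto simp: val_def)
      thus ?thesis using p True by (simp add: \<nu>_def)
    next
      case False
      thus ?thesis using p e0_EN by (simp add: \<nu>_def)
    qed
    hence "\<nu> n \<in> PiE ?P (\<lambda>_. EN N)"
    proof (rule PiE_I)
      show "\<nu> n p = undefined" if "p \<notin> ?P" for p using that by (simp only: \<nu>_def restrict_apply if_False)
    qed
    moreover have "Y \<le> real (a (\<nu> n))" "real (a (\<nu> n)) ^ 4 \<le> y" using s(3,4)[OF n] unfolding av by blast+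
    ultimately show ?thesis unfolding V_def using kv by blast
  qed
  have nS: "n \<in> S (\<nu> n)" if n: "n \<in> Nn" for n
  proof -
    have \<nu>_val: "\<nu> n p = (if p < s n then val p n else e0)" if "p \<in> ?P" for p using that by (simp add: \<nu>_def)
    have "vcond p (\<nu> n p) n" if p: "p \<in> ?P" "\<nu> n p \<noteq> e0" for p
    proof -
      have "\<nu> n p = val p n" using p(2) \<nu>_val[OF p(1)] by presburger
      thus ?thesis using vcond_val[OF primes_leD(1)[OF p(1)] Nn(3)[OF n]] by (simp only:)
    qed
    moreover have "\<not> int p dvd poly Qp n" if p: "p \<in> primes_le t" "\<nu> n p = e0" for p
    proof -
      have "p < s n" using s(1)[OF n] primes_leD(2)[OF p(1)] by linarith
      hence "val p n = e0" using p \<nu>_val[of p] primes_le_mono[OF t(3)] by (metis subsetD)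
      thus ?thesis by (rule val_eq_e0[OF primes_leD(1)[OF p(1)] Nn(3)[OF n]])
    qed
    ultimately show ?thesis using Nn(1,2)[OF n] by (simp add: S_def)
  qed
  have finS: "finite (S v)" for v
    by (rule finite_subset[of _ "{\<lfloor>x\<rfloor>..\<lceil>x+y\<rceil>}"]) (auto simp: S_def floor_le_iff le_ceiling_iff)
  have "Nn \<subseteq> (\<Union>v\<in>V. S v)" using nS \<nu>V by blast
  hence "card Nn \<le> card (\<Union>v\<in>V. S v)" using finV finS by (intro card_mono) auto
  also have "\<dots> \<le> (\<Sum>v\<in>V. card (S v))" using finV by (rule card_UN_le)
  finally have "real (card Nn) \<le> (\<Sum>v\<in>V. real (card (S v)))" by (simp flip: of_nat_sum)
  also have "\<dots> \<le> (\<Sum>v\<in>V. 4 * exp (8 * real g) * y * Y powr (-\<sigma>) * (\<Prod>p\<in>?P. W \<sigma> p (v p)))"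
  proof (rule sum_mono)
    fix v assume v: "v \<in> V"
    have vPi: "v \<in> PiE ?P (\<lambda>_. EN N)" and vY: "Y \<le> real (a v)" and vy: "real (a v) ^ 4 \<le> y"
      using v by (auto simp: V_def)
    have "real (card (S v)) \<le> 4 * exp (8 * real g) * y * (\<Prod>p\<in>?P. wd p (v p))"
      unfolding S_def by (rule card_local_conditions_le[OF t Qb vPi]) (use vy in \<open>simp add: a_def\<close>)
    also have "\<dots> \<le> 4 * exp (8 * real g) * y * (Y powr (-\<sigma>) * (\<Prod>p\<in>?P. W \<sigma> p (v p)))"
    proof (rule mult_left_mono)
      have a0: "real (a v) > 0" using Y vY by linarith
      have "(\<Prod>p\<in>?P. W \<sigma> p (v p)) = (\<Prod>p\<in>?P. wd p (v p)) * (\<Prod>p\<in>?P. (real p ^ esum (v p)) powr \<sigma>)"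
      proof -
        have "real p powr (\<sigma> * real (esum (v p))) = (real p ^ esum (v p)) powr \<sigma>" if p: "p \<in> ?P" for p
        proof -
          have "real p > 0" using primes_leD(3)[OF p] by simp
          hence "real p ^ esum (v p) = real p powr real (esum (v p))" by (simp add: powr_realpow)
          thus ?thesis by (simp add: powr_powr mult.commute)
        qed
        hence "(\<Prod>p\<in>?P. real p powr (\<sigma> * real (esum (v p)))) = (\<Prod>p\<in>?P. (real p ^ esum (v p)) powr \<sigma>)"
          by (intro prod.cong) auto
        thus ?thesis unfolding W_def prod.distrib by simp
      qed
      also have "(\<Prod>p\<in>?P. (real p ^ esum (v p)) powr \<sigma>) = real (a v) powr \<sigma>"
        unfolding a_def by (simp add: prod_powr_distrib)
      finally have W: "(\<Prod>p\<in>?P. W \<sigma> p (v p)) = (\<Prod>p\<in>?P. wd p (v p)) * real (a v) powr \<sigma>" .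
      \<comment> \<open>Rankin's trick; the factor \<open>real (a v) powr \<sigma>\<close> is what
        turns the weights \<open>wd\<close> into \<open>W \<sigma>\<close>.\<close>
      have "1 \<le> (real (a v) / Y) powr \<sigma>" using vY Y \<sigma> by (intro ge_one_powr_ge_zero) auto
      also have "\<dots> = Y powr (-\<sigma>) * real (a v) powr \<sigma>" using Y a0 by (simp add: powr_divide powr_minus field_simps)
      finally have "(\<Prod>p\<in>?P. wd p (v p)) * 1 \<le> (\<Prod>p\<in>?P. wd p (v p)) * (Y powr (-\<sigma>) * real (a v) powr \<sigma>)"
        by (intro mult_left_mono prod_nonneg) auto
      thus "(\<Prod>p\<in>?P. wd p (v p)) \<le> Y powr (-\<sigma>) * (\<Prod>p\<in>?P. W \<sigma> p (v p))" unfolding W by (simp add: mult_ac)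
    qed (use y1 in auto)
    finally show "real (card (S v)) \<le> 4 * exp (8 * real g) * y * Y powr (-\<sigma>) * (\<Prod>p\<in>?P. W \<sigma> p (v p))" by (simp add: mult_ac)
  qed
  also have "\<dots> = 4 * exp (8 * real g) * y * Y powr (-\<sigma>) * (\<Sum>v\<in>V. \<Prod>p\<in>?P. W \<sigma> p (v p))"
    by (simp add: sum_distrib_left)
  also have "\<dots> \<le> 4 * exp (8 * real g) * y * Y powr (-\<sigma>) * (massC b * (\<Prod>j=1..r. 60 * massB b / sqrt (1 + Esum (f j) j T)))"
  proof (rule mult_left_mono)
    have "(\<Sum>v\<in>V. \<Prod>p\<in>?P. W \<sigma> p (v p)) \<le>
      (\<Sum>v\<in>{v \<in> PiE ?P (\<lambda>_. EN N). \<forall>j\<in>{1..r}. (\<Sum>p\<in>?P. f j (p ^ v p j)) = k j}. \<Prod>p\<in>?P. W \<sigma> p (v p))"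
      using finPi by (intro sum_mono2 prod_nonneg) (auto simp: V_def W_def)
    also have "\<dots> \<le> massC b * (\<Prod>j=1..r. 60 * massB b / sqrt (1 + Esum (f j) j T))"
      using t f1 \<sigma> by (intro tuple_concentration) (auto simp: N_def)
    finally show "(\<Sum>v\<in>V. \<Prod>p\<in>?P. W \<sigma> p (v p)) \<le> massC b * (\<Prod>j=1..r. 60 * massB b / sqrt (1 + Esum (f j) j T))" .
  qed (use y1 in auto)
  also have "\<dots> = blockC b * y * Y powr (-\<sigma>) * (\<Prod>j=1..r. 1 / sqrt (1 + Esum (f j) j T))"
  proof -
    have "(\<Prod>j=1..r. 60 * massB b / sqrt (1 + Esum (f j) j T)) = (60 * massB b) ^ r * (\<Prod>j=1..r. 1 / sqrt (1 + Esum (f j) j T))"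
      unfolding prod_dividef by simp
    thus ?thesis by (simp add: blockC_def mult_ac)
  qed
  finally show ?thesis .
qed

end

section \<open>From smooth parts to additive functions\<close>

lemma multiplicity_nat_abs:
  fixes q :: int and p :: nat
  assumes "prime p" "q \<noteq> 0"
  shows "multiplicity (int p) q = multiplicity p (nat \<bar>q\<bar>)"
proof (rule multiplicity_eqI)
  have nu: "\<not> is_unit p" using assms(1) by auto
  have nz: "nat \<bar>q\<bar> \<noteq> 0" using assms(2) by simp
  have iff: "int p ^ k dvd q \<longleftrightarrow> p ^ k dvd nat \<bar>q\<bar>" for k
  proof -
    have "int p ^ k dvd q \<longleftrightarrow> int (p ^ k) dvd int (nat \<bar>q\<bar>)" by simp
    thus ?thesis by (simp only: int_dvd_int_iff)
  qed
  show "int p ^ multiplicity p (nat \<bar>q\<bar>) dvd q" unfolding iff by (rule multiplicity_dvd)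
  show "\<not> int p ^ Suc (multiplicity p (nat \<bar>q\<bar>)) dvd q"
    unfolding iff using power_dvd_iff_le_multiplicity[OF nz nu, of "Suc (multiplicity p (nat \<bar>q\<bar>))"] by simp
qed

lemma smooth_rough_factorization:
  fixes m s :: nat
  assumes m: "m \<ge> 1"
  obtains b where "m = (\<Prod>p | prime p \<and> p < s. p ^ multiplicity p m) * b" "b \<ge> 1"
    "coprime (\<Prod>p | prime p \<and> p < s. p ^ multiplicity p m) b"
    "\<And>p. prime p \<Longrightarrow> p dvd b \<Longrightarrow> p \<ge> s"
proof -
  let ?P = "{p. prime p \<and> p < s}"
  have finP: "finite ?P" by simp
  have dvd: "(\<Prod>p\<in>A. p ^ multiplicity p m) dvd m" if "finite A" "\<And>p. p \<in> A \<Longrightarrow> prime p" for A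
    using that
  proof (induction A rule: finite_induct)
    case (insert p A)
    have "coprime (p ^ multiplicity p m) (\<Prod>q\<in>A. q ^ multiplicity q m)"
    proof (rule prod_coprime_right)
      fix q assume "q \<in> A"
      hence "coprime p q" using insert by (intro primes_coprime) auto
      thus "coprime (p ^ multiplicity p m) (q ^ multiplicity q m)" by simp
    qed
    thus ?case using insert by (simp add: divides_mult multiplicity_dvd)
  qed auto
  define a where "a = (\<Prod>p\<in>?P. p ^ multiplicity p m)"
  have "a dvd m" unfolding a_def by (rule dvd) auto
  then obtain b where b: "m = a * b" by (elim dvdE)
  have b1: "b \<ge> 1" using m b by (cases b) auto
  have rough: "p \<ge> s" if p: "prime p" "p dvd b" for p
  proof (rule ccontr)
    assume "\<not> p \<ge> s"
    hence "p ^ multiplicity p m dvd a" unfolding a_def using p(1) by (intro dvd_prodI) auto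
    hence "p ^ multiplicity p m * p dvd a * b" using p(2) by (rule mult_dvd_mono)
    hence d: "p ^ Suc (multiplicity p m) dvd m" using b by (simp add: mult.commute)
    have "m \<noteq> 0" "\<not> is_unit p" using m p(1) by auto
    from power_dvd_iff_le_multiplicity[OF this, of "Suc (multiplicity p m)"] d show False by simp
  qed
  have cop: "coprime a b"
  proof (rule ccontr)
    assume "\<not> coprime a b"
    hence "gcd a b \<noteq> 1" by (simp add: coprime_iff_gcd_eq_1)
    then obtain p where "prime p" "p dvd gcd a b" using prime_factor_nat by blast
    hence p: "prime p" "p dvd a" "p dvd b" by simp_all
    then obtain q where "q \<in> ?P" "p dvd q ^ multiplicity q m"
      unfolding a_def using finP by (auto simp: prime_dvd_prod_iff)
    hence "p dvd q" "prime q" "q < s" using p(1) prime_dvd_power by blast+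
    hence "p < s" using p(1) primes_dvd_imp_eq by blast
    thus False using rough[OF p(1,3)] by simp
  qed
  show ?thesis using that[of b] b b1 cop rough unfolding a_def by blast
qed

lemma additive_fun_1: "additive_fun f \<Longrightarrow> f 1 = 0"
  unfolding additive_fun_def using coprime_1_left[of 1] by (metis add_cancel_right_left le_refl mult_1)

lemma additive_fun_prod:
  assumes f: "additive_fun f" and "finite A" "\<And>p. p \<in> A \<Longrightarrow> prime p"
  shows "f (\<Prod>p\<in>A. p ^ e p) = (\<Sum>p\<in>A. f (p ^ e p))"
  using assms(2,3)
proof (induction A rule: finite_induct)
  case empty
  thus ?case using additive_fun_1[OF f] by simp
next
  case (insert p A)
  have "coprime (p ^ e p) (\<Prod>q\<in>A. q ^ e q)"
  proof (rule prod_coprime_right)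
    fix q assume "q \<in> A"
    hence "coprime p q" using insert by (intro primes_coprime) auto
    thus "coprime (p ^ e p) (q ^ e q)" by simp
  qed
  moreover have "p ^ e p \<ge> 1" "(\<Prod>q\<in>A. q ^ e q) \<ge> 1"
    using insert by (auto intro!: prod_ge_1 simp: Suc_le_eq prime_gt_0_nat)
  ultimately have "f (p ^ e p * (\<Prod>q\<in>A. q ^ e q)) = f (p ^ e p) + f (\<Prod>q\<in>A. q ^ e q)"
    using f unfolding additive_fun_def by blast
  thus ?case using insert by simp
qed

lemma least_prime_factor_gt:
  assumes b: "b \<ge> 1" and rough: "\<And>p. prime p \<Longrightarrow> p dvd b \<Longrightarrow> p \<ge> s" and t: "t < real s"
  shows "least_prime_factor b > ereal t"
proof -
  have "ereal (real s) \<le> least_prime_factor b"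
    unfolding least_prime_factor_def using rough by (intro INF_greatest) auto
  moreover have "ereal t < ereal (real s)" using t by simp
  ultimately show ?thesis by (rule less_le_trans[rotated])
qed

lemma abs_poly_le:
  fixes q :: "int poly"
  assumes n: "n \<ge> 1"
  shows "\<bar>poly q n\<bar> \<le> (int (degree q) + 1) * poly_height q * n ^ degree q"
proof -
  have "\<bar>poly q n\<bar> \<le> (\<Sum>i\<le>degree q. \<bar>coeff q i * n ^ i\<bar>)" unfolding poly_altdef by (rule sum_abs)
  also have "\<dots> \<le> (\<Sum>i\<le>degree q. poly_height q * n ^ degree q)"
  proof (rule sum_mono)
    fix i assume i: "i \<in> {..degree q}"
    have "\<bar>coeff q i\<bar> \<le> poly_height q" unfolding poly_height_def using i by (intro Max_ge) auto
    moreover have "n ^ i \<le> n ^ degree q" using i n by (intro power_increasing) auto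
    ultimately have "\<bar>coeff q i\<bar> * n ^ i \<le> poly_height q * n ^ degree q" using n by (intro mult_mono) auto
    thus "\<bar>coeff q i * n ^ i\<bar> \<le> poly_height q * n ^ degree q" using n by (simp add: abs_mult)
  qed
  also have "\<dots> = (int (degree q) + 1) * poly_height q * n ^ degree q" by (simp add: algebra_simps)
  finally show ?thesis .
qed

lemma finite_int_interval [simp]: "finite {n :: int. x < real_of_int n \<and> real_of_int n \<le> y \<and> P n}"
  by (rule finite_subset[of _ "{\<lfloor>x\<rfloor>..\<lceil>y\<rceil>}"]) (auto simp: floor_le_iff le_ceiling_iff)

lemma poly_height_ge_1:
  assumes "q \<noteq> 0"
  shows "poly_height q \<ge> 1"
proof -
  have "\<bar>lead_coeff q\<bar> \<le> poly_height q" unfolding poly_height_def by (intro Max_ge) auto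
  moreover have "\<bar>lead_coeff q\<bar> \<ge> 1" using assms by (metis abs_ge_zero leading_coeff_0_iff zero_less_abs_iff int_one_le_iff_zero_less)
  ultimately show ?thesis by linarith
qed

context poly_fam
begin

text \<open>The hypothesis on the height makes it at most x^(1/\<delta>); the power x^g and the
  constant (g + 1) 2^g, absorbed in one more x, account for the rest of the exponent.\<close>

lemma abs_Qp_le:
  assumes x: "x \<ge> 1" "real (g + 1) * 2 ^ g \<le> x" and \<delta>: "\<delta> > 0"
    and h: "real_of_int (poly_height Qp) powr \<delta> \<le> x"
    and n: "x < real_of_int n" "real_of_int n \<le> 2 * x"
  shows "real_of_int \<bar>poly Qp n\<bar> \<le> x powr (1 + real g + 1 / \<delta>)"
proof -
  have n1: "n \<ge> 1" using x(1) n(1) by linarith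
  have h1: "real_of_int (poly_height Qp) \<ge> 1" using poly_height_ge_1[OF Qp_nz] by simp
  have "real_of_int (poly_height Qp) = (real_of_int (poly_height Qp) powr \<delta>) powr (1 / \<delta>)"
    using \<delta> h1 by (simp add: powr_powr)
  also have "\<dots> \<le> x powr (1 / \<delta>)" using h \<delta> by (intro powr_mono2) auto
  finally have hx: "real_of_int (poly_height Qp) \<le> x powr (1 / \<delta>)" .
  have "real_of_int \<bar>poly Qp n\<bar> \<le> real_of_int ((int g + 1) * poly_height Qp * n ^ g)"
    using abs_poly_le[OF n1, of Qp] unfolding degQp by (simp only: of_int_le_iff)
  also have "\<dots> = real (g + 1) * real_of_int (poly_height Qp) * real_of_int n ^ g" by simp
  also have "\<dots> \<le> real (g + 1) * x powr (1 / \<delta>) * (2 * x) ^ g"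
    using hx h1 n n1 by (intro mult_mono power_mono) auto
  also have "\<dots> = (real (g + 1) * 2 ^ g) * (x powr (1 / \<delta>) * x powr real g)"
    using x by (simp add: power_mult_distrib powr_realpow)
  also have "\<dots> \<le> x powr 1 * (x powr (1 / \<delta>) * x powr real g)"
    using x by (intro mult_right_mono) auto
  also have "\<dots> = x powr (1 + real g + 1 / \<delta>)" by (simp only: powr_add mult_ac)
  finally show ?thesis .
qed

lemma abs_Q_le_abs_Qp:
  assumes "poly Qp n \<noteq> 0" "j \<in> {1..r}"
  shows "\<bar>poly (Q j) n\<bar> \<le> \<bar>poly Qp n\<bar>"
proof -
  have "poly (Q j) n dvd poly Qp n" unfolding poly_Qp using assms(2) by (intro dvd_prodI) auto
  thus ?thesis using assms(1) by (rule dvd_imp_le_int[rotated])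
qed

text \<open>Additivity splits \<open>f\<close> over the coprime smooth and rough parts of
  \<open>Q_j(n)\<close>. The rough part has all its primes at least s > t and is at most
  \<open>t powr u\<close>, so it falls under the counting hypothesis.\<close>

lemma value_decomposition:
  assumes f: "additive_fun f" and n: "poly Qp n \<noteq> 0" and j: "j \<in> {1..r}" and t: "t < real s"
    and u: "real_of_int \<bar>poly Qp n\<bar> \<le> t powr u"
  shows "\<exists>v \<in> f ` {m. m \<ge> 1 \<and> real m \<le> t powr u \<and> least_prime_factor m > ereal t}.
    ext_even f (poly (Q j) n) = (\<Sum>p | prime p \<and> p < s. f (p ^ val p n j)) + v"
proof -
  have nz: "poly (Q j) n \<noteq> 0" using n j by (auto simp: poly_Qp)
  define m where "m = nat \<bar>poly (Q j) n\<bar>"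
  have m1: "m \<ge> 1" using nz by (simp add: m_def)
  obtain b where b: "m = (\<Prod>p | prime p \<and> p < s. p ^ multiplicity p m) * b" "b \<ge> 1"
    "coprime (\<Prod>p | prime p \<and> p < s. p ^ multiplicity p m) b" "\<And>p. prime p \<Longrightarrow> p dvd b \<Longrightarrow> p \<ge> s"
    using smooth_rough_factorization[OF m1, of s] by blast
  let ?a = "\<Prod>p | prime p \<and> p < s. p ^ multiplicity p m"
  have a1: "?a \<ge> 1" by (intro prod_ge_1) (auto simp: Suc_le_eq prime_gt_0_nat)
  have "f m = f (?a * b)" using b(1) by (rule arg_cong)
  also have "\<dots> = f ?a + f b" using f a1 b(2,3) unfolding additive_fun_def by blast
  also have "f ?a = (\<Sum>p | prime p \<and> p < s. f (p ^ multiplicity p m))"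
    by (rule additive_fun_prod[OF f]) auto
  also have "\<dots> = (\<Sum>p | prime p \<and> p < s. f (p ^ val p n j))"
    using j nz by (intro sum.cong) (auto simp: val_def m_def multiplicity_nat_abs)
  finally have fm: "f m = (\<Sum>p | prime p \<and> p < s. f (p ^ val p n j)) + f b" .
  have "b dvd m" using b(1) by (metis dvd_triv_right)
  hence "b \<le> m" using m1 by (intro dvd_imp_le) auto
  hence "real b \<le> real m" by simp
  also have "real m = real_of_int \<bar>poly (Q j) n\<bar>" by (simp add: m_def)
  also have "\<dots> \<le> real_of_int \<bar>poly Qp n\<bar>" using abs_Q_le_abs_Qp[OF n j] by (simp only: of_int_le_iff)
  also note u
  finally have "real b \<le> t powr u" .
  moreover have "least_prime_factor b > ereal t" by (rule least_prime_factor_gt[OF b(2,4) t])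
  ultimately have "b \<in> {m. m \<ge> 1 \<and> real m \<le> t powr u \<and> least_prime_factor m > ereal t}" using b(2) by simp
  moreover have "ext_even f (poly (Q j) n) = f m" using nz by (simp add: ext_even_def m_def)
  ultimately show ?thesis using fm by (intro bexI[of _ "f b"] imageI) simp_all
qed

text \<open>The values at the rough parts are unknown, but there are at most
  \<open>(real V powr u) ^ r\<close> tuples v of them. For each tuple the smooth parts must sum to
  the shifted targets \<open>k j - v j\<close>, and \<open>block_count\<close> is uniform in the
  targets.\<close>

theorem block_count_additive:
  fixes x y t T Qb Y \<sigma> b z u :: real and f :: "nat \<Rightarrow> nat \<Rightarrow> real" and k :: "nat \<Rightarrow> real"
  assumes t: "t \<ge> 2" "t \<ge> 2 * real g" "T \<ge> t" "T \<le> t ^ 2"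
    and Qb: "Qb \<ge> 1" "Qb ^ 6 \<le> sqrt y" "ln Qb \<ge> (6 * real (g * (g + 1)) + 1) * ln t"
    and f: "\<And>j. j \<in> {1..r} \<Longrightarrow> additive_fun (f j)" "\<And>j. j \<in> {1..r} \<Longrightarrow> value_count_bound V z (f j)"
    and z: "t \<ge> z" and u: "u \<ge> 1"
    and \<sigma>: "\<sigma> \<ge> 0" "\<sigma> \<le> 1 / (4 * real g)" "\<sigma> * ln T \<le> b" and Y: "Y > 0"
    and Nn: "\<And>n. n \<in> Nn \<Longrightarrow> x < real_of_int n" "\<And>n. n \<in> Nn \<Longrightarrow> real_of_int n \<le> x + y"
       "\<And>n. n \<in> Nn \<Longrightarrow> poly Qp n \<noteq> 0" "\<And>n. n \<in> Nn \<Longrightarrow> real_of_int \<bar>poly Qp n\<bar> \<le> t powr u"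
    and s: "\<And>n. n \<in> Nn \<Longrightarrow> t < real (s n)" "\<And>n. n \<in> Nn \<Longrightarrow> real (s n) \<le> T + 1"
       "\<And>n. n \<in> Nn \<Longrightarrow> Y \<le> real (smooth_part (s n) n)" "\<And>n. n \<in> Nn \<Longrightarrow> real (smooth_part (s n) n) ^ 4 \<le> y"
    and k: "\<And>n j. n \<in> Nn \<Longrightarrow> j \<in> {1..r} \<Longrightarrow> ext_even (f j) (poly (Q j) n) = k j"
  shows "real (card Nn) \<le> (real V powr u) ^ r * (blockC b * y * Y powr (-\<sigma>) * (\<Prod>j=1..r. 1 / sqrt (1 + Esum (f j) j T)))"
proof -
  define F where "F j = f j ` {m. m \<ge> 1 \<and> real m \<le> t powr u \<and> least_prime_factor m > ereal t}" for j
  have finF: "finite (F j)" for j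
  proof -
    have "finite {m::nat. m \<ge> 1 \<and> real m \<le> t powr u \<and> least_prime_factor m > ereal t}"
      by (rule finite_subset[of _ "{..nat \<lfloor>t powr u\<rfloor>}"]) (auto intro: le_nat_floor)
    thus ?thesis by (simp add: F_def)
  qed
  have cF: "real (card (F j)) \<le> real V powr u" if "j \<in> {1..r}" for j
    using f(2)[OF that] z u unfolding value_count_bound_def F_def by blast
  define RHS where "RHS = blockC b * y * Y powr (-\<sigma>) * (\<Prod>j=1..r. 1 / sqrt (1 + Esum (f j) j T))"
  let ?G = "PiE {1..r} F"
  define Nv where "Nv v = {n \<in> Nn. \<forall>j\<in>{1..r}. (\<Sum>p | prime p \<and> p < s n. f j (p ^ val p n j)) = k j - v j}" for v
  have finNn: "finite Nn"
    by (rule finite_subset[of _ "{n. x < real_of_int n \<and> real_of_int n \<le> x + y \<and> True}"]) (use Nn in blast, rule finite_int_interval)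
  have finG: "finite ?G" using finF by (intro finite_PiE) auto
  have "Nn \<subseteq> (\<Union>v\<in>?G. Nv v)"
  proof
    fix n assume n: "n \<in> Nn"
    have "\<forall>j\<in>{1..r}. \<exists>v. v \<in> F j \<and> ext_even (f j) (poly (Q j) n) = (\<Sum>p | prime p \<and> p < s n. f j (p ^ val p n j)) + v"
    proof
      fix j assume j: "j \<in> {1..r}"
      show "\<exists>v. v \<in> F j \<and> ext_even (f j) (poly (Q j) n) = (\<Sum>p | prime p \<and> p < s n. f j (p ^ val p n j)) + v"
        using value_decomposition[OF f(1)[OF j] Nn(3)[OF n] j s(1)[OF n] Nn(4)[OF n]] unfolding F_def by blast
    qed
    from bchoice[OF this] obtain v where v: "\<And>j. j \<in> {1..r} \<Longrightarrow> v j \<in> F j"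
      "\<And>j. j \<in> {1..r} \<Longrightarrow> ext_even (f j) (poly (Q j) n) = (\<Sum>p | prime p \<and> p < s n. f j (p ^ val p n j)) + v j" by blast
    have "restrict v {1..r} \<in> ?G" using v(1) by (simp add: restrict_PiE_iff)
    moreover have "n \<in> Nv (restrict v {1..r})"
    proof -
      have "(\<Sum>p | prime p \<and> p < s n. f j (p ^ val p n j)) = k j - restrict v {1..r} j" if j: "j \<in> {1..r}" for j
        using v(2)[OF j] k[OF n j] j by simp
      thus ?thesis using n by (simp add: Nv_def)
    qed
    ultimately show "n \<in> (\<Union>v\<in>?G. Nv v)" by blast
  qed
  moreover have "finite (Nv v)" for v using finNn by (simp add: Nv_def)
  ultimately have "card Nn \<le> card (\<Union>v\<in>?G. Nv v)" using finG by (intro card_mono) auto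
  also have "\<dots> \<le> (\<Sum>v\<in>?G. card (Nv v))" using finG by (rule card_UN_le)
  finally have "real (card Nn) \<le> (\<Sum>v\<in>?G. real (card (Nv v)))" by (simp flip: of_nat_sum)
  also have "\<dots> \<le> real (card ?G) * RHS"
  proof (rule sum_bounded_above)
    fix v
    show "real (card (Nv v)) \<le> RHS" unfolding RHS_def
    proof (rule block_count[OF t Qb _ \<sigma> Y, where s = s and k = "\<lambda>j. k j - v j"])
      show "f j 1 = 0" if "j \<in> {1..r}" for j using additive_fun_1[OF f(1)[OF that]] .
    qed (use Nn s in \<open>auto simp: Nv_def\<close>)
  qed
  also have "\<dots> \<le> (real V powr u) ^ r * RHS"
  proof (rule mult_right_mono)
    have "real (card ?G) = (\<Prod>j\<in>{1..r}. real (card (F j)))" by (simp add: card_PiE)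
    also have "\<dots> \<le> (\<Prod>j\<in>{1..r}. real V powr u)" using cF by (intro prod_mono) auto
    finally show "real (card ?G) \<le> (real V powr u) ^ r" by simp
    \<comment> \<open>The bound applied to the empty set yields that it is nonnegative.\<close>
    have "real (card ({} :: int set)) \<le> RHS" unfolding RHS_def
    proof (rule block_count[OF t Qb _ \<sigma> Y, where s = s and k = k])
      show "f j 1 = 0" if "j \<in> {1..r}" for j using additive_fun_1[OF f(1)[OF that]] .
    qed auto
    thus "0 \<le> RHS" by simp
  qed
  finally show ?thesis unfolding RHS_def .
qed

end

section \<open>Comparison of the sums over good primes up to T with E\<close>

lemma sum_Un_le:
  fixes h :: "'a \<Rightarrow> real"
  assumes "finite A" "finite B" "\<And>x. x \<in> A \<Longrightarrow> h x \<ge> 0"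
  shows "sum h (A \<union> B) \<le> sum h A + sum h B"
proof -
  have "sum h (A \<union> B) + sum h (A \<inter> B) = sum h A + sum h B" using assms(1,2) by (rule sum.union_inter)
  moreover have "sum h (A \<inter> B) \<ge> 0" using assms(3) by (intro sum_nonneg) auto
  ultimately show ?thesis by linarith
qed

context poly_fam
begin

text \<open>The cost of discarding the primes that divide \<beta>D. By 1 - u \<le> exp(-u) its
  exponential is at most \<beta>D / \<phi>_0(\<beta>D), which is the source of that factor in the
  theorem.\<close>

definition Lsum :: real where "Lsum = (\<Sum>p | prime p \<and> p dvd N0. real (rho0 p) / real p)"

lemma finite_prime_divisors_N0: "finite {p. prime p \<and> p dvd N0}"
  by (rule finite_subset[of _ "{..N0}"]) (use N0_pos in \<open>auto dest: dvd_imp_le\<close>)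

lemma Lsum_nonneg: "Lsum \<ge> 0"
  unfolding Lsum_def by (intro sum_nonneg) auto

lemma exp_Lsum_le:
  assumes nz: "phi_roots Qp N0 \<noteq> 0"
  shows "phi_roots Qp N0 > 0" "exp Lsum \<le> real N0 / phi_roots Qp N0"
proof -
  let ?P = "{p. prime p \<and> p dvd N0}"
  define PP where "PP = (\<Prod>p\<in>?P. 1 - real (rho0 p) / real p)"
  have phi: "phi_roots Qp N0 = real N0 * PP" by (simp add: phi_roots_def PP_def rho0_def)
  have le1: "real (rho0 p) / real p \<le> 1" if "p \<in> ?P" for p
  proof -
    have "rho0 p \<le> p" unfolding rho0_def num_roots_mod_eq_pcount by (rule pcount_le)
    thus ?thesis by (auto simp: divide_le_eq_1)
  qed
  have "PP \<ge> 0" unfolding PP_def using le1 by (intro prod_nonneg) auto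
  moreover have "PP \<noteq> 0" using nz phi by auto
  ultimately have pos: "PP > 0" by simp
  thus "phi_roots Qp N0 > 0" unfolding phi using N0_pos by simp
  have "PP \<le> (\<Prod>p\<in>?P. exp (- (real (rho0 p) / real p)))" unfolding PP_def
  proof (rule prod_mono)
    fix p assume p: "p \<in> ?P"
    show "0 \<le> 1 - real (rho0 p) / real p \<and> 1 - real (rho0 p) / real p \<le> exp (- (real (rho0 p) / real p))"
      using le1[OF p] exp_ge_add_one_self[of "- (real (rho0 p) / real p)"] by simp
  qed
  also have "\<dots> = exp (- Lsum)"
    unfolding Lsum_def sum_negf[symmetric] by (rule exp_sum[OF finite_prime_divisors_N0, symmetric])
  finally have "exp Lsum * PP \<le> exp Lsum * exp (- Lsum)" by (intro mult_left_mono) auto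
  hence "exp Lsum * PP \<le> 1" by (simp add: exp_minus)
  hence "exp Lsum \<le> 1 / PP" using pos by (simp add: le_divide_eq)
  also have "1 / PP = real N0 / phi_roots Qp N0" unfolding phi using N0_pos by simp
  finally show "exp Lsum \<le> real N0 / phi_roots Qp N0" .
qed

text \<open>Three groups of primes separate E from \<open>Esum\<close>: those up to 2g, contributing
  at most 1 each; those dividing \<beta>D, contributing \<open>Lsum\<close> at most; and those
  between T and x, for which the hypothesis on M_j is used at both ends, hence
  \<open>2 * m\<close>.\<close>

lemma E_sum_le:
  assumes j: "j \<in> {1..r}" and T: "2 \<le> T" "T \<le> x"
    and M: "\<And>x::real. x \<ge> 2 \<Longrightarrow> \<bar>(\<Sum>p | prime p \<and> real p \<le> x. real (num_roots_mod (Q j) p) / real p) - ln (ln x)\<bar> \<le> m"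
  shows "E_sum f (\<lambda>p. real (num_roots_mod (Q j) p)) x \<le>
     (1 + Esum f j T) + 2 * real g + Lsum + ln (ln x / ln T) + 2 * m"
proof -
  let ?h = "\<lambda>p. real (rho j p) / real p"
  let ?A = "{p \<in> good T. f p \<noteq> 0}" and ?B = "{p. prime p \<and> p \<le> 2 * g}" and ?C = "{p. prime p \<and> p dvd N0}"
    and ?D = "primes_le x - primes_le T"
  have h0: "?h p \<ge> 0" for p by simp
  have fin: "finite ?A" "finite ?B" "finite ?C" "finite ?D" using finite_prime_divisors_N0 by (auto simp: good_def)
  have "(\<Sum>p | prime p \<and> real p \<le> x \<and> f p \<noteq> 0. ?h p) \<le> sum ?h (?A \<union> (?B \<union> (?C \<union> ?D)))"
    using fin by (intro sum_mono2) (auto simp: good_def primes_le_def)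
  also have "\<dots> \<le> sum ?h ?A + (sum ?h ?B + (sum ?h ?C + sum ?h ?D))"
    using fin h0 by (intro order_trans[OF sum_Un_le] add_left_mono finite_UnI order_refl) auto
  also have "sum ?h ?A = Esum f j T" by (simp add: Esum_def)
  also have "sum ?h ?B \<le> 2 * real g"
  proof -
    have "?h p \<le> 1" for p
    proof -
      have "rho j p \<le> p" unfolding rho_def num_roots_mod_eq_pcount by (rule pcount_le)
      thus ?thesis by (auto simp: divide_le_eq_1)
    qed
    hence "sum ?h ?B \<le> real (card ?B) * 1" by (intro sum_bounded_above) auto
    also have "card ?B \<le> card {1..2 * g}" by (intro card_mono) (auto simp: Suc_le_eq prime_gt_0_nat)
    finally show ?thesis by simp
  qed
  also have "sum ?h ?C \<le> Lsum" unfolding Lsum_def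
    using rho_le_rho0[OF j] by (intro sum_mono divide_right_mono) auto
  also have "sum ?h ?D = sum ?h (primes_le x) - sum ?h (primes_le T)"
    using primes_le_mono[OF T(2)] by (intro sum_diff) auto
  also have "\<dots> \<le> ln (ln x / ln T) + 2 * m"
  proof -
    have "\<bar>sum ?h (primes_le x) - ln (ln x)\<bar> \<le> m" "\<bar>sum ?h (primes_le T) - ln (ln T)\<bar> \<le> m"
      using M[of x] M[of T] T by (auto simp: primes_le_def rho_def)
    moreover have "ln (ln x / ln T) = ln (ln x) - ln (ln T)" using T by (intro ln_divide_pos) auto
    ultimately show ?thesis by linarith
  qed
  finally show ?thesis by (simp add: E_sum_def rho_def)
qed

text \<open>As 1 + Esum is at least 1, the additive losses become factors, and 1 + 2a \<le> exp(a)^2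
  puts them in a form whose square root is exp(a). Hence the exponents \<open>Lsum\<close> and m
  appear with coefficient 1 for each j.\<close>

lemma inverse_sqrt_Esum_le:
  assumes j: "j \<in> {1..r}" and T: "2 \<le> T" "T \<le> x" and m: "m \<ge> 0"
    and M: "\<And>x::real. x \<ge> 2 \<Longrightarrow> \<bar>(\<Sum>p | prime p \<and> real p \<le> x. real (num_roots_mod (Q j) p) / real p) - ln (ln x)\<bar> \<le> m"
    and G: "1 + 2 * real g + ln (ln x / ln T) \<le> G"
  shows "1 / sqrt (1 + Esum f j T) \<le> G * exp Lsum * exp m / sqrt (E_sum f (\<lambda>p. real (num_roots_mod (Q j) p)) x)"
proof -
  define H where "H = 1 + Esum f j T"
  define E where "E = E_sum f (\<lambda>p. real (num_roots_mod (Q j) p)) x"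
  have H1: "H \<ge> 1" unfolding H_def Esum_def by (simp add: sum_nonneg)
  have E1: "E \<ge> 1" unfolding E_def E_sum_def by (simp add: sum_nonneg)
  have lam0: "ln (ln x / ln T) \<ge> 0" using T by (intro ln_ge_zero) auto
  have G1: "G \<ge> 1" using G lam0 by simp
  have "E \<le> H + (2 * real g + Lsum + ln (ln x / ln T) + 2 * m)"
    using E_sum_le[OF j T M, of f] unfolding E_def H_def by simp
  also have "\<dots> \<le> H + H * (2 * real g + Lsum + ln (ln x / ln T) + 2 * m)"
    using H1 lam0 Lsum_nonneg m mult_right_mono[of 1 H "2 * real g + Lsum + ln (ln x / ln T) + 2 * m"] by simp
  also have "\<dots> = H * (1 + 2 * real g + ln (ln x / ln T) + Lsum + 2 * m)" by (simp add: algebra_simps)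
  also have "\<dots> \<le> H * (G * G * ((exp Lsum)\<^sup>2 * (exp m)\<^sup>2))"
  proof (rule mult_left_mono)
    have a: "1 + 2 * Lsum \<le> (exp Lsum)\<^sup>2" using exp_ge_add_one_self[of "2 * Lsum"] by (simp add: exp_double)
    have b: "1 + 2 * m \<le> (exp m)\<^sup>2" using exp_ge_add_one_self[of "2 * m"] by (simp add: exp_double)
    have "1 + 2 * real g + ln (ln x / ln T) + Lsum + 2 * m \<le> G + (2 * Lsum + 2 * m)" using G Lsum_nonneg by simp
    also have "\<dots> \<le> G + G * (2 * Lsum + 2 * m)" using G1 Lsum_nonneg m mult_right_mono[of 1 G "2 * Lsum + 2 * m"] by simp
    also have "\<dots> = G * (1 + 2 * Lsum + 2 * m)" by (simp add: algebra_simps)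
    also have "\<dots> \<le> G * ((1 + 2 * Lsum) * (1 + 2 * m))"
      using G1 Lsum_nonneg m by (intro mult_left_mono) (auto simp: algebra_simps)
    also have "\<dots> \<le> G * ((exp Lsum)\<^sup>2 * (exp m)\<^sup>2)" using a b G1 m Lsum_nonneg by (intro mult_left_mono mult_mono) auto
    also have "\<dots> \<le> G * G * ((exp Lsum)\<^sup>2 * (exp m)\<^sup>2)" using G1 by (intro mult_right_mono) auto
    finally show "1 + 2 * real g + ln (ln x / ln T) + Lsum + 2 * m \<le> G * G * ((exp Lsum)\<^sup>2 * (exp m)\<^sup>2)" .
  qed (use H1 in simp)
  also have "\<dots> = H * (G * exp Lsum * exp m)\<^sup>2" by (simp add: power_mult_distrib power2_eq_square)
  finally have "sqrt E \<le> sqrt (H * (G * exp Lsum * exp m)\<^sup>2)" by (rule real_sqrt_le_mono)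
  also have "\<dots> = sqrt H * (G * exp Lsum * exp m)" using G1 by (simp add: real_sqrt_mult)
  finally have "sqrt E \<le> sqrt H * (G * exp Lsum * exp m)" .
  moreover have "sqrt H > 0" "sqrt E > 0" using H1 E1 by auto
  ultimately show ?thesis unfolding H_def[symmetric] E_def[symmetric] by (simp add: divide_simps mult_ac)
qed

text \<open>The worst case, in which \<open>f\<close> vanishes at no prime. It shows that any
  contribution up to y / (ln x)^r is admissible in the final estimate.\<close>

lemma E_sum_le_ln:
  assumes x: "ln x \<ge> 1" and m: "m \<ge> 0"
    and M: "\<bar>(\<Sum>p | prime p \<and> real p \<le> x. real (num_roots_mod (Q j) p) / real p) - ln (ln x)\<bar> \<le> m"
  shows "sqrt (E_sum f (\<lambda>p. real (num_roots_mod (Q j) p)) x) \<le> ln x * exp m"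
proof -
  have "E_sum f (\<lambda>p. real (num_roots_mod (Q j) p)) x \<le> 1 + (\<Sum>p\<in>primes_le x. real (num_roots_mod (Q j) p) / real p)"
    unfolding E_sum_def by (intro add_left_mono sum_mono2 finite_primes_le) (auto simp: primes_le_def)
  also have "\<dots> \<le> 1 + (ln (ln x) + m)" using M by (simp add: primes_le_def)
  also have "\<dots> \<le> ln x + m" using ln_le_minus_one[of "ln x"] x by simp
  also have "\<dots> \<le> ln x * (1 + m)" using x m mult_right_mono[of 1 "ln x" m] by (simp add: algebra_simps)
  also have "\<dots> \<le> ln x * exp m" using x by (intro mult_left_mono exp_ge_add_one_self) auto
  also have "\<dots> \<le> (ln x * exp m) * (ln x * exp m)"
  proof -
    have "ln x * exp m \<ge> 1 * 1" using x m by (intro mult_mono) auto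
    thus ?thesis using mult_left_mono[of 1 "ln x * exp m" "ln x * exp m"] by simp
  qed
  finally have "E_sum f (\<lambda>p. real (num_roots_mod (Q j) p)) x \<le> (ln x * exp m)\<^sup>2" by (simp add: power2_eq_square)
  thus ?thesis using x by (intro real_le_lsqrt) auto
qed

section \<open>Exceptional n: large powers of small primes, and zeros of Q\<close>

definition bad :: "real \<Rightarrow> real \<Rightarrow> int \<Rightarrow> bool" where
  "bad t c n \<longleftrightarrow> (\<exists>p\<in>primes_le t. \<exists>i. int (p ^ i) dvd poly Qp n \<and> real (p ^ i) > c)"

text \<open>For each p only the least power exceeding c = y^\<kappa>2 matters. It is at most p c
  \<le> y, so counting in the interval costs only a factor 2, and its root density is at most g
  c^(-1/g). Summing over at most y^\<kappa> primes still saves y^(\<kappa>2/(2g)), because \<kappa>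
  is at most half of \<kappa>2/g.\<close>

lemma card_bad_le:
  fixes x y :: real
  assumes y: "y \<ge> 1" and \<kappa>: "0 < \<kappa>" "\<kappa> \<le> \<kappa>2 / (2 * real g)" "\<kappa> + \<kappa>2 \<le> 1" "\<kappa>2 > 0"
  shows "real (card {n :: int. x < n \<and> n \<le> x + y \<and> bad (y powr \<kappa>) (y powr \<kappa>2) n}) \<le> 2 * real g * y powr (1 - \<kappa>2 / (2 * real g))"
proof -
  let ?P = "primes_le (y powr \<kappa>)"
  define c where "c = y powr \<kappa>2"
  have c1: "c \<ge> 1" unfolding c_def using y \<kappa> by (intro ge_one_powr_ge_zero) auto
  define e where "e p = (LEAST i. real (p ^ i) > c)" for p :: nat
  have e: "real (p ^ e p) > c" "i < e p \<Longrightarrow> real (p ^ i) \<le> c" "e p \<ge> 1" if p: "p \<in> ?P" for p i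
  proof -
    have p2: "p \<ge> 2" using primes_leD(3)[OF p] .
    obtain i where "real p ^ i > c" using real_arch_pow[of "real p" c] p2 by auto
    hence ex: "\<exists>i. real (p ^ i) > c" by auto
    show 1: "real (p ^ e p) > c" unfolding e_def by (rule LeastI_ex[OF ex])
    show "i < e p \<Longrightarrow> real (p ^ i) \<le> c" for i unfolding e_def using not_less_Least[of i "\<lambda>i. real (p ^ i) > c"] by linarith
    show "e p \<ge> 1"
    proof (rule ccontr)
      assume "\<not> e p \<ge> 1"
      hence "e p = 0" by simp
      hence "real (p ^ e p) = 1" by simp
      thus False using 1 c1 by linarith
    qed
  qed
  define S where "S p = {n :: int. x < n \<and> n \<le> x + y \<and> int (p ^ e p) dvd poly Qp n}" for p
  have sub: "{n :: int. x < n \<and> n \<le> x + y \<and> bad (y powr \<kappa>) c n} \<subseteq> (\<Union>p\<in>?P. S p)"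
  proof
    fix n assume n: "n \<in> {n :: int. x < n \<and> n \<le> x + y \<and> bad (y powr \<kappa>) c n}"
    then obtain p i where p: "p \<in> ?P" and i: "int (p ^ i) dvd poly Qp n" "real (p ^ i) > c" unfolding bad_def by blast
    have "\<not> i < e p" using e(2)[OF p, of i] i(2) by linarith
    hence "int (p ^ e p) dvd int (p ^ i)" by (simp only: int_dvd_int_iff le_imp_power_dvd not_less)
    hence "int (p ^ e p) dvd poly Qp n" using i(1) by (rule dvd_trans)
    thus "n \<in> (\<Union>p\<in>?P. S p)" using n p unfolding S_def by blast
  qed
  have finS: "finite (S p)" for p unfolding S_def by (rule finite_int_interval)
  have cS: "real (card (S p)) \<le> 2 * real g * y * c powr (- (1 / real g))" if p: "p \<in> ?P" for p
  proof -
    have pr: "prime p" "p \<ge> 2" "real p \<le> y powr \<kappa>" using primes_leD[OF p] by auto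
    define q where "q = p ^ e p"
    have q0: "q > 0" using pr by (simp add: q_def)
    obtain i where i: "e p = Suc i" using e(3)[OF p] by (cases "e p") auto
    have "real q = real p * real (p ^ i)" by (simp add: q_def i)
    also have "\<dots> \<le> y powr \<kappa> * c" using pr e(2)[OF p, of i] i by (intro mult_mono) auto
    also have "\<dots> = y powr (\<kappa> + \<kappa>2)" by (simp add: c_def powr_add)
    also have "\<dots> \<le> y powr 1" using y \<kappa> by (intro powr_mono) auto
    finally have qy: "real q \<le> y" using y by simp
    let ?pc = "real (pcount (\<lambda>a. int q dvd poly Qp a) q)"
    have "\<bar>real (card (S p)) - ?pc * (y / real q)\<bar> \<le> ?pc"
      unfolding S_def q_def[symmetric] using card_periodic_interval[OF periodic_mod_dvd_poly q0, of y x Qp] y by simp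
    hence "real (card (S p)) \<le> ?pc * (y / real q) + ?pc * 1" by simp
    also have "\<dots> \<le> ?pc * (y / real q) + ?pc * (y / real q)"
      using qy q0 by (intro add_left_mono mult_left_mono) auto
    also have "\<dots> = 2 * y * (?pc / real q)" by simp
    also have "\<dots> \<le> 2 * y * (real g * real p powr (- (real (e p) / real g)))"
      using density_prime_power_le[OF pr(1) e(3)[OF p]] y unfolding q_def by (intro mult_left_mono) auto
    also have "real p powr (- (real (e p) / real g)) = real q powr (- (1 / real g))"
    proof -
      have "real q = real p powr real (e p)" using pr by (simp add: q_def powr_realpow)
      thus ?thesis by (simp add: powr_powr)
    qed
    also have "2 * y * (real g * real q powr (- (1 / real g))) \<le> 2 * y * (real g * c powr (- (1 / real g)))"
      using e(1)[OF p] c1 y unfolding q_def[symmetric] by (intro mult_left_mono powr_mono2') auto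
    finally show ?thesis by (simp add: mult_ac)
  qed
  have "card {n :: int. x < n \<and> n \<le> x + y \<and> bad (y powr \<kappa>) c n} \<le> card (\<Union>p\<in>?P. S p)"
    using sub finS by (intro card_mono) auto
  also have "\<dots> \<le> (\<Sum>p\<in>?P. card (S p))" by (rule card_UN_le) simp
  finally have "real (card {n :: int. x < n \<and> n \<le> x + y \<and> bad (y powr \<kappa>) c n}) \<le> (\<Sum>p\<in>?P. real (card (S p)))"
    by (simp flip: of_nat_sum)
  also have "\<dots> \<le> real (card ?P) * (2 * real g * y * c powr (- (1 / real g)))" using cS by (rule sum_bounded_above)
  also have "\<dots> \<le> y powr \<kappa> * (2 * real g * y * c powr (- (1 / real g)))"
  proof (rule mult_right_mono)
    have "card ?P \<le> card {1..nat \<lfloor>y powr \<kappa>\<rfloor>}"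
      by (intro card_mono) (auto simp: primes_le_def Suc_le_eq prime_gt_0_nat intro: le_nat_floor)
    hence "card ?P \<le> nat \<lfloor>y powr \<kappa>\<rfloor>" by simp
    hence "real (card ?P) \<le> real (nat \<lfloor>y powr \<kappa>\<rfloor>)" by (simp only: of_nat_le_iff)
    also have "\<dots> \<le> y powr \<kappa>" by (intro of_nat_floor) auto
    finally show "real (card ?P) \<le> y powr \<kappa>" .
  qed (use y in auto)
  also have "\<dots> = 2 * real g * (y powr 1 * y powr \<kappa> * y powr (- (\<kappa>2 / real g)))" using y by (simp add: c_def powr_powr)
  also have "\<dots> = 2 * real g * y powr (1 + \<kappa> - \<kappa>2 / real g)" by (simp only: powr_add[symmetric]) simp
  also have "\<dots> \<le> 2 * real g * y powr (1 - \<kappa>2 / (2 * real g))"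
    using y \<kappa>(2) by (intro mult_left_mono powr_mono) (auto simp: field_simps)
  finally show ?thesis by (simp add: c_def)
qed

lemma card_zeros_le: "card {n :: int. poly Qp n = 0} \<le> g" "finite {n :: int. poly Qp n = 0}"
  using poly_roots_degree[OF Qp_nz] poly_roots_finite[OF Qp_nz] by (auto simp: degQp)

end

section \<open>The main estimate\<close>

context poly_fam
begin

lemma smooth_part_0 [simp]: "smooth_part 0 n = 1"
  by (simp add: smooth_part_def)

lemma smooth_part_Suc:
  "smooth_part (Suc s) n = (if prime s then s ^ esum (val s n) else 1) * smooth_part s n"
proof -
  have "{p. prime p \<and> p < Suc s} = (if prime s then insert s {p. prime p \<and> p < s} else {p. prime p \<and> p < s})"
    by (auto simp: less_Suc_eq)
  thus ?thesis by (simp add: smooth_part_def)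
qed

lemma smooth_part_le_power:
  assumes "\<And>p. prime p \<Longrightarrow> p < s \<Longrightarrow> real (p ^ esum (val p n)) \<le> c" "c \<ge> 1"
  shows "real (smooth_part s n) \<le> c ^ s"
  using assms(1)
proof (induction s)
  case (Suc s)
  have "real (if prime s then s ^ esum (val s n) else 1) \<le> c" using Suc.prems[of s] assms(2) by auto
  moreover have "real (smooth_part s n) \<le> c ^ s" using Suc by simp
  ultimately have "real (if prime s then s ^ esum (val s n) else 1) * real (smooth_part s n) \<le> c * c ^ s"
    using assms(2) by (intro mult_mono) auto
  thus ?case by (simp only: smooth_part_Suc of_nat_mult power_Suc)
qed auto

lemma smooth_part_pos: "smooth_part s n \<ge> 1"
  unfolding smooth_part_def by (intro prod_ge_1) (auto simp: Suc_le_eq prime_gt_0_nat)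

lemma not_badD:
  assumes "\<not> bad t c n" "prime p" "real p \<le> t" "poly Qp n \<noteq> 0"
  shows "real (p ^ esum (val p n)) \<le> c"
proof (rule ccontr)
  assume "\<not> real (p ^ esum (val p n)) \<le> c"
  moreover have "int (p ^ esum (val p n)) dvd poly Qp n" by (rule vcond_dvd[OF vcond_val[OF assms(2,4)]])
  moreover have "p \<in> primes_le t" using assms by (simp add: primes_le_def)
  ultimately show False using assms(1) unfolding bad_def by (meson linorder_not_le)
qed

text \<open>The prime at which the smooth part of \<open>Q(n)\<close> first exceeds \<open>y powr (1/4)\<close>.\<close>

lemma first_large_smooth_part:
  fixes n :: int
  assumes y: "y \<ge> 1" and Tm: "Tm \<ge> 1" and \<kappa>2: "\<kappa>2 * (8 * (Tm + 1)) = 1"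
    and n: "poly Qp n \<noteq> 0" and nb: "\<not> bad t0 (y powr \<kappa>2) n" and t0: "t0 \<ge> 0"
    and big: "\<not> real (smooth_part (nat \<lfloor>t0\<rfloor> + 1) n) ^ 4 \<le> y"
  obtains s where "prime s" "real s \<le> t0" "real s > Tm" "real (smooth_part s n) ^ 4 \<le> y"
    "y powr (1 / 8) \<le> real (smooth_part s n)"
proof -
  \<comment> \<open>Minimality refers to the smooth part that includes s itself; the part strictly
    below s is then still at most y^(1/4), and s is prime because otherwise the two parts
    coincide.\<close>
  define s where "s = (LEAST s. \<not> real (smooth_part (Suc s) n) ^ 4 \<le> y)"
  have ex: "\<not> real (smooth_part (Suc (nat \<lfloor>t0\<rfloor>)) n) ^ 4 \<le> y" using big by simp
  have s1: "\<not> real (smooth_part (Suc s) n) ^ 4 \<le> y" unfolding s_def by (rule LeastI[of "\<lambda>s. \<not> real (smooth_part (Suc s) n) ^ 4 \<le> y", OF ex])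
  have "s \<le> nat \<lfloor>t0\<rfloor>" unfolding s_def by (rule Least_le[of "\<lambda>s. \<not> real (smooth_part (Suc s) n) ^ 4 \<le> y", OF ex])
  hence "real s \<le> real (nat \<lfloor>t0\<rfloor>)" by (simp only: of_nat_le_iff)
  also have "\<dots> \<le> t0" using t0 by (intro of_nat_floor) auto
  finally have st0: "real s \<le> t0" .
  have s2: "real (smooth_part s n) ^ 4 \<le> y"
  proof (cases s)
    case 0
    thus ?thesis using y by simp
  next
    case (Suc s')
    hence "s' < s" by simp
    hence "\<not> \<not> real (smooth_part (Suc s') n) ^ 4 \<le> y" unfolding s_def by (rule not_less_Least)
    thus ?thesis using Suc by simp
  qed
  have prs: "prime s"
  proof (rule ccontr)
    assume "\<not> prime s"
    hence "smooth_part (Suc s) n = smooth_part s n" by (simp add: smooth_part_Suc)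
    thus False using s1 s2 by simp
  qed
  define c where "c = y powr \<kappa>2"
  have k0: "\<kappa>2 > 0" using \<kappa>2 Tm by (simp add: zero_less_mult_iff eq_divide_eq) (smt (verit) mult_nonneg_nonneg zero_less_mult_iff)
  have c1: "c \<ge> 1" unfolding c_def using y k0 by (intro ge_one_powr_ge_zero) auto
  have pc: "real (p ^ esum (val p n)) \<le> c" if "prime p" "real p \<le> t0" for p
    unfolding c_def by (rule not_badD[OF nb that n])
  \<comment> \<open>If s were at most Tm, at most Tm + 1 prime powers of size at most y^\<kappa>2
    would multiply to no more than y^(1/8). The bound is needed later: the tilt is admissible only
    for large T.\<close>
  have sT: "real s > Tm"
  proof (rule ccontr)
    assume "\<not> real s > Tm"
    hence "real (Suc s) \<le> Tm + 1" by simp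
    have "real (smooth_part (Suc s) n) \<le> c ^ Suc s"
    proof (rule smooth_part_le_power[OF _ c1])
      fix p assume p: "prime p" "p < Suc s"
      hence "real p \<le> t0" using st0 by linarith
      thus "real (p ^ esum (val p n)) \<le> c" using pc p by blast
    qed
    also have "c ^ Suc s = y powr (\<kappa>2 * real (Suc s))" unfolding c_def
      by (subst powr_realpow[symmetric]) (use y in \<open>auto simp: powr_powr\<close>)
    also have "\<dots> \<le> y powr (\<kappa>2 * (Tm + 1))"
      using y k0 \<open>real (Suc s) \<le> Tm + 1\<close> by (intro powr_mono mult_left_mono) auto
    also have "\<kappa>2 * (Tm + 1) = 1 / 8"
    proof -
      have "8 * (\<kappa>2 * (Tm + 1)) = 1" using \<kappa>2 by (simp only: mult.left_commute)
      thus ?thesis by linarith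
    qed
    finally have "real (smooth_part (Suc s) n) ^ 4 \<le> (y powr (1 / 8)) ^ 4" by (intro power_mono) auto
    also have "(y powr (1 / 8)) ^ 4 = y powr (1 / 2)"
      by (subst powr_realpow[symmetric]) (use y in \<open>auto simp: powr_powr\<close>)
    also have "\<dots> \<le> y powr 1" using y by (intro powr_mono) auto
    finally show False using s1 y by simp
  qed
  \<comment> \<open>The jump at s is a factor of at most y^\<kappa>2 \<le> y^(1/8), so a product
    exceeding y^(1/4) was already at least y^(1/8) before it.\<close>
  have "y powr (1 / 8) \<le> real (smooth_part s n)"
  proof (rule ccontr)
    assume "\<not> y powr (1 / 8) \<le> real (smooth_part s n)"
    moreover have "real (smooth_part (Suc s) n) = real (s ^ esum (val s n)) * real (smooth_part s n)"
      using prs by (simp add: smooth_part_Suc)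
    moreover have "c \<le> y powr (1 / 8)"
      unfolding c_def
    proof (rule powr_mono)
      have "\<kappa>2 * 8 \<le> \<kappa>2 * (8 * (Tm + 1))" using k0 Tm by (intro mult_left_mono) auto
      thus "\<kappa>2 \<le> 1 / 8" using \<kappa>2 by simp
    qed (use y in simp)
    ultimately have "real (smooth_part (Suc s) n) \<le> y powr (1 / 8) * y powr (1 / 8)"
      using pc[OF prs st0] c1 by (simp only:) (intro mult_mono, auto)
    also have "\<dots> = y powr (1 / 4)" by (simp add: powr_add[symmetric])
    finally have "real (smooth_part (Suc s) n) ^ 4 \<le> (y powr (1 / 4)) ^ 4" by (intro power_mono) auto
    also have "(y powr (1 / 4)) ^ 4 = y"
      by (subst powr_realpow[symmetric]) (use y in \<open>auto simp: powr_powr\<close>)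
    finally show False using s1 by simp
  qed
  thus ?thesis using that[OF prs st0 sT s2] by blast
qed

text \<open>The origin of the parameters: \<open>Bx\<close> is the exponent in the bound for |Q(n)|.
  \<open>C\<close> is chosen so that C/8 exceeds by 1 the rate 2 r Bx ln V / \<epsilon> at which the
  number of rough values grows. \<open>Tm\<close> guarantees \<sigma> = C / ln T \<le> 1/(4g) and
  sqrt T \<ge> 2g. \<open>\<kappa>2\<close> makes Tm + 1 prime powers multiply to at most y^(1/8).
  \<open>\<kappa>\<close> is small enough for the sieve level y^(1/12) at the limit y^\<kappa> and
  for the count of bad n. \<open>Z\<close> is the target up to constants.\<close>

theorem main_count:
  fixes V :: nat and \<epsilon> \<delta> lam x y Bx C Tm \<kappa>2 \<kappa> :: real and f :: "nat \<Rightarrow> nat \<Rightarrow> real" and M k :: "nat \<Rightarrow> real"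
  defines "z \<equiv> exp (ln x powr (1 - lam))"
  defines "Z \<equiv> y * (exp Lsum ^ r * (\<Prod>j=1..r. exp (M j))) / (\<Prod>j=1..r. sqrt (E_sum (f j) (\<lambda>p. real (num_roots_mod (Q j) p)) x))"
  defines "cs \<equiv> 6 * real (g * (g + 1)) + 1"
  defines "C3 \<equiv> (2 * real r / \<epsilon>) ^ r * exp ((1 + 2 * real g) * \<epsilon> / 2)"
  defines "A1 \<equiv> (real V powr (Bx / (\<kappa> * \<epsilon>))) ^ r * blockC C * (1 + 2 * real g + 1 / (\<kappa> * \<epsilon>)) ^ r"
  assumes V: "V \<ge> 1" and \<epsilon>: "0 < \<epsilon>" "\<epsilon> < 1" and \<delta>: "\<delta> > 0" and lam: "0 < lam" "lam < 1"
    and Bx: "Bx = 1 + real g + 1 / \<delta>" and C: "C = 8 * (2 * real r * Bx * ln (real V) / \<epsilon> + 1)"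
    and Tm: "Tm = exp (4 * real g * C) + 4 * (real g)\<^sup>2 + 4"
    and \<kappa>2: "\<kappa>2 * (8 * (Tm + 1)) = 1" and \<kappa>: "\<kappa> * (24 * real g * cs) = \<kappa>2"
    and x1: "x \<ge> 1" and L1: "ln x \<ge> 1" and L2: "real (g + 1) * 2 ^ g \<le> x" and L3: "Tm \<le> x powr (\<epsilon> * \<kappa>)"
    and L4: "ln x powr (1 - lam) \<le> \<epsilon> * \<kappa> * ln x" and L5: "ln x ^ r \<le> x powr (\<epsilon> * \<kappa>2 / (2 * real g))"
    and L6: "ln x ^ r * (ln x + 2) \<le> exp (\<epsilon> / 2 * ln x powr lam)"
    and height: "real_of_int (poly_height Qp) powr \<delta> \<le> x"
    and y: "x powr \<epsilon> < y" "y \<le> x"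
    and f: "\<And>j. j \<in> {1..r} \<Longrightarrow> additive_fun (f j)" "\<And>j. j \<in> {1..r} \<Longrightarrow> value_count_bound V z (f j)"
    and M0: "\<And>j. j \<in> {1..r} \<Longrightarrow> M j \<ge> 0"
    and M: "\<And>j x. j \<in> {1..r} \<Longrightarrow> x \<ge> 2 \<Longrightarrow> \<bar>(\<Sum>p | prime p \<and> real p \<le> x. real (num_roots_mod (Q j) p) / real p) - ln (ln x)\<bar> \<le> M j"
  shows "real (card {n :: int. x < real_of_int n \<and> real_of_int n \<le> x + y \<and> (\<forall>j\<in>{1..r}. ext_even (f j) (poly (Q j) n) = k j)})
    \<le> (A1 + blockC C * (3 * C3 + 1) + 3 * real g) * Z"
proof -
  have g1: "real g \<ge> 1" and r1: "real r \<ge> 1" using g r by auto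
  have lnV: "ln (real V) \<ge> 0" using V by simp
  have Bx1: "Bx \<ge> 1" using Bx \<delta> by simp
  have C8: "C \<ge> 8" unfolding C using lnV Bx1 r1 \<epsilon> by simp
  have Tm4: "Tm \<ge> 4" "Tm \<ge> exp (4 * real g * C)" "Tm \<ge> (2 * real g)\<^sup>2 + 4"
    unfolding Tm by (simp_all add: power2_eq_square)
  have cs1: "cs \<ge> 1" by (simp add: cs_def)
  have \<kappa>2e: "\<kappa>2 = 1 / (8 * (Tm + 1))" using \<kappa>2 Tm4 by (simp add: eq_divide_eq)
  have \<kappa>20: "\<kappa>2 > 0" "\<kappa>2 \<le> 1 / 40" unfolding \<kappa>2e using Tm4 by (auto simp: divide_simps)
  have \<kappa>e: "\<kappa> = \<kappa>2 / (24 * real g * cs)" using \<kappa> g1 cs1 by (simp add: eq_divide_eq)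
  have gcs: "real g * cs \<ge> 1" using g1 cs1 mult_mono[of 1 "real g" 1 cs] by simp
  have \<kappa>0: "\<kappa> > 0" unfolding \<kappa>e using \<kappa>20 g1 cs1 by simp
  have \<kappa>le: "\<kappa> \<le> \<kappa>2 / (2 * real g)"
    unfolding \<kappa>e
  proof (rule divide_left_mono)
    show "2 * real g \<le> 24 * real g * cs" using g1 cs1 mult_left_mono[of 1 cs "24 * real g"] by simp
  qed (use g1 cs1 \<kappa>20 in auto)
  have \<kappa>cs: "cs * \<kappa> \<le> 1 / 12"
  proof -
    have "cs * \<kappa> * (24 * real g) = \<kappa>2" using \<kappa> by (simp add: mult_ac)
    hence "cs * \<kappa> * 24 * 1 \<le> \<kappa>2" using g1 \<kappa>0 cs1 mult_left_mono[of 1 "real g" "cs * \<kappa> * 24"] by (simp add: mult_ac)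
    thus ?thesis using \<kappa>20 by simp
  qed
  have \<kappa>1: "\<kappa> \<le> 1"
  proof -
    have "1 * \<kappa> \<le> cs * \<kappa>" using cs1 \<kappa>0 by (intro mult_right_mono) auto
    thus ?thesis using \<kappa>cs by linarith
  qed
  have x2: "x \<ge> 2"
  proof -
    have "2 \<le> real (g + 1) * 1" using g1 by simp
    also have "\<dots> \<le> real (g + 1) * 2 ^ g" by (intro mult_left_mono) auto
    finally show ?thesis using L2 by linarith
  qed
  have lx: "ln x > 0" using L1 by simp
  have xe1: "x powr \<epsilon> \<ge> 1" using x1 \<epsilon> by (intro ge_one_powr_ge_zero) auto
  have y1: "y \<ge> 1" using xe1 y by linarith
  have ly: "\<epsilon> * ln x \<le> ln y" "ln y \<le> ln x"
  proof -
    have "ln (x powr \<epsilon>) \<le> ln y" using y xe1 by (intro ln_mono) auto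
    thus "\<epsilon> * ln x \<le> ln y" using x1 by (simp add: ln_powr)
    show "ln y \<le> ln x" using y y1 by (intro ln_mono) auto
  qed
  have ly0: "ln y > 0" using ly lx \<epsilon> by (smt (verit) mult_pos_pos)
  define E where "E j = sqrt (E_sum (f j) (\<lambda>p. real (num_roots_mod (Q j) p)) x)" for j
  have E0: "E j > 0" for j unfolding E_def E_sum_def by (simp add: add_pos_nonneg sum_nonneg)
  have PE0: "(\<Prod>j=1..r. E j) > 0" using E0 by (intro prod_pos) auto
  have Ze: "Z = y * (exp Lsum ^ r * (\<Prod>j=1..r. exp (M j))) / (\<Prod>j=1..r. E j)" by (simp only: Z_def E_def)
  have PM0: "(\<Prod>j=1..r. exp (M j)) > 0" by (intro prod_pos) auto
  have Z0: "Z > 0" unfolding Ze using y1 PE0 PM0 by (intro divide_pos_pos mult_pos_pos zero_less_power) auto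
  \<comment> \<open>The yardstick for the contributions that ignore the functions
    \<open>f j\<close>.\<close>
  have Zge: "y / ln x ^ r \<le> Z"
  proof -
    have "(\<Prod>j=1..r. E j) \<le> (\<Prod>j=1..r. ln x * exp (M j))"
    proof (rule prod_mono)
      fix j assume j: "j \<in> {1..r}"
      show "0 \<le> E j \<and> E j \<le> ln x * exp (M j)"
        using E_sum_le_ln[OF L1 M0[OF j] M[OF j x2], of "f j"] E0[of j] unfolding E_def by simp
    qed
    also have "\<dots> = ln x ^ r * (\<Prod>j=1..r. exp (M j))" by (simp add: prod.distrib)
    also have "\<dots> \<le> ln x ^ r * (exp Lsum ^ r * (\<Prod>j=1..r. exp (M j)))"
    proof (rule mult_left_mono)
      have "1 \<le> exp Lsum ^ r" using Lsum_nonneg by (intro one_le_power) auto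
      moreover have "(\<Prod>j=1..r. exp (M j)) \<ge> 0" by (intro prod_nonneg) auto
      ultimately show "(\<Prod>j=1..r. exp (M j)) \<le> exp Lsum ^ r * (\<Prod>j=1..r. exp (M j))"
        using mult_right_mono[of 1 "exp Lsum ^ r" "\<Prod>j=1..r. exp (M j)"] by simp
    qed (use lx in simp)
    finally have "y * (\<Prod>j=1..r. E j) \<le> y * (ln x ^ r * (exp Lsum ^ r * (\<Prod>j=1..r. exp (M j))))"
      using y1 by (intro mult_left_mono) auto
    thus ?thesis unfolding Ze using PE0 lx by (simp add: divide_simps mult_ac)
  qed
  \<comment> \<open>Stopping at T instead of x costs a factor G per coordinate, where G grows with
    ln(ln x / ln T).\<close>
  have blockZ: "y * (\<Prod>j=1..r. 1 / sqrt (1 + Esum (f j) j T)) \<le> G ^ r * Z"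
    if T: "2 \<le> T" "T \<le> x" and G: "1 + 2 * real g + ln (ln x / ln T) \<le> G" for T G
  proof -
    have "(\<Prod>j=1..r. 1 / sqrt (1 + Esum (f j) j T)) \<le> (\<Prod>j=1..r. G * exp Lsum * exp (M j) / E j)"
    proof (rule prod_mono)
      fix j assume j: "j \<in> {1..r}"
      have "Esum (f j) j T \<ge> 0" unfolding Esum_def by (intro sum_nonneg) auto
      thus "0 \<le> 1 / sqrt (1 + Esum (f j) j T) \<and> 1 / sqrt (1 + Esum (f j) j T) \<le> G * exp Lsum * exp (M j) / E j"
        unfolding E_def using inverse_sqrt_Esum_le[OF j T M0[OF j] M[OF j] G, of "f j"] by simp
    qed
    also have "\<dots> = G ^ r * (exp Lsum ^ r * (\<Prod>j=1..r. exp (M j)) / (\<Prod>j=1..r. E j))"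
      by (simp add: prod_dividef prod.distrib power_mult_distrib)
    finally have "y * (\<Prod>j=1..r. 1 / sqrt (1 + Esum (f j) j T)) \<le> y * (G ^ r * (exp Lsum ^ r * (\<Prod>j=1..r. exp (M j)) / (\<Prod>j=1..r. E j)))"
      using y1 by (intro mult_left_mono) auto
    thus ?thesis unfolding Ze by (simp add: mult_ac)
  qed
  have bC0: "blockC C \<ge> 0" unfolding blockC_def massC_def using massB_ge_1[of C] by simp
  define t0 where "t0 = y powr \<kappa>"
  have lt0: "ln t0 = \<kappa> * ln y" using y1 by (simp add: t0_def ln_powr)
  have t0Tm: "Tm \<le> t0"
  proof -
    have "x powr (\<epsilon> * \<kappa>) = (x powr \<epsilon>) powr \<kappa>" by (simp add: powr_powr)
    also have "\<dots> \<le> y powr \<kappa>" using y \<kappa>0 by (intro powr_mono2) auto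
    finally show ?thesis using L3 by (simp add: t0_def)
  qed
  have Tmg: "2 * real g \<le> t" if "(2 * real g)\<^sup>2 + 4 \<le> t\<^sup>2" "t \<ge> 0" for t
    using that by (intro power2_le_imp_le[of "2 * real g" t]) auto
  define Qb where "Qb = y powr (1 / 12)"
  have Qb1: "Qb \<ge> 1" unfolding Qb_def using y1 by (intro ge_one_powr_ge_zero) auto
  have Qb6: "Qb ^ 6 \<le> sqrt y"
  proof -
    have "Qb ^ 6 = y powr (1 / 2)" unfolding Qb_def by (subst powr_realpow[symmetric]) (use y1 in \<open>auto simp: powr_powr\<close>)
    thus ?thesis using y1 by (simp add: powr_half_sqrt)
  qed
  have lnQb: "cs * ln t \<le> ln Qb" if "ln t \<le> ln t0" for t
  proof -
    have "cs * ln t \<le> cs * (\<kappa> * ln y)" using that cs1 unfolding lt0 by (intro mult_left_mono) auto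
    also have "\<dots> = (cs * \<kappa>) * ln y" by simp
    also have "\<dots> \<le> 1 / 12 * ln y" using \<kappa>cs ly0 by (intro mult_right_mono) auto
    also have "\<dots> = ln Qb" unfolding Qb_def using y1 by (simp add: ln_powr)
    finally show ?thesis .
  qed
  have wln: "ln u \<le> u" if "u > 0" for u :: real using ln_le_minus_one[OF that] by linarith
  define S where "S = {n :: int. x < real_of_int n \<and> real_of_int n \<le> x + y \<and> (\<forall>j\<in>{1..r}. ext_even (f j) (poly (Q j) n) = k j)}"
  have Qpx: "real_of_int \<bar>poly Qp n\<bar> \<le> x powr Bx" if "n \<in> S" for n
    unfolding Bx using that y x1 L2 \<delta> height by (intro abs_Qp_le) (auto simp: S_def)
  have xpow: "x powr Bx = t powr (Bx * ln x / ln t)" if "t > 1" for t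
    using that x1 by (simp add: powr_def)
  \<comment> \<open>The generic case: the smooth part is still small at t0, a fixed power of y. Then
    u is bounded, and the block theorem applies with \<sigma> = 0 and Y = 1.\<close>
  define N1 where "N1 = {n \<in> S. poly Qp n \<noteq> 0 \<and> real (smooth_part (nat \<lfloor>t0\<rfloor> + 1) n) ^ 4 \<le> y}"
  have N1: "real (card N1) \<le> A1 * Z"
  proof -
    define u where "u = Bx * ln x / ln t0"
    have t01: "t0 \<ge> 2" "t0 > 1" using t0Tm Tm4 by auto
    have t0x: "t0 \<le> x"
    proof -
      have "y powr \<kappa> \<le> y powr 1" using y1 \<kappa>1 by (intro powr_mono) auto
      thus ?thesis using y y1 by (simp add: t0_def)
    qed
    have rat: "ln x / ln t0 \<le> 1 / (\<kappa> * \<epsilon>)"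
    proof -
      have "\<kappa> * (\<epsilon> * ln x) \<le> \<kappa> * ln y" using ly \<kappa>0 by (intro mult_left_mono) auto
      thus ?thesis unfolding lt0 using \<kappa>0 \<epsilon> ly0 by (simp add: divide_simps mult_ac)
    qed
    have rat1: "ln x / ln t0 \<ge> 1" using t01 t0x by simp
    have u1: "u \<ge> 1"
    proof -
      have "1 * 1 \<le> Bx * (ln x / ln t0)" using Bx1 rat1 by (intro mult_mono) auto
      thus ?thesis by (simp add: u_def)
    qed
    have "z \<le> t0"
    proof -
      have "ln x powr (1 - lam) \<le> \<kappa> * (\<epsilon> * ln x)" using L4 by (simp add: mult_ac)
      also have "\<dots> \<le> \<kappa> * ln y" using ly \<kappa>0 by (intro mult_left_mono) auto
      finally have "exp (ln x powr (1 - lam)) \<le> exp (ln t0)" unfolding lt0 by simp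
      thus ?thesis using t01 by (simp add: z_def)
    qed
    have "real (card N1) \<le> (real V powr u) ^ r * (blockC C * y * 1 powr (-0) * (\<Prod>j=1..r. 1 / sqrt (1 + Esum (f j) j t0)))"
    proof (rule block_count_additive[where t = t0 and T = t0 and Qb = Qb and z = z and s = "\<lambda>_. nat \<lfloor>t0\<rfloor> + 1"])
      show "2 * real g \<le> t0"
      proof -
        have "2 * real g * 1 \<le> 2 * real g * (2 * real g)" using g1 by (intro mult_left_mono) auto
        thus ?thesis using t0Tm Tm4(3) by (simp add: power2_eq_square)
      qed
      show "t0 \<le> t0\<^sup>2" using t01 mult_left_mono[of 1 t0 t0] by (simp add: power2_eq_square)
      show "(6 * real (g * (g + 1)) + 1) * ln t0 \<le> ln Qb" using lnQb[of t0] by (simp add: cs_def)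
      show "t0 < real (nat \<lfloor>t0\<rfloor> + 1)" using t01 by linarith
      show "real (nat \<lfloor>t0\<rfloor> + 1) \<le> t0 + 1" using t01 by linarith
      show "1 \<le> real (smooth_part (nat \<lfloor>t0\<rfloor> + 1) n)" for n using smooth_part_pos[of "nat \<lfloor>t0\<rfloor> + 1" n] by linarith
      show "real_of_int \<bar>poly Qp n\<bar> \<le> t0 powr u" if "n \<in> N1" for n
        using Qpx[of n] that xpow[OF t01(2)] by (simp add: N1_def u_def)
    qed (use t01 Qb1 Qb6 f \<open>z \<le> t0\<close> u1 C8 in \<open>auto simp: N1_def S_def\<close>)
    also have "\<dots> = (real V powr u) ^ r * (blockC C * (y * (\<Prod>j=1..r. 1 / sqrt (1 + Esum (f j) j t0))))" by (simp add: mult_ac)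
    also have "\<dots> \<le> (real V powr (Bx / (\<kappa> * \<epsilon>))) ^ r * (blockC C * ((1 + 2 * real g + 1 / (\<kappa> * \<epsilon>)) ^ r * Z))"
    proof (rule mult_mono)
      have "u \<le> Bx * (1 / (\<kappa> * \<epsilon>))" unfolding u_def using rat Bx1 mult_left_mono[of "ln x / ln t0" "1 / (\<kappa> * \<epsilon>)" Bx] by simp
      thus "(real V powr u) ^ r \<le> (real V powr (Bx / (\<kappa> * \<epsilon>))) ^ r" using V by (intro power_mono powr_mono) auto
      have "ln (ln x / ln t0) \<le> ln x / ln t0" using rat1 by (intro wln) auto
      hence "y * (\<Prod>j=1..r. 1 / sqrt (1 + Esum (f j) j t0)) \<le> (1 + 2 * real g + 1 / (\<kappa> * \<epsilon>)) ^ r * Z"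
        using rat by (intro blockZ[OF t01(1) t0x]) auto
      thus "blockC C * (y * (\<Prod>j=1..r. 1 / sqrt (1 + Esum (f j) j t0))) \<le> blockC C * ((1 + 2 * real g + 1 / (\<kappa> * \<epsilon>)) ^ r * Z)"
        using bC0 by (rule mult_left_mono)
      have "Esum (f j) j t0 \<ge> 0" for j unfolding Esum_def by (intro sum_nonneg) auto
      hence "0 \<le> (\<Prod>j=1..r. 1 / sqrt (1 + Esum (f j) j t0))" by (intro prod_nonneg) auto
      thus "0 \<le> blockC C * (y * (\<Prod>j=1..r. 1 / sqrt (1 + Esum (f j) j t0)))" using y1 bC0 by simp
    qed simp
    also have "\<dots> = A1 * Z" by (simp add: A1_def mult_ac)
    finally show ?thesis .
  qed
  \<comment> \<open>Successive square roots of t0: each block has T at most t^2, and the loss and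
    gain exponents double from one block to the next.\<close>
  define T where "T i = exp (\<kappa> * ln y / 2 ^ i)" for i :: nat
  have lnT: "ln (T i) = \<kappa> * ln y / 2 ^ i" for i by (simp add: T_def)
  have lnT0: "ln (T i) > 0" for i unfolding lnT using \<kappa>0 ly0 by simp
  have T0: "T 0 = t0" using y1 by (simp add: T_def t0_def powr_def)
  have Tsq: "(T (Suc i))\<^sup>2 = T i" for i
  proof -
    have "(T (Suc i))\<^sup>2 = exp (2 * (\<kappa> * ln y / 2 ^ Suc i))" unfolding T_def by (rule exp_double[symmetric])
    thus ?thesis by (simp add: T_def)
  qed
  define Y where "Y = y powr (1 / 8)"
  define N2 where "N2 i = {n \<in> S. T i > Tm \<and> poly Qp n \<noteq> 0 \<and> (\<exists>s::nat. T (Suc i) < real s \<and> real s \<le> T i \<and>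
      Y \<le> real (smooth_part s n) \<and> real (smooth_part s n) ^ 4 \<le> y)}" for i
  have C30: "C3 \<ge> 0" unfolding C3_def using \<epsilon> by simp
  have N2: "real (card (N2 i)) \<le> blockC C * C3 * Z * exp (- (1 / 2)) ^ i + blockC C * y * exp (- (\<epsilon> / 2 * ln x powr lam))" for i
  proof (cases "T i > Tm")
    case False
    hence "N2 i = {}" by (simp add: N2_def)
    thus ?thesis using bC0 C30 Z0 y1 by simp
  next
    case True
    define t where "t = T (Suc i)"
    have t2T: "t\<^sup>2 = T i" unfolding t_def by (rule Tsq)
    have lt: "ln t = ln (T i) / 2" unfolding t_def lnT by simp
    have lt0': "ln t > 0" using lnT0[of i] lt by simp
    have tpos: "t > 0" by (simp add: t_def T_def)
    have t2: "t \<ge> 2" using True Tm4(1) t2T tpos by (intro power2_le_imp_le[of 2 t]) auto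
    have tg: "t \<ge> 2 * real g" using True Tm4(3) t2T tpos by (intro Tmg) auto
    have tT: "t \<le> T i" using t2 t2T mult_left_mono[of 1 t t] by (simp add: power2_eq_square)
    have Tt0: "ln (T i) \<le> ln t0" unfolding lnT lt0 using \<kappa>0 ly0 by (simp add: divide_le_eq)
    have Tx: "T i \<le> x"
    proof -
      have "\<kappa> * ln y \<le> 1 * ln x" using \<kappa>1 \<kappa>0 ly ly0 by (intro mult_mono) auto
      hence "ln t0 \<le> ln x" unfolding lt0 by simp
      hence "ln (T i) \<le> ln x" using Tt0 by linarith
      thus ?thesis using x1 by (simp add: T_def ln_ge_iff)
    qed
    \<comment> \<open>The ratio ln y / ln T. Loss and gain in this block are exponentials of
      multiples of w.\<close>
    define w where "w = 2 ^ i / \<kappa>"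
    have w0: "w > 0" using \<kappa>0 by (simp add: w_def)
    have wT: "ln y = w * ln (T i)" unfolding lnT w_def using \<kappa>0 by simp
    have wi: "real i \<le> w"
    proof -
      have "real i \<le> 2 ^ i" using less_exp[of i] by (metis less_imp_le of_nat_le_iff of_nat_numeral of_nat_power)
      also have "\<dots> \<le> 2 ^ i / \<kappa>" using \<kappa>0 \<kappa>1 by (simp add: le_divide_eq)
      finally show ?thesis by (simp add: w_def)
    qed
    have xT: "ln x / ln (T i) \<le> w / \<epsilon>"
    proof -
      have "\<epsilon> * ln x \<le> w * ln (T i)" using ly(1) wT by simp
      thus ?thesis using \<epsilon> lnT0[of i] by (simp add: divide_simps mult_ac)
    qed
    have xT1: "ln x / ln (T i) \<ge> 1"
    proof -
      have "ln (T i) \<le> ln x" using Tx by (intro ln_mono) (auto simp: T_def)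
      thus ?thesis using lnT0[of i] by simp
    qed
    \<comment> \<open>The largest order of tilt that keeps the local masses bounded; with Y =
      y^(1/8) it gains exp(-C w / 8).\<close>
    define \<sigma> where "\<sigma> = C / ln (T i)"
    have \<sigma>0: "\<sigma> \<ge> 0" unfolding \<sigma>_def using C8 lnT0[of i] by simp
    have \<sigma>C: "\<sigma> * ln (T i) \<le> C" unfolding \<sigma>_def using lnT0[of i] by simp
    have \<sigma>g: "\<sigma> \<le> 1 / (4 * real g)"
    proof -
      have "exp (4 * real g * C) \<le> T i" using True Tm4(2) by linarith
      hence "4 * real g * C \<le> ln (T i)" by (simp add: T_def)
      thus ?thesis unfolding \<sigma>_def using g1 lnT0[of i] by (simp add: divide_simps mult_ac)
    qed
    have Y\<sigma>: "Y powr (-\<sigma>) = exp (- (C / 8 * w))"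
    proof -
      have "Y powr (-\<sigma>) = exp (- (\<sigma> * ln y / 8))" using y1 by (simp add: Y_def powr_powr powr_def)
      also have "\<sigma> * ln y / 8 = C / 8 * w" unfolding \<sigma>_def wT using lnT0[of i] by simp
      finally show ?thesis .
    qed
    define s where "s n = (SOME s::nat. T (Suc i) < real s \<and> real s \<le> T i \<and>
      Y \<le> real (smooth_part s n) \<and> real (smooth_part s n) ^ 4 \<le> y)" for n
    have s: "t < real (s n)" "real (s n) \<le> T i" "Y \<le> real (smooth_part (s n) n)" "real (smooth_part (s n) n) ^ 4 \<le> y"
      if n: "n \<in> N2 i" for n
    proof -
      have "\<exists>s::nat. T (Suc i) < real s \<and> real s \<le> T i \<and> Y \<le> real (smooth_part s n) \<and> real (smooth_part s n) ^ 4 \<le> y"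
        using n by (simp add: N2_def)
      from someI_ex[OF this] show "t < real (s n)" "real (s n) \<le> T i" "Y \<le> real (smooth_part (s n) n)" "real (smooth_part (s n) n) ^ 4 \<le> y"
        unfolding s_def t_def by blast+
    qed
    have s': "real (s n) \<le> T i + 1" if "n \<in> N2 i" for n using s(2)[OF that] by simp
    have Y0: "Y > 0" using y1 by (simp add: Y_def)
    have cst: "(6 * real (g * (g + 1)) + 1) * ln t \<le> ln Qb"
    proof -
      have "ln t \<le> ln t0" using lt Tt0 lnT0[of i] by simp
      from lnQb[OF this] show ?thesis by (simp add: cs_def)
    qed
    have tT2: "T i \<le> t\<^sup>2" using t2T by simp
    have Ni: "x < real_of_int n" "real_of_int n \<le> x + y" "poly Qp n \<noteq> 0" if "n \<in> N2 i" for n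
      using that by (auto simp: N2_def S_def)
    show ?thesis
    proof (cases "z \<le> t")
      case zt: True
      define u where "u = Bx * ln x / ln t"
      have ux: "u = 2 * Bx * (ln x / ln (T i))" unfolding u_def lt by simp
      have u1: "u \<ge> 1"
      proof -
        have "2 * 1 * 1 \<le> 2 * Bx * (ln x / ln (T i))" using Bx1 xT1 by (intro mult_mono) auto
        thus ?thesis by (simp add: ux)
      qed
      have "real (card (N2 i)) \<le> (real V powr u) ^ r * (blockC C * y * Y powr (-\<sigma>) * (\<Prod>j=1..r. 1 / sqrt (1 + Esum (f j) j (T i))))"
      proof (rule block_count_additive[OF t2 tg tT tT2 Qb1 Qb6 cst f zt u1 \<sigma>0 \<sigma>g \<sigma>C Y0 Ni _ s(1) s' s(3,4)])
        show "real_of_int \<bar>poly Qp n\<bar> \<le> t powr u" if "n \<in> N2 i" for n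
          using Qpx[of n] that xpow[of t] t2 by (simp add: N2_def u_def)
        show "ext_even (f j) (poly (Q j) n) = k j" if "n \<in> N2 i" "j \<in> {1..r}" for n j
          using that by (simp add: N2_def S_def)
      qed
      also have "\<dots> = blockC C * (((real V powr u) ^ r * Y powr (-\<sigma>)) * (y * (\<Prod>j=1..r. 1 / sqrt (1 + Esum (f j) j (T i)))))" by (simp add: mult_ac)
      \<comment> \<open>The number of rough values is at most exp((C/8 - 1) w), by the choice of C,
        so exp(-w) survives. Half of it pays for the r-th power of the loss from stopping at T, the
        other half makes the blocks summable.\<close>
      also have "\<dots> \<le> blockC C * (exp (- w) * ((C3 * exp (w / 2)) * Z))"
      proof (rule mult_left_mono[OF mult_mono])
        have "(real V powr u) ^ r = exp (real r * u * ln (real V))" using V by (simp add: powr_def exp_of_nat_mult[symmetric] mult_ac)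
        also have "\<dots> \<le> exp (real r * (2 * Bx * (w / \<epsilon>)) * ln (real V))"
          unfolding ux using xT Bx1 lnV by (intro exp_le_cancel_iff[THEN iffD2] mult_right_mono mult_left_mono) auto
        also have "real r * (2 * Bx * (w / \<epsilon>)) * ln (real V) = (C / 8 - 1) * w" unfolding C by (simp add: field_simps)
        finally have "(real V powr u) ^ r * Y powr (-\<sigma>) \<le> exp ((C / 8 - 1) * w) * exp (- (C / 8 * w))"
          unfolding Y\<sigma> by (intro mult_right_mono) auto
        also have "\<dots> = exp (- w)" by (simp add: exp_add[symmetric] algebra_simps)
        finally show "(real V powr u) ^ r * Y powr (-\<sigma>) \<le> exp (- w)" .
        have "ln (ln x / ln (T i)) \<le> ln x / ln (T i)" using xT1 by (intro wln) auto
        hence "y * (\<Prod>j=1..r. 1 / sqrt (1 + Esum (f j) j (T i))) \<le> (1 + 2 * real g + w / \<epsilon>) ^ r * Z"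
          using xT t2 tT by (intro blockZ[OF _ Tx]) auto
        also have "(1 + 2 * real g + w / \<epsilon>) ^ r \<le> C3 * exp (w / 2)"
        proof -
          \<comment> \<open>Scaled so that in v \<le> exp(v) the r-th power produces exactly
            exp(w/2), up to the constant \<open>C3\<close>.\<close>
          define v where "v = ((1 + 2 * real g) * \<epsilon> + w) / (2 * real r)"
          have ev: "v \<le> exp v" using exp_ge_add_one_self[of v] by linarith
          have "1 + 2 * real g + w / \<epsilon> = 2 * real r / \<epsilon> * v" unfolding v_def using \<epsilon> r1 by (simp add: field_simps)
          also have "\<dots> \<le> 2 * real r / \<epsilon> * exp v" using ev \<epsilon> r1 by (intro mult_left_mono) auto
          finally have "(1 + 2 * real g + w / \<epsilon>) ^ r \<le> (2 * real r / \<epsilon> * exp v) ^ r" using w0 \<epsilon> by (intro power_mono) auto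
          also have "\<dots> = (2 * real r / \<epsilon>) ^ r * exp (real r * v)" by (simp only: power_mult_distrib exp_of_nat_mult)
          also have "real r * v = (1 + 2 * real g) * \<epsilon> / 2 + w / 2" unfolding v_def using r1 by (simp add: field_simps)
          finally show ?thesis by (simp add: C3_def exp_add mult_ac)
        qed
        finally show "y * (\<Prod>j=1..r. 1 / sqrt (1 + Esum (f j) j (T i))) \<le> C3 * exp (w / 2) * Z" using Z0 by (simp add: mult_right_mono)
        have "Esum (f j) j (T i) \<ge> 0" for j unfolding Esum_def by (intro sum_nonneg) auto
        hence "0 \<le> (\<Prod>j=1..r. 1 / sqrt (1 + Esum (f j) j (T i)))" by (intro prod_nonneg) auto
        thus "0 \<le> y * (\<Prod>j=1..r. 1 / sqrt (1 + Esum (f j) j (T i)))" using y1 by simp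
      qed (use bC0 in auto)
      also have "\<dots> = blockC C * C3 * Z * exp (- (w / 2))"
      proof -
        have "exp (- w) * exp (w / 2) = exp (- (w / 2))" by (simp add: exp_add[symmetric])
        thus ?thesis by (simp add: mult_ac)
      qed
      also have "\<dots> \<le> blockC C * C3 * Z * exp (- (1 / 2)) ^ i"
      proof (rule mult_left_mono)
        have "exp (- (1 / 2) :: real) ^ i = exp (- (real i / 2))" by (simp add: exp_of_nat_mult[symmetric])
        thus "exp (- (w / 2)) \<le> exp (- (1 / 2)) ^ i" using wi by simp
      qed (use bC0 C30 Z0 in simp)
      finally show ?thesis using bC0 y1 by (simp add: add_increasing2)
    next
      \<comment> \<open>Below z the functions are replaced by 0, for which every n satisfies the
        value conditions with targets 0 and the product over j is 1; only the Rankin gain is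
        used.\<close>
      case zt: False
      have "real (card (N2 i)) \<le> blockC C * y * Y powr (-\<sigma>) * (\<Prod>j=1..r. 1 / sqrt (1 + Esum (\<lambda>_. 0) j (T i)))"
        by (rule block_count[OF t2 tg tT tT2 Qb1 Qb6 cst _ \<sigma>0 \<sigma>g \<sigma>C Y0 Ni s(1) s' s(3,4), where f = "\<lambda>_ _. 0" and k = "\<lambda>_. 0"]) auto
      also have "\<dots> = blockC C * y * exp (- (C / 8 * w))" unfolding Y\<sigma> by (simp add: Esum_def)
      also have "\<dots> \<le> blockC C * y * exp (- (\<epsilon> / 2 * ln x powr lam))"
      proof (intro mult_left_mono exp_le_cancel_iff[THEN iffD2] neg_le_iff_le[THEN iffD2])
        \<comment> \<open>From t < z and ln y = 2 w ln t one gets w \<ge> (\<epsilon>/2)(ln x)^lam,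
          and C/8 is at least 1.\<close>
        have "ln t < ln x powr (1 - lam)" using zt tpos unfolding z_def by (metis exp_le_cancel_iff exp_ln linorder_not_le)
        hence "w * (2 * ln t) \<le> w * (2 * ln x powr (1 - lam))" using w0 by (intro mult_left_mono) auto
        hence "\<epsilon> * ln x \<le> w * (2 * ln x powr (1 - lam))" using ly(1) wT lt by simp
        moreover have "ln x = ln x powr lam * ln x powr (1 - lam)" using lx by (simp add: powr_add[symmetric])
        ultimately have "\<epsilon> * (ln x powr lam * ln x powr (1 - lam)) \<le> w * (2 * ln x powr (1 - lam))" by simp
        hence "(\<epsilon> * ln x powr lam) * ln x powr (1 - lam) \<le> (2 * w) * ln x powr (1 - lam)" by (simp add: mult_ac)
        hence "\<epsilon> * ln x powr lam \<le> 2 * w" using lx by (simp add: mult_le_cancel_right)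
        hence "\<epsilon> / 2 * ln x powr lam \<le> 1 * w" by simp
        also have "\<dots> \<le> C / 8 * w" using C8 w0 by (intro mult_right_mono) auto
        finally show "\<epsilon> / 2 * ln x powr lam \<le> C / 8 * w" .
      qed (use bC0 y1 in auto)
      finally show ?thesis using bC0 C30 Z0 by (simp add: add_increasing)
    qed
  qed
  \<comment> \<open>Blocks count only while T i > Tm \<ge> 4, which forces 2^i \<le> ln x. The
    number of blocks multiplies the part of the bound that does not decay with i.\<close>
  define I where "I = nat \<lceil>ln x\<rceil> + 1"
  define N3 where "N3 = {n :: int. x < real_of_int n \<and> real_of_int n \<le> x + y \<and> bad t0 (y powr \<kappa>2) n}"
  define N4 where "N4 = {n :: int. poly Qp n = 0}"
  have cover: "S \<subseteq> N1 \<union> (\<Union>i<I. N2 i) \<union> N3 \<union> N4"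
  proof
    fix n assume n: "n \<in> S"
    show "n \<in> N1 \<union> (\<Union>i<I. N2 i) \<union> N3 \<union> N4"
    proof (rule ccontr)
      assume not: "n \<notin> N1 \<union> (\<Union>i<I. N2 i) \<union> N3 \<union> N4"
      have nz: "poly Qp n \<noteq> 0" using not by (simp add: N4_def)
      have nb: "\<not> bad t0 (y powr \<kappa>2) n" using not n by (simp add: N3_def S_def)
      have big: "\<not> real (smooth_part (nat \<lfloor>t0\<rfloor> + 1) n) ^ 4 \<le> y" using not n nz by (simp add: N1_def)
      have Tm1: "Tm \<ge> 1" and t00: "t0 \<ge> 0" using Tm4 t0Tm by auto
      obtain s where s: "prime s" "real s \<le> t0" "real s > Tm" "real (smooth_part s n) ^ 4 \<le> y" "Y \<le> real (smooth_part s n)"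
        unfolding Y_def by (rule first_large_smooth_part[OF y1 Tm1 \<kappa>2 nz nb t00 big])
      have s2: "real s \<ge> 2" using s(1) prime_ge_2_nat[of s] by simp
      have ex: "\<exists>i. T (Suc i) < real s"
      proof -
        obtain i where i: "\<kappa> * ln y < 2 ^ i" using real_arch_pow[of 2 "\<kappa> * ln y"] by auto
        have "\<kappa> * ln y / 2 ^ Suc i < 1 / 2" using i by (simp add: divide_less_eq)
        also have "1 / 2 < ln (2 :: real)" using ln2_ge_two_thirds by simp
        also have "\<dots> \<le> ln (real s)" using s2 by (intro ln_mono) auto
        finally have "T (Suc i) < exp (ln (real s))" unfolding T_def by (simp only: exp_less_cancel_iff)
        thus ?thesis using s2 by auto
      qed
      \<comment> \<open>The least i places s between T(i + 1) and T i; for i = 0 the upper bound is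
        s \<le> t0.\<close>
      define i where "i = (LEAST i. T (Suc i) < real s)"
      have i1: "T (Suc i) < real s" unfolding i_def by (rule LeastI_ex[OF ex])
      have i2: "real s \<le> T i"
      proof (cases i)
        case 0
        thus ?thesis using s(2) T0 by simp
      next
        case (Suc i')
        hence "i' < i" by simp
        hence "\<not> T (Suc i') < real s" unfolding i_def by (rule not_less_Least)
        thus ?thesis using Suc by simp
      qed
      have TTm: "T i > Tm" using i2 s(3) by linarith
      have "i < I"
      proof -
        have "exp 1 \<le> T i"
        proof -
          have "exp 1 \<le> (3 :: real)" by (rule exp_le)
          thus ?thesis using TTm Tm4 by linarith
        qed
        hence "1 \<le> \<kappa> * ln y / 2 ^ i" unfolding T_def by simp
        hence "2 ^ i \<le> \<kappa> * ln y" by (simp add: le_divide_eq)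
        also have "\<dots> \<le> 1 * ln x" using \<kappa>1 \<kappa>0 ly ly0 by (intro mult_mono) auto
        finally have "2 ^ i \<le> ln x" by simp
        moreover have "real i < 2 ^ i" by (rule of_nat_less_two_power)
        ultimately have "real i < ln x" by linarith
        thus ?thesis unfolding I_def by linarith
      qed
      moreover have "n \<in> N2 i" unfolding N2_def using n TTm nz i1 i2 s(4,5) by blast
      ultimately show False using not by blast
    qed
  qed
  have finS: "finite S" unfolding S_def by (rule finite_int_interval)
  have fin: "finite N1" "finite (N2 i)" "finite N3" "finite N4" for i
    using finS card_zeros_le(2) by (auto simp: N1_def N2_def N3_def N4_def)
  have "card S \<le> card (N1 \<union> (\<Union>i<I. N2 i) \<union> N3 \<union> N4)" using fin cover by (intro card_mono) auto
  also have "\<dots> \<le> card N1 + card (\<Union>i<I. N2 i) + card N3 + card N4"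
    by (intro order_trans[OF card_Un_le] add_mono order_refl)
  also have "card (\<Union>i<I. N2 i) \<le> (\<Sum>i<I. card (N2 i))" by (rule card_UN_le) simp
  finally have "real (card S) \<le> real (card N1) + (\<Sum>i<I. real (card (N2 i))) + real (card N3) + real (card N4)"
    by (simp flip: of_nat_sum of_nat_add)
  moreover have "(\<Sum>i<I. real (card (N2 i))) \<le> blockC C * (3 * C3 + 1) * Z"
  proof -
    have "(\<Sum>i<I. real (card (N2 i))) \<le> (\<Sum>i<I. blockC C * C3 * Z * exp (- (1 / 2)) ^ i + blockC C * y * exp (- (\<epsilon> / 2 * ln x powr lam)))"
      by (rule sum_mono) (rule N2)
    also have "\<dots> = blockC C * C3 * Z * (\<Sum>i<I. exp (- (1 / 2)) ^ i) + real I * (blockC C * y * exp (- (\<epsilon> / 2 * ln x powr lam)))"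
      by (simp add: sum.distrib sum_distrib_left)
    also have "\<dots> \<le> blockC C * C3 * Z * 3 + blockC C * Z"
    proof (intro add_mono mult_left_mono)
      have e: "exp (- (1 / 2) :: real) \<le> 2 / 3"
      proof -
        have "3 / 2 \<le> exp (1 / 2 :: real)" using exp_ge_add_one_self[of "1 / 2 :: real"] by simp
        thus ?thesis by (simp add: exp_minus inverse_eq_divide divide_simps)
      qed
      have "(\<Sum>i<I. exp (- (1 / 2) :: real) ^ i) \<le> (\<Sum>i. exp (- (1 / 2)) ^ i)"
        using e by (intro sum_le_suminf summable_geometric) auto
      also have "\<dots> = 1 / (1 - exp (- (1 / 2)))" using e by (intro suminf_geometric) auto
      also have "\<dots> \<le> 1 / (1 / 3)" using e by (intro divide_left_mono) auto
      finally show "(\<Sum>i<I. exp (- (1 / 2) :: real) ^ i) \<le> 3" by simp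
      have I: "real I \<le> ln x + 2" unfolding I_def using lx by linarith
      define e2 where "e2 = exp (\<epsilon> / 2 * ln x powr lam)"
      have "real I * ln x ^ r \<le> (ln x + 2) * ln x ^ r" using I lx by (intro mult_right_mono) auto
      also have "\<dots> \<le> e2" using L6 by (simp add: e2_def mult.commute)
      finally have "real I / e2 \<le> 1 / ln x ^ r" using lx by (simp add: e2_def divide_simps)
      hence "blockC C * y * (real I / e2) \<le> blockC C * y * (1 / ln x ^ r)" using bC0 y1 by (intro mult_left_mono) auto
      also have "\<dots> = blockC C * (y / ln x ^ r)" by simp
      also have "\<dots> \<le> blockC C * Z" using Zge bC0 by (intro mult_left_mono)
      finally show "real I * (blockC C * y * exp (- (\<epsilon> / 2 * ln x powr lam))) \<le> blockC C * Z"
        by (simp add: e2_def exp_minus field_simps)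
    qed (use bC0 C30 Z0 in auto)
    finally show ?thesis by (simp add: algebra_simps)
  qed
  moreover have "real (card N3) \<le> 2 * real g * Z"
  proof -
    have "real (card N3) \<le> 2 * real g * y powr (1 - \<kappa>2 / (2 * real g))"
      unfolding N3_def t0_def
    proof (rule card_bad_le[OF y1 \<kappa>0 \<kappa>le _ \<kappa>20(1)])
      have "\<kappa>2 / (2 * real g) \<le> \<kappa>2 / 1" using \<kappa>20 g1 by (intro divide_left_mono) auto
      thus "\<kappa> + \<kappa>2 \<le> 1" using \<kappa>le \<kappa>20 by simp
    qed
    also have "\<dots> \<le> 2 * real g * (y / ln x ^ r)"
    proof (rule mult_left_mono)
      have "ln x ^ r \<le> (x powr \<epsilon>) powr (\<kappa>2 / (2 * real g))" using L5 by (simp add: powr_powr)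
      also have "\<dots> \<le> y powr (\<kappa>2 / (2 * real g))" using y \<kappa>20 g1 by (intro powr_mono2) auto
      finally have le: "ln x ^ r \<le> y powr (\<kappa>2 / (2 * real g))" .
      have "y powr (1 - \<kappa>2 / (2 * real g)) = y / y powr (\<kappa>2 / (2 * real g))" using y1 by (simp add: powr_diff)
      also have "\<dots> \<le> y / ln x ^ r" using le lx y1 by (intro divide_left_mono mult_pos_pos) auto
      finally show "y powr (1 - \<kappa>2 / (2 * real g)) \<le> y / ln x ^ r" .
    qed simp
    also have "\<dots> \<le> 2 * real g * Z" using Zge by (intro mult_left_mono) auto
    finally show ?thesis .
  qed
  moreover have "real (card N4) \<le> real g * Z"
  proof -
    have "ln x ^ r \<le> x powr (\<epsilon> * \<kappa>2 / (2 * real g))" by (rule L5)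
    also have "\<dots> \<le> x powr \<epsilon>"
    proof (rule powr_mono)
      have "\<kappa>2 / (2 * real g) \<le> 1 / 1" using \<kappa>20 g1 by (intro frac_le) auto
      hence "\<epsilon> * (\<kappa>2 / (2 * real g)) \<le> \<epsilon> * 1" using \<epsilon> by (intro mult_left_mono) auto
      thus "\<epsilon> * \<kappa>2 / (2 * real g) \<le> \<epsilon>" by simp
    qed (use x1 in simp)
    also have "\<dots> \<le> y" using y by simp
    finally have "1 \<le> y / ln x ^ r" using lx by (simp add: le_divide_eq)
    hence "1 \<le> Z" using Zge by linarith
    hence "real g * 1 \<le> real g * Z" by (intro mult_left_mono) auto
    moreover have "real (card N4) \<le> real g" unfolding N4_def using card_zeros_le(1) by simp
    ultimately show ?thesis by simp
  qed
  ultimately have "real (card S) \<le> A1 * Z + blockC C * (3 * C3 + 1) * Z + 2 * real g * Z + real g * Z"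
    using N1 by linarith
  thus ?thesis unfolding S_def by (simp add: algebra_simps)
qed

end

section \<open>Thresholds for x, and the choice of constants in the theorem\<close>

lemma eventually_ln_power_mult_le_exp:
  fixes c l :: real
  assumes c: "c > 0" and l: "l > 0"
  shows "eventually (\<lambda>x::real. ln x ^ r * (ln x + 2) \<le> exp (c * ln x powr l)) at_top"
proof -
  have "eventually (\<lambda>x::real. real (r + 1) * ln (ln x) + ln 3 \<le> c * ln x powr l) at_top"
    using c l by real_asymp
  moreover have "eventually (\<lambda>x::real. ln x \<ge> 1) at_top" by real_asymp
  ultimately show ?thesis
  proof eventually_elim
    case (elim x)
    have lx: "ln x > 0" using elim(2) by linarith
    have "ln x ^ r * (ln x + 2) \<le> ln x ^ r * (3 * ln x)" using elim(2) by (intro mult_left_mono) auto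
    also have "\<dots> = exp (real (r + 1) * ln (ln x) + ln 3)"
      unfolding exp_add exp_of_nat_mult using lx by simp
    also have "\<dots> \<le> exp (c * ln x powr l)" using elim(1) by simp
    finally show ?case .
  qed
qed

theorem mainTheorem1:
  fixes r g V :: nat
    and \<epsilon> \<delta> lam :: real
    and c C :: "nat \<Rightarrow> real"
  assumes "r \<ge> 1" and "g \<ge> 1" and "V \<ge> 1"
    and "0 < \<epsilon>" and "\<epsilon> < 1"
    and "0 < \<delta>" and "\<delta> < 1"
    and "0 < lam" and "lam < 1"
    and "\<And>d. c d > 0" and "\<And>d. C d > 0"
  shows "\<exists>K c0 A :: real. K > 0 \<and> c0 > 0 \<and> A > 0 \<and>
    (\<forall>(Q :: nat \<Rightarrow> int poly) (M :: nat \<Rightarrow> real) (M' :: nat \<Rightarrow> real).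
      poly_family r g Q \<longrightarrow>
      (\<forall>j\<in>{1..r}. prime_sum_bounds (c g) (C g) (Q j) (M j) (M' j)) \<longrightarrow>
      (\<forall>(x :: real) (y :: real) (f :: nat \<Rightarrow> nat \<Rightarrow> real).
        let z = exp (ln x powr (1 - lam)); Qprod = (\<Prod>j=1..r. Q j) in
        x \<ge> 1 \<longrightarrow>
        x \<ge> c0 * real_of_int (poly_height Qprod) powr \<delta> \<longrightarrow>
        x powr \<epsilon> < y \<longrightarrow> y \<le> x \<longrightarrow>
        (\<forall>j\<in>{1..r}. additive_fun (f j) \<and> value_count_bound V z (f j)) \<longrightarrow>
        (SUP k :: nat \<Rightarrow> real.
           ereal (real (card {n :: int. x < real_of_int n \<and> real_of_int n \<le> x + y \<and>
             (\<forall>j\<in>{1..r}. ext_even (f j) (poly (Q j) n) = k j)})))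
        \<le> ereal A * ereal_powr (disc_ratio Qprod) K *
           ereal (exp (3 * (\<Sum>j=1..r. M j) + (\<Sum>j=1..r. M' j) / z) * y /
             (\<Prod>j=1..r. sqrt (E_sum (f j) (\<lambda>p. real (num_roots_mod (Q j) p)) x)))))"
proof -
  define Bx where "Bx = 1 + real g + 1 / \<delta>"
  define CR where "CR = 8 * (2 * real r * Bx * ln (real V) / \<epsilon> + 1)"
  define Tm where "Tm = exp (4 * real g * CR) + 4 * (real g)\<^sup>2 + 4"
  define cs where "cs = 6 * real (g * (g + 1)) + 1"
  define \<kappa>2 where "\<kappa>2 = 1 / (8 * (Tm + 1))"
  define \<kappa> where "\<kappa> = \<kappa>2 / (24 * real g * cs)"
  define C3 where "C3 = (2 * real r / \<epsilon>) ^ r * exp ((1 + 2 * real g) * \<epsilon> / 2)"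
  define A1 where "A1 = (real V powr (Bx / (\<kappa> * \<epsilon>))) ^ r * poly_fam.blockC r g CR * (1 + 2 * real g + 1 / (\<kappa> * \<epsilon>)) ^ r"
  \<comment> \<open>The maximum secures positivity of the implied constant.\<close>
  define A where "A = max 1 (A1 + poly_fam.blockC r g CR * (3 * C3 + 1) + 3 * real g)"
  have g1: "real g \<ge> 1" using \<open>g \<ge> 1\<close> by simp
  have Tm0: "Tm > 0" unfolding Tm_def by (intro add_nonneg_pos add_nonneg_nonneg) auto
  have cs0: "cs > 0" unfolding cs_def by (intro add_nonneg_pos mult_nonneg_nonneg) auto
  have \<kappa>2e: "\<kappa>2 * (8 * (Tm + 1)) = 1" using Tm0 by (simp add: \<kappa>2_def)
  have \<kappa>e: "\<kappa> * (24 * real g * cs) = \<kappa>2" using g1 cs0 by (simp add: \<kappa>_def)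
  have \<kappa>0: "\<kappa>2 > 0" "\<kappa> > 0" using Tm0 cs0 g1 by (auto simp: \<kappa>2_def \<kappa>_def)
  have "eventually (\<lambda>x::real. ln x \<ge> 1) at_top" by real_asymp
  moreover have "eventually (\<lambda>x::real. real (g + 1) * 2 ^ g \<le> x) at_top" by (rule eventually_ge_at_top)
  moreover have "eventually (\<lambda>x::real. Tm \<le> x powr (\<epsilon> * \<kappa>)) at_top"
  proof -
    have "\<epsilon> * \<kappa> > 0" using \<open>0 < \<epsilon>\<close> \<kappa>0 by simp
    thus ?thesis by real_asymp
  qed
  moreover have "eventually (\<lambda>x::real. ln x powr (1 - lam) \<le> \<epsilon> * \<kappa> * ln x) at_top"
  proof -
    have "\<epsilon> * \<kappa> > 0" using \<open>0 < \<epsilon>\<close> \<kappa>0 by simp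
    thus ?thesis using \<open>0 < lam\<close> by real_asymp
  qed
  moreover have "eventually (\<lambda>x::real. ln x ^ r \<le> x powr (\<epsilon> * \<kappa>2 / (2 * real g))) at_top"
  proof -
    have "\<epsilon> * \<kappa>2 / (2 * real g) > 0" using \<open>0 < \<epsilon>\<close> \<kappa>0 g1 by simp
    thus ?thesis by real_asymp
  qed
  moreover have "eventually (\<lambda>x::real. ln x ^ r * (ln x + 2) \<le> exp (\<epsilon> / 2 * ln x powr lam)) at_top"
    using \<open>0 < \<epsilon>\<close> \<open>0 < lam\<close> by (intro eventually_ln_power_mult_le_exp) auto
  ultimately have "eventually (\<lambda>x::real. ln x \<ge> 1 \<and> real (g + 1) * 2 ^ g \<le> x \<and> Tm \<le> x powr (\<epsilon> * \<kappa>) \<and>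
      ln x powr (1 - lam) \<le> \<epsilon> * \<kappa> * ln x \<and> ln x ^ r \<le> x powr (\<epsilon> * \<kappa>2 / (2 * real g)) \<and>
      ln x ^ r * (ln x + 2) \<le> exp (\<epsilon> / 2 * ln x powr lam)) at_top"
    by eventually_elim blast
  then obtain X0 where X0: "\<And>x. x \<ge> X0 \<Longrightarrow> ln x \<ge> 1 \<and> real (g + 1) * 2 ^ g \<le> x \<and> Tm \<le> x powr (\<epsilon> * \<kappa>) \<and>
      ln x powr (1 - lam) \<le> \<epsilon> * \<kappa> * ln x \<and> ln x ^ r \<le> x powr (\<epsilon> * \<kappa>2 / (2 * real g)) \<and>
      ln x ^ r * (ln x + 2) \<le> exp (\<epsilon> / 2 * ln x powr lam)"
    unfolding eventually_at_top_linorder by blast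
  \<comment> \<open>Since the height is at least 1, the single hypothesis on x then gives both
    \<open>x \<ge> X0\<close> and the height bound.\<close>
  define c0 where "c0 = max 1 X0"
  \<comment> \<open>K = r, because each of the r factors 1 / sqrt E brings in
    exp(\<open>Lsum\<close>) once.\<close>
  show ?thesis
  proof (rule exI[of _ "real r"], rule exI[of _ c0], rule exI[of _ A], intro conjI allI impI)
    show "real r > 0" using \<open>r \<ge> 1\<close> by simp
    show "c0 > 0" "A > 0" by (auto simp: c0_def A_def)
    fix Q :: "nat \<Rightarrow> int poly" and M M' :: "nat \<Rightarrow> real" and x y :: real and f :: "nat \<Rightarrow> nat \<Rightarrow> real"
    assume fam: "poly_family r g Q" and MM: "\<forall>j\<in>{1..r}. prime_sum_bounds (c g) (C g) (Q j) (M j) (M' j)"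
    interpret poly_fam r g Q by unfold_locales (use fam \<open>r \<ge> 1\<close> \<open>g \<ge> 1\<close> in auto)
    define z where "z = exp (ln x powr (1 - lam))"
    have Qp: "(\<Prod>j=1..r. Q j) = Qp" by (simp only: Qp_def)
    have M0: "M j \<ge> 0" and M'0: "M' j \<ge> 0" if "j \<in> {1..r}" for j
      using MM that by (auto simp: prime_sum_bounds_def intro: order_trans[OF zero_le_one])
    have Mb: "\<bar>(\<Sum>p | prime p \<and> real p \<le> x. real (num_roots_mod (Q j) p) / real p) - ln (ln x)\<bar> \<le> M j"
      if "j \<in> {1..r}" "x \<ge> 2" for j x
      using MM that unfolding prime_sum_bounds_def by blast
    show "let z = exp (ln x powr (1 - lam)); Qprod = (\<Prod>j=1..r. Q j) in
        x \<ge> 1 \<longrightarrow>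
        x \<ge> c0 * real_of_int (poly_height Qprod) powr \<delta> \<longrightarrow>
        x powr \<epsilon> < y \<longrightarrow> y \<le> x \<longrightarrow>
        (\<forall>j\<in>{1..r}. additive_fun (f j) \<and> value_count_bound V z (f j)) \<longrightarrow>
        (SUP k :: nat \<Rightarrow> real.
           ereal (real (card {n :: int. x < real_of_int n \<and> real_of_int n \<le> x + y \<and>
             (\<forall>j\<in>{1..r}. ext_even (f j) (poly (Q j) n) = k j)})))
        \<le> ereal A * ereal_powr (disc_ratio Qprod) (real r) *
           ereal (exp (3 * (\<Sum>j=1..r. M j) + (\<Sum>j=1..r. M' j) / z) * y /
             (\<Prod>j=1..r. sqrt (E_sum (f j) (\<lambda>p. real (num_roots_mod (Q j) p)) x)))"
      unfolding Let_def Qp z_def[symmetric]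
    proof (intro impI)
      assume x1: "x \<ge> 1" and xc: "x \<ge> c0 * real_of_int (poly_height Qp) powr \<delta>"
        and y: "x powr \<epsilon> < y" "y \<le> x"
        and f: "\<forall>j\<in>{1..r}. additive_fun (f j) \<and> value_count_bound V z (f j)"
      define PE where "PE = (\<Prod>j=1..r. sqrt (E_sum (f j) (\<lambda>p. real (num_roots_mod (Q j) p)) x))"
      have PE0: "PE > 0" unfolding PE_def
      proof (rule prod_pos)
        fix j
        have "E_sum (f j) (\<lambda>p. real (num_roots_mod (Q j) p)) x > 0"
          unfolding E_sum_def by (intro add_pos_nonneg sum_nonneg) auto
        thus "0 < sqrt (E_sum (f j) (\<lambda>p. real (num_roots_mod (Q j) p)) x)" by simp
      qed
      define Z where "Z = y * (exp Lsum ^ r * (\<Prod>j=1..r. exp (M j))) / PE"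
      have h1: "real_of_int (poly_height Qp) powr \<delta> \<ge> 1"
        using poly_height_ge_1[OF Qp_nz] \<open>0 < \<delta>\<close> by (intro ge_one_powr_ge_zero) auto
      have c01: "c0 \<ge> 1" "c0 \<ge> X0" by (auto simp: c0_def)
      have height: "real_of_int (poly_height Qp) powr \<delta> \<le> x"
        using xc c01(1) h1 mult_right_mono[of 1 c0 "real_of_int (poly_height Qp) powr \<delta>"] by simp
      have "c0 * 1 \<le> c0 * real_of_int (poly_height Qp) powr \<delta>" using h1 c01 by (intro mult_left_mono) auto
      hence "x \<ge> X0" using xc c01 by linarith
      note L = X0[OF this]
      have y0: "y > 0" using y x1 by (meson less_trans order_less_le_trans powr_gt_zero less_le_not_le zero_less_one not_one_le_zero order_le_less_trans powr_ge_zero)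
      have bound: "real (card {n :: int. x < real_of_int n \<and> real_of_int n \<le> x + y \<and>
             (\<forall>j\<in>{1..r}. ext_even (f j) (poly (Q j) n) = k j)}) \<le> (A1 + blockC CR * (3 * C3 + 1) + 3 * real g) * Z" for k
        unfolding A1_def C3_def Z_def PE_def
        by (rule main_count[OF \<open>V \<ge> 1\<close> \<open>0 < \<epsilon>\<close> \<open>\<epsilon> < 1\<close> \<open>0 < \<delta>\<close> \<open>0 < lam\<close> \<open>lam < 1\<close> Bx_def CR_def Tm_def \<kappa>2e \<kappa>e[unfolded cs_def] x1])
           (use L height y f M0 Mb in \<open>auto simp: z_def\<close>)
      have PM: "(\<Prod>j=1..r. exp (M j)) \<le> exp (3 * (\<Sum>j=1..r. M j) + (\<Sum>j=1..r. M' j) / z)"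
      proof -
        have "(\<Sum>j=1..r. M j) \<ge> 0" "(\<Sum>j=1..r. M' j) \<ge> 0" using M0 M'0 by (auto intro!: sum_nonneg)
        hence "(\<Sum>j=1..r. M' j) / z \<ge> 0" by (simp add: z_def)
        thus ?thesis using \<open>(\<Sum>j=1..r. M j) \<ge> 0\<close> by (simp flip: exp_sum)
      qed
      define ex where "ex = exp (3 * (\<Sum>j=1..r. M j) + (\<Sum>j=1..r. M' j) / z)"
      have ex0: "ex > 0" by (simp add: ex_def)
      have ratio: "disc_ratio Qp = ereal (real N0) / ereal (phi_roots Qp N0)"
        by (simp add: disc_ratio_def N0_def Let_def)
      show "(SUP k :: nat \<Rightarrow> real.
           ereal (real (card {n :: int. x < real_of_int n \<and> real_of_int n \<le> x + y \<and>
             (\<forall>j\<in>{1..r}. ext_even (f j) (poly (Q j) n) = k j)})))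
        \<le> ereal A * ereal_powr (disc_ratio Qp) (real r) *
           ereal (exp (3 * (\<Sum>j=1..r. M j) + (\<Sum>j=1..r. M' j) / z) * y /
             (\<Prod>j=1..r. sqrt (E_sum (f j) (\<lambda>p. real (num_roots_mod (Q j) p)) x)))"
        unfolding PE_def[symmetric] ex_def[symmetric]
      proof (cases "phi_roots Qp N0 = 0")
        \<comment> \<open>Here \<beta>D / \<phi>_0(\<beta>D) is infinite and the remaining factors
          are positive, so the right-hand side is infinite.\<close>
        case True
        have "disc_ratio Qp = \<infinity>" unfolding ratio True using N0_pos by (simp add: divide_ereal_def)
        hence "ereal_powr (disc_ratio Qp) (real r) = \<infinity>" by (simp add: ereal_powr_def)
        moreover define b where "b = ex * y / PE"
        moreover have "b > 0" unfolding b_def using ex0 y0 PE0 by simp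
        moreover have "A > 0" by (simp add: A_def)
        ultimately have "ereal A * ereal_powr (disc_ratio Qp) (real r) * ereal (ex * y / PE) = \<infinity>"
          unfolding b_def[symmetric] by simp
        thus "(SUP k :: nat \<Rightarrow> real.
           ereal (real (card {n :: int. x < real_of_int n \<and> real_of_int n \<le> x + y \<and>
             (\<forall>j\<in>{1..r}. ext_even (f j) (poly (Q j) n) = k j)}))) \<le>
           ereal A * ereal_powr (disc_ratio Qp) (real r) * ereal (ex * y / PE)" by (simp only: top_greatest top_ereal_def[symmetric])
      next
        case False
        define R where "R = real N0 / phi_roots Qp N0"
        have R: "exp Lsum \<le> R" using exp_Lsum_le(2)[OF False] by (simp add: R_def)
        have R0: "R > 0" using R by (rule less_le_trans[OF exp_gt_zero])
        have "disc_ratio Qp = ereal R" unfolding ratio R_def using False by (simp add: divide_ereal_def inverse_eq_divide)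
        hence pw: "ereal_powr (disc_ratio Qp) (real r) = ereal (R ^ r)"
          using R0 by (simp add: ereal_powr_def powr_realpow)
        have ZR: "Z \<le> R ^ r * (ex * y / PE)"
        proof -
          have "exp Lsum ^ r * (\<Prod>j=1..r. exp (M j)) \<le> R ^ r * ex"
            using R R0 PM unfolding ex_def by (intro mult_mono power_mono prod_nonneg) auto
          hence "y * (exp Lsum ^ r * (\<Prod>j=1..r. exp (M j))) / PE \<le> y * (R ^ r * ex) / PE"
            using y0 PE0 by (intro divide_right_mono mult_left_mono) auto
          thus ?thesis by (simp add: Z_def mult_ac)
        qed
        have Z0: "Z \<ge> 0" unfolding Z_def using y0 PE0 by (intro divide_nonneg_pos mult_nonneg_nonneg prod_nonneg) auto
        have "real (card {n :: int. x < real_of_int n \<and> real_of_int n \<le> x + y \<and>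
             (\<forall>j\<in>{1..r}. ext_even (f j) (poly (Q j) n) = k j)}) \<le> A * (R ^ r * (ex * y / PE))" for k
        proof -
          note bound[of k]
          also have "(A1 + blockC CR * (3 * C3 + 1) + 3 * real g) * Z \<le> A * Z"
            using Z0 unfolding A_def by (intro mult_right_mono) auto
          also have "\<dots> \<le> A * (R ^ r * (ex * y / PE))" using ZR unfolding A_def by (intro mult_left_mono) auto
          finally show ?thesis .
        qed
        thus "(SUP k :: nat \<Rightarrow> real.
           ereal (real (card {n :: int. x < real_of_int n \<and> real_of_int n \<le> x + y \<and>
             (\<forall>j\<in>{1..r}. ext_even (f j) (poly (Q j) n) = k j)}))) \<le>
           ereal A * ereal_powr (disc_ratio Qp) (real r) * ereal (ex * y / PE)"
          unfolding pw by (intro SUP_least) (simp add: mult.assoc)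
      qed
    qed
  qed
qed

end
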